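(* There exists an invertible measure preserving strong mixing transformation $T$ on a Lebesgue probability space $(X,\mathcal{B},\mu)$ such that for every measurable set $A$ satisfying $0<\mu(A)<1$, the set $$\{n\in\mathbb{N} : \mu(T^nA\cap A)-\mu(A)^2>0\}$$ is infinite.
   Context: A Lebesgue probability space is a (non-atomic) standard probability space, i.e. isomorphic mod null sets to $[0,1]$ with Lebesgue measure. $\mathbb{N}=\{1,2,\ldots\}$. $T$ is strong mixing if $\lim_{n\to\infty}\mu(T^nA\cap B)=\mu(A)\mu(B)$ for all measurable $A,B$. *)

theory Defs
  imports "HOL-Probability.Probability"
begin

definition measure_isomorphism :: "'a measure \<Rightarrow> 'b measure \<Rightarrow> ('a \<Rightarrow> 'b) \<Rightarrow> bool" where
  "measure_isomorphism M N f \<longleftrightarrow>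
     bij_betw f (space M) (space N) \<and>
     f \<in> measurable M N \<and>
     the_inv_into (space M) f \<in> measurable N M \<and>
     distr M N f = N"

definition isomorphic_mod_null :: "'a measure \<Rightarrow> 'b measure \<Rightarrow> bool" where
  "isomorphic_mod_null M N \<longleftrightarrow>
     (\<exists>U\<in>null_sets M. \<exists>V\<in>null_sets N. \<exists>f.
        measure_isomorphism (restrict_space M (space M - U)) (restrict_space N (space N - V)) f)"

text \<open>
  The model space carries the complete Lebesgue \<open>\<sigma>\<close>-algebra, not just the Borel sets. Non-atomicity
  follows from the isomorphism.
\<close>
definition lebesgue_prob_space :: "'a measure \<Rightarrow> bool" where
  "lebesgue_prob_space M \<longleftrightarrow>
     prob_space M \<and> isomorphic_mod_null M (lebesgue_on {0..1::real})"

definition invertible_measure_preserving :: "'a measure \<Rightarrow> ('a \<Rightarrow> 'a) \<Rightarrow> bool" where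
  "invertible_measure_preserving M T \<longleftrightarrow> measure_isomorphism M M T"

text \<open>
  This is meant for invertible measure preserving \<open>T\<close>, for which the forward images \<open>(T ^^ n) ` A\<close>
  are measurable.
\<close>
definition strong_mixing :: "'a measure \<Rightarrow> ('a \<Rightarrow> 'a) \<Rightarrow> bool" where
  "strong_mixing M T \<longleftrightarrow>
     (\<forall>A\<in>sets M. \<forall>B\<in>sets M.
        (\<lambda>n. measure M ((T ^^ n) ` A \<inter> B)) \<longlonglongrightarrow> measure M A * measure M B)"

end

theory Submission
  imports Defs "HOL-Real_Asymp.Real_Asymp"
begin

text \<open>
  Why the theorem is true. Suppose \<open>\<mu>(T\<^sup>t A \<inter> A) \<le> \<mu>(A)\<^sup>2\<close> for all large \<open>t\<close>, and put
  \<open>f = 1\<^sub>A - \<mu>(A)\<close>. For times \<open>t\<^sub>1, \<dots>, t\<^sub>m\<close> with large differences, all off-diagonal terms of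
  \<open>\<parallel>\<Sum>\<^sub>k f \<circ> T^t\<^sub>k\<parallel>\<^sup>2\<close> are then nonpositive, so this norm is at most \<open>m\<close>. A mixing \<open>T\<close> that
  is, at suitable large times, almost the identity on a small part of the space contradicts this:
  if \<open>R\<close> has measure about \<open>\<epsilon>\<close>, and \<open>T^(k H)\<close> moves hardly any point of \<open>R\<close> across the boundary
  of \<open>A\<close> for \<open>k < m\<close>, then the norm is at least of the order \<open>\<epsilon> m\<^sup>2\<close>, which exceeds \<open>m\<close> once
  \<open>\<epsilon> m\<close> is large. So it suffices to find \<open>T\<close> mixing together with such sets \<open>R\<^sub>n\<close> of measure at
  most \<open>\<epsilon>\<^sub>n \<rightarrow> 0\<close>.

  Smallness of \<open>\<epsilon>\<^sub>n\<close> keeps \<open>T\<close> mixing, but an arbitrary \<open>A\<close> is only approximated by unions of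
  levels up to a set \<open>E\<close> of small measure, and \<open>E\<close> could fill \<open>R\<^sub>n\<close>. It cannot do so for all \<open>n\<close>
  when \<open>\<Sum> \<epsilon>\<^sub>n = \<infinity>\<close> and the \<open>R\<^sub>n\<close> are pairwise at most as correlated as independent sets, by the
  Cauchy-Schwarz inequality for \<open>1\<^sub>E\<close> and \<open>\<Sum>\<^sub>n 1\<^sub>R\<^sub>n\<close> (\<open>exists_rigid_part_avoiding\<close>). The choice
  \<open>\<epsilon>\<^sub>n = 1/(n+1)\<close> satisfies both demands.

  The transformation is built by cutting and stacking. The orbit block of stage \<open>n + 1\<close> consists of
  \<open>r\<^sub>n = (n+1) e\<^sub>n\<close> copies of the block of stage \<open>n\<close>, of length \<open>h\<^sub>n\<close>; the \<open>i\<close>-th copy starts at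
  \<open>i H\<^sub>n + x\<^sub>n\<^sub>i\<close>, where \<open>H\<^sub>n = h\<^sub>n + K\<^sub>n\<close> and \<open>0 \<le> x\<^sub>n\<^sub>i < K\<^sub>n\<close>. The first \<open>e\<^sub>n\<close> offsets vanish, so on
  the corresponding columns, which form \<open>R\<^sub>n\<close>, the times \<open>k H\<^sub>n\<close> return a point to its own level
  (\<open>rigid_return\<close>). All offsets together form a word in which, at every lag \<open>k \<ge> 1\<close>, the
  pairs \<open>(x\<^sub>n\<^sub>i, x\<^sub>n\<^sub>i\<^sub>+\<^sub>k)\<close> are nearly equidistributed; random words have this property by
  Hoeffding's inequality (\<open>exists_spacer_word\<close>).

  Mixing comes from the equidistribution. The correlation at time \<open>t\<close> inside the block of stage
  \<open>n + 1\<close> is a sum over pairs of copies, and only two lags \<open>k\<close> contribute. For \<open>k \<ge> 1\<close> the sum is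
  close to an average of stage \<open>n\<close> correlations over shifts \<open>a - b\<close> with \<open>a, b < K\<^sub>n\<close>, which
  involves sums over windows of \<open>K\<^sub>n\<close> consecutive positions. A function that sums to zero over the
  block of stage \<open>n - 1\<close> has window sums of size at most \<open>2 h\<^sub>n\<^sub>-\<^sub>1\<close>, far less than \<open>K\<^sub>n\<close>
  (\<open>lag_sum_bound\<close>). Summing the errors over the stages gives \<open>corr_tends_to_zero\<close>, and
  approximation by unions of levels gives \<open>flow_mixing\<close>.
\<close>

section \<open>Words with equidistributed pairs at every lag\<close>

lemma prob_pair_uniform_word:
  fixes a b K r i l :: nat
  assumes "a < K" "b < K" "i < r" "l < r" "i \<noteq> l"
  shows "measure (measure_pmf (Pi_pmf {..<r} 0 (\<lambda>_. pmf_of_set {..<K})))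
           {f. f i = a \<and> f l = b} = 1 / real K ^ 2"
proof -
  let ?A = "\<lambda>t. if t = i then {a} else if t = l then {b} else (UNIV :: nat set)"
  have ne: "{..<K} \<noteq> {}" using assms(1) by auto
  have "{f. f i = a \<and> f l = b} = Pi {..<r} ?A"
    using assms by (auto simp: Pi_def)
  then have "measure (measure_pmf (Pi_pmf {..<r} 0 (\<lambda>_. pmf_of_set {..<K}))) {f. f i = a \<and> f l = b}
     = (\<Prod>t<r. measure (measure_pmf (pmf_of_set {..<K})) (?A t))"
    by (simp add: measure_Pi_pmf_Pi)
  also have "\<dots> = (\<Prod>t\<in>{i, l}. measure (measure_pmf (pmf_of_set {..<K})) (?A t))"
    using assms by (intro prod.mono_neutral_right) auto
  also have "\<dots> = 1 / real K ^ 2"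
    using assms ne by (simp add: measure_pmf_of_set power2_eq_square)
  finally show ?thesis .
qed

text \<open>
  The indicators of the event \<open>f i = a, f (i + k) = b\<close> are independent as long as the pairs
  \<open>{i, i + k}\<close> are disjoint; splitting the positions \<open>i\<close> by the parity of \<open>i div k\<close>
  makes them so, and Hoeffding's inequality applies to each half.
\<close>

lemma pair_count_deviation_half:
  fixes a b K r k c :: nat and s :: real
  assumes "a < K" "b < K" "1 \<le> k" "s > 0" "r > 0"
  defines "P \<equiv> Pi_pmf {..<r} 0 (\<lambda>_. pmf_of_set {..<K})"
  defines "J \<equiv> {i. i < r - k \<and> (i div k) mod 2 = c}"
  shows "measure (measure_pmf P)
     {f. \<bar>(\<Sum>i\<in>J. of_bool (f i = a \<and> f (i + k) = b)) - real (card J) / real K ^ 2\<bar> \<ge> s}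
       \<le> 2 * exp (-2 * s ^ 2 / real r)"
proof (cases "J = {}")
  case True
  then show ?thesis unfolding True using assms(4) by simp
next
  case False
  have finJ: "finite J" unfolding J_def by auto
  have ind: "prob_space.indep_vars (measure_pmf P) (\<lambda>_. count_space UNIV) (\<lambda>i f. f i) {..<r}"
    unfolding P_def by (rule indep_vars_Pi_pmf) auto
  have disj: "disjoint_family_on (\<lambda>i. {i, i + k}) J"
  proof (unfold disjoint_family_on_def, intro ballI impI)
    fix m n assume mn: "m \<in> J" "n \<in> J" "m \<noteq> n"
    have "m \<noteq> n + k" if "(m div k) mod 2 = (n div k) mod 2" for m n
    proof
      assume "m = n + k"
      then have "m div k = Suc (n div k)" using assms(3) by auto
      moreover have "Suc q mod 2 \<noteq> q mod 2" for q :: nat by presburger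
      ultimately show False using that by metis
    qed
    then show "{m, m + k} \<inter> {n, n + k} = {}" using mn by (auto simp: J_def)
  qed
  (* Y j depends on the two coordinates j and j + k only, so independence of the disjoint blocks of
     coordinates passes to the variables Y j. *)
  define Y :: "nat \<Rightarrow> (nat \<Rightarrow> nat) \<Rightarrow> real" where "Y j g = of_bool (g j = a \<and> g (j + k) = b)" for j g
  have pairs: "prob_space.indep_vars (measure_pmf P) (\<lambda>j. PiM {j, j + k} (\<lambda>_. count_space UNIV))
          (\<lambda>j \<omega>. restrict (\<lambda>i. \<omega> i) {j, j + k}) J"
    by (rule prob_space.indep_vars_restrict[OF measure_pmf.prob_space_axioms ind _ disj]) (auto simp: J_def)
  have Ymeas: "Y j \<in> borel_measurable (PiM {j, j + k} (\<lambda>_. count_space UNIV))" for j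
  proof -
    have "{g. g t = u} \<inter> space (PiM {j, j + k} (\<lambda>_. count_space UNIV)) \<in> sets (PiM {j, j + k} (\<lambda>_. count_space UNIV))"
      if "t \<in> {j, j + k}" for t u :: nat
      using measurable_sets[OF measurable_component_singleton[OF that], of "{u}" "\<lambda>_. count_space UNIV"]
      by (simp add: vimage_def)
    from sets.Int[OF this[of j a] this[of "j + k" b]]
    have "{g. g j = a \<and> g (j + k) = b} \<inter> space (PiM {j, j + k} (\<lambda>_. count_space UNIV))
        \<in> sets (PiM {j, j + k} (\<lambda>_. count_space UNIV))"
      by (simp add: Int_def conj_ac cong: conj_cong)
    then have "indicator {g. g j = a \<and> g (j + k) = b} \<in> borel_measurable (PiM {j, j + k} (\<lambda>_. count_space UNIV))"
      by (simp add: borel_measurable_indicator_iff Int_commute)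
    moreover have "Y j = indicator {g. g j = a \<and> g (j + k) = b}"
      by (auto simp: Y_def indicator_def)
    ultimately show ?thesis by simp
  qed
  have "prob_space.indep_vars (measure_pmf P) (\<lambda>_. borel) (\<lambda>j \<omega>. Y j (restrict (\<lambda>i. \<omega> i) {j, j + k})) J"
    using prob_space.indep_vars_compose2[OF measure_pmf.prob_space_axioms pairs, of Y "\<lambda>_. borel"] Ymeas by simp
  then have ind': "prob_space.indep_vars (measure_pmf P) (\<lambda>_. borel) (\<lambda>j \<omega>. of_bool (\<omega> j = a \<and> \<omega> (j + k) = b) :: real) J"
    by (simp add: Y_def)
  interpret Hf: Hoeffding_ineq "measure_pmf P" J "\<lambda>j \<omega>. of_bool (\<omega> j = a \<and> \<omega> (j + k) = b) :: real"
    "\<lambda>_. 0" "\<lambda>_. 1" "\<Sum>j\<in>J. measure_pmf.expectation P (\<lambda>\<omega>. of_bool (\<omega> j = a \<and> \<omega> (j + k) = b) :: real)"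
    by unfold_locales (use finJ ind' in auto)
  have "measure_pmf.expectation P (\<lambda>\<omega>. of_bool (\<omega> j = a \<and> \<omega> (j + k) = b) :: real) = 1 / real K ^ 2" if "j \<in> J" for j
  proof -
    have "(\<lambda>\<omega>. of_bool (\<omega> j = a \<and> \<omega> (j + k) = b) :: real) = indicator {f. f j = a \<and> f (j + k) = b}"
      by (auto simp: indicator_def)
    then have "measure_pmf.expectation P (\<lambda>\<omega>. of_bool (\<omega> j = a \<and> \<omega> (j + k) = b) :: real)
        = measure (measure_pmf P) {f. f j = a \<and> f (j + k) = b}"
      by simp
    also have "\<dots> = 1 / real K ^ 2"
      unfolding P_def using that assms(1-3) by (intro prob_pair_uniform_word) (auto simp: J_def)
    finally show ?thesis .
  qed
  then have mu: "(\<Sum>j\<in>J. measure_pmf.expectation P (\<lambda>\<omega>. of_bool (\<omega> j = a \<and> \<omega> (j + k) = b) :: real))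
     = real (card J) / real K ^ 2"
    by simp
  have "card J \<le> card {..<r}" by (intro card_mono) (auto simp: J_def)
  then have cJ: "real (card J) \<le> real r" by simp
  have cpos: "card J > 0" using False finJ by (simp add: card_gt_0_iff)
  have "measure (measure_pmf P)
     {f. \<bar>(\<Sum>i\<in>J. of_bool (f i = a \<and> f (i + k) = b)) - real (card J) / real K ^ 2\<bar> \<ge> s}
    \<le> 2 * exp (-2 * s ^ 2 / real (card J))"
    using Hf.Hoeffding_ineq_abs_ge[of s] assms cpos unfolding mu by simp
  also have "\<dots> \<le> 2 * exp (-2 * s ^ 2 / real r)"
    using cJ cpos assms by (auto simp: divide_simps mult_left_mono)
  finally show ?thesis .
qed

lemma pair_count_deviation:
  fixes a b K r k :: nat and s :: real
  assumes "a < K" "b < K" "1 \<le> k" "s > 0" "r > 0"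
  defines "P \<equiv> Pi_pmf {..<r} 0 (\<lambda>_. pmf_of_set {..<K})"
  shows "measure (measure_pmf P)
     {f. \<bar>(\<Sum>i<r-k. of_bool (f i = a \<and> f (i + k) = b)) - real (r - k) / real K ^ 2\<bar> \<ge> s}
       \<le> 4 * exp (- (s ^ 2 / (2 * real r)))"
proof -
  define J where "J c = {i. i < r - k \<and> (i div k) mod 2 = c}" for c :: nat
  define B where "B c = {f :: nat \<Rightarrow> nat. \<bar>(\<Sum>i\<in>J c. of_bool (f i = a \<and> f (i + k) = b))
      - real (card (J c)) / real K ^ 2\<bar> \<ge> s / 2}" for c
  have split: "{..<r-k} = J 0 \<union> J 1" "J 0 \<inter> J 1 = {}" "finite (J 0)" "finite (J 1)"
    by (auto simp: J_def)
  have card: "r - k = card (J 0) + card (J 1)"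
    using card_Un_disjoint[OF split(3,4,2)] split(1) by (metis card_lessThan)
  have "{f. \<bar>(\<Sum>i<r-k. of_bool (f i = a \<and> f (i + k) = b)) - real (r - k) / real K ^ 2\<bar> \<ge> s}
      \<subseteq> B 0 \<union> B 1"
  proof
    fix f :: "nat \<Rightarrow> nat"
    let ?S = "\<lambda>A. \<Sum>i\<in>A. of_bool (f i = a \<and> f (i + k) = b) :: real"
    have S: "?S {..<r-k} = ?S (J 0) + ?S (J 1)"
      unfolding split(1) using split(2-4) by (intro sum.union_disjoint) auto
    have C: "real (r - k) / real K ^ 2 = real (card (J 0)) / real K ^ 2 + real (card (J 1)) / real K ^ 2"
      unfolding card by (simp add: add_divide_distrib)
    assume "f \<in> {f. \<bar>(\<Sum>i<r-k. of_bool (f i = a \<and> f (i + k) = b)) - real (r - k) / real K ^ 2\<bar> \<ge> s}"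
    then have "\<bar>?S {..<r-k} - real (r - k) / real K ^ 2\<bar> \<ge> s" by simp
    then show "f \<in> B 0 \<union> B 1" unfolding B_def S C Un_iff mem_Collect_eq by arith
  qed
  then have "measure (measure_pmf P) {f. \<bar>(\<Sum>i<r-k. of_bool (f i = a \<and> f (i + k) = b)) - real (r - k) / real K ^ 2\<bar> \<ge> s}
     \<le> measure (measure_pmf P) (B 0 \<union> B 1)"
    by (intro measure_pmf.finite_measure_mono) auto
  also have "\<dots> \<le> measure (measure_pmf P) (B 0) + measure (measure_pmf P) (B 1)"
    by (intro measure_Un_le) auto
  also have "\<dots> \<le> 2 * exp (-2 * (s/2) ^ 2 / real r) + 2 * exp (-2 * (s/2) ^ 2 / real r)"
    unfolding B_def J_def P_def using assms by (intro add_mono pair_count_deviation_half) auto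
  finally show ?thesis by (simp add: power_divide field_simps)
qed

text \<open>
  A uniformly random word of length \<open>r\<close> has equidistributed pairs with positive probability:
  there are only \<open>r K\<^sup>2\<close> triples of a lag and two letters, and each of the deviations has
  probability exponentially small in \<open>r\<close>.
\<close>

lemma exists_equidistributed_word:
  fixes K :: nat and \<delta> :: real
  assumes "K > 0" "\<delta> > 0"
  shows "\<exists>R. \<forall>r\<ge>R. \<exists>y :: nat \<Rightarrow> nat. (\<forall>i. y i < K) \<and>
     (\<forall>k\<ge>1. \<forall>a<K. \<forall>b<K.
        \<bar>(\<Sum>i<r-k. of_bool (y i = a \<and> y (i + k) = b)) - real (r - k) / real K ^ 2\<bar> \<le> \<delta> * r)"
proof -
  have "((\<lambda>r :: real. r * (real K ^ 2 * (4 * exp (- (\<delta>^2 * r / 2))))) \<longlongrightarrow> 0) at_top"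
    using assms by real_asymp
  then have "eventually (\<lambda>r :: real. r * (real K ^ 2 * (4 * exp (- (\<delta>^2 * r / 2)))) < 1) at_top"
    by (rule order_tendstoD) auto
  then have "eventually (\<lambda>r :: nat. real r * (real K ^ 2 * (4 * exp (- (\<delta>^2 * real r / 2)))) < 1) at_top"
    using filterlim_real_sequentially by (rule eventually_compose_filterlim)
  then obtain R0 where R0: "\<And>r :: nat. r \<ge> R0 \<Longrightarrow> real r * (real K ^ 2 * (4 * exp (- (\<delta>^2 * real r / 2)))) < 1"
    by (auto simp: eventually_at_top_linorder)
  show ?thesis
  proof (rule exI[of _ "max 1 R0"], intro allI impI)
    fix r :: nat assume r: "r \<ge> max 1 R0"
    define P where "P = Pi_pmf {..<r} 0 (\<lambda>_. pmf_of_set {..<K})"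
    define B where "B = (\<lambda>(k, a, b). {f :: nat \<Rightarrow> nat. \<bar>(\<Sum>i<r-k. of_bool (f i = a \<and> f (i + k) = b))
         - real (r - k) / real K ^ 2\<bar> \<ge> \<delta> * r})"
    define I where "I = {1..<r} \<times> {..<K} \<times> {..<K}"
    have bound: "measure (measure_pmf P) (B t) \<le> 4 * exp (- (\<delta>^2 * real r / 2))" if "t \<in> I" for t
    proof -
      obtain k a b where t: "t = (k, a, b)" by (cases t) auto
      have "measure (measure_pmf P) (B t) \<le> 4 * exp (- ((\<delta> * r) ^ 2 / (2 * real r)))"
        unfolding t B_def P_def split using that r assms
        by (intro pair_count_deviation) (auto simp: t I_def)
      also have "(\<delta> * r) ^ 2 / (2 * real r) = \<delta>^2 * real r / 2"
        using r by (simp add: power2_eq_square field_simps)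
      finally show ?thesis .
    qed
    have cI: "card I = (r - 1) * K ^ 2" by (simp add: I_def card_cartesian_product power2_eq_square)
    have "measure (measure_pmf P) (\<Union>t\<in>I. B t) \<le> (\<Sum>t\<in>I. measure (measure_pmf P) (B t))"
      by (intro measure_pmf.finite_measure_subadditive_finite) (auto simp: I_def)
    also have "\<dots> \<le> (\<Sum>t\<in>I. 4 * exp (- (\<delta>^2 * real r / 2)))"
      by (intro sum_mono bound)
    also have "\<dots> = real (r - 1) * (real K ^ 2 * (4 * exp (- (\<delta>^2 * real r / 2))))"
      by (simp add: cI)
    also have "\<dots> \<le> real r * (real K ^ 2 * (4 * exp (- (\<delta>^2 * real r / 2))))"
      by (intro mult_right_mono) auto
    also have "\<dots> < 1" using R0[of r] r by auto
    finally have lt: "measure (measure_pmf P) (\<Union>t\<in>I. B t) < 1" .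
    have "\<exists>f\<in>set_pmf P. f \<notin> (\<Union>t\<in>I. B t)"
    proof (rule ccontr)
      assume "\<not> ?thesis"
      then have "set_pmf P \<subseteq> (\<Union>t\<in>I. B t)" by auto
      then have "measure (measure_pmf P) (\<Union>t\<in>I. B t) = 1"
        by (subst measure_pmf.prob_eq_1) (auto simp: AE_measure_pmf_iff)
      with lt show False by simp
    qed
    then obtain f where f: "f \<in> set_pmf P" "f \<notin> (\<Union>t\<in>I. B t)" by auto
    have ne: "{..<K} \<noteq> {}" using assms by auto
    have fK: "f i < K" for i
      using f(1) assms(1) ne unfolding P_def
      by (cases "i < r") (auto simp: set_Pi_pmf PiE_dflt_def)
    show "\<exists>y. (\<forall>i. y i < K) \<and> (\<forall>k\<ge>1. \<forall>a<K. \<forall>b<K.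
        \<bar>(\<Sum>i<r-k. of_bool (y i = a \<and> y (i + k) = b)) - real (r - k) / real K ^ 2\<bar> \<le> \<delta> * r)"
    proof (intro exI[of _ f] conjI allI impI)
      fix k a b :: nat assume k: "k \<ge> 1" "a < K" "b < K"
      show "\<bar>(\<Sum>i<r-k. of_bool (f i = a \<and> f (i + k) = b)) - real (r - k) / real K ^ 2\<bar> \<le> \<delta> * r"
      proof (cases "k < r")
        case True
        then have "f \<notin> B (k, a, b)" using f(2) k by (auto simp: I_def)
        then show ?thesis by (simp add: B_def)
      qed (use assms in auto)
    qed (rule fK)
  qed
qed

text \<open>
  Overwriting the first \<open>e\<close> letters by \<open>0\<close> disturbs at most \<open>e\<close> pairs at each lag.
  Testing against a function \<open>\<psi>\<close> of two letters instead of single pairs of letters is the form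
  that correlations need.
\<close>

lemma exists_spacer_word:
  fixes K n :: nat
  assumes "K > 0"
  shows "\<exists>E. \<forall>e\<ge>E. \<exists>x :: nat \<Rightarrow> nat. (\<forall>i. x i < K) \<and> (\<forall>i<e. x i = 0) \<and>
     (\<forall>k\<ge>1. \<forall>\<psi> :: nat \<Rightarrow> nat \<Rightarrow> real. (\<forall>a<K. \<forall>b<K. \<bar>\<psi> a b\<bar> \<le> 1) \<longrightarrow>
        \<bar>(\<Sum>i<Suc n * e - k. \<psi> (x i) (x (i + k)))
           - real (Suc n * e - k) / real K ^ 2 * (\<Sum>a<K. \<Sum>b<K. \<psi> a b)\<bar> \<le> 3 * real e)"
proof -
  define \<delta> where "\<delta> = 1 / (real K ^ 2 * real (Suc n))"
  have "\<delta> > 0" using assms by (simp add: \<delta>_def)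
  from exists_equidistributed_word[OF assms this] obtain R where R:
    "\<And>r. r \<ge> R \<Longrightarrow> \<exists>y :: nat \<Rightarrow> nat. (\<forall>i. y i < K) \<and>
     (\<forall>k\<ge>1. \<forall>a<K. \<forall>b<K.
        \<bar>(\<Sum>i<r-k. of_bool (y i = a \<and> y (i + k) = b)) - real (r - k) / real K ^ 2\<bar> \<le> \<delta> * r)"
    by blast
  show ?thesis
  proof (rule exI[of _ R], intro allI impI)
    fix e assume e: "e \<ge> R"
    define r where "r = Suc n * e"
    have "r \<ge> R" using e by (simp add: r_def)
    from R[OF this] obtain y :: "nat \<Rightarrow> nat" where y: "\<And>i. y i < K"
      "\<And>k a b. k \<ge> 1 \<Longrightarrow> a < K \<Longrightarrow> b < K \<Longrightarrow>
        \<bar>(\<Sum>i<r-k. of_bool (y i = a \<and> y (i + k) = b)) - real (r - k) / real K ^ 2\<bar> \<le> \<delta> * r"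
      by blast
    define x where "x i = (if i < e then 0 else y i)" for i
    have xK: "x i < K" for i using y(1) assms by (simp add: x_def)
    have main: "\<bar>(\<Sum>i<r-k. \<psi> (x i) (x (i + k))) - real (r - k) / real K ^ 2 * (\<Sum>a<K. \<Sum>b<K. \<psi> a b)\<bar>
          \<le> 3 * real e"
      if k: "k \<ge> 1" and \<psi>: "\<forall>a<K. \<forall>b<K. \<bar>\<psi> a b\<bar> \<le> 1" for k and \<psi> :: "nat \<Rightarrow> nat \<Rightarrow> real"
    proof -
      have "\<bar>(\<Sum>i<r-k. \<psi> (x i) (x (i + k))) - (\<Sum>i<r-k. \<psi> (y i) (y (i + k)))\<bar>
          \<le> (\<Sum>i<r-k. \<bar>\<psi> (x i) (x (i + k)) - \<psi> (y i) (y (i + k))\<bar>)"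
        by (simp add: sum_subtractf[symmetric])
      also have "\<dots> \<le> (\<Sum>i<r-k. 2 * of_bool (i < e))"
      proof (intro sum_mono)
        fix i
        have "\<bar>\<psi> (x i) (x (i + k))\<bar> \<le> 1" "\<bar>\<psi> (y i) (y (i + k))\<bar> \<le> 1" using \<psi> xK y(1) by auto
        then show "\<bar>\<psi> (x i) (x (i + k)) - \<psi> (y i) (y (i + k))\<bar> \<le> 2 * of_bool (i < e)"
          by (cases "i < e") (auto simp: x_def)
      qed
      also have "\<dots> = 2 * real (card ({..<r-k} \<inter> {..<e}))"
        by (simp add: sum_distrib_left[symmetric] Int_def)
      also have "\<dots> \<le> 2 * real e"
        using card_mono[of "{..<e}" "{..<r-k} \<inter> {..<e}"] by auto
      finally have d1: "\<bar>(\<Sum>i<r-k. \<psi> (x i) (x (i + k))) - (\<Sum>i<r-k. \<psi> (y i) (y (i + k)))\<bar> \<le> 2 * real e" .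
      define N where "N a b = (\<Sum>i<r-k. of_bool (y i = a \<and> y (i + k) = b) :: real)" for a b
      have "(\<Sum>i<r-k. \<psi> (y i) (y (i + k)))
         = (\<Sum>i<r-k. \<Sum>a<K. \<Sum>b<K. \<psi> a b * of_bool (y i = a \<and> y (i + k) = b))"
      proof (intro sum.cong refl)
        fix i
        have "(\<Sum>a<K. \<Sum>b<K. \<psi> a b * of_bool (y i = a \<and> y (i + k) = b))
            = (\<Sum>a<K. if a = y i then (\<Sum>b<K. if y (i + k) = b then \<psi> a b else 0) else 0)"
          by (intro sum.cong refl) (auto intro!: sum.cong)
        then show "\<psi> (y i) (y (i + k)) = (\<Sum>a<K. \<Sum>b<K. \<psi> a b * of_bool (y i = a \<and> y (i + k) = b))"
          using y(1) by (simp add: sum.delta)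
      qed
      also have "\<dots> = (\<Sum>a<K. \<Sum>i<r-k. \<Sum>b<K. \<psi> a b * of_bool (y i = a \<and> y (i + k) = b))"
        by (rule sum.swap)
      also have "\<dots> = (\<Sum>a<K. \<Sum>b<K. \<Sum>i<r-k. \<psi> a b * of_bool (y i = a \<and> y (i + k) = b))"
        by (intro sum.cong refl sum.swap)
      also have "\<dots> = (\<Sum>a<K. \<Sum>b<K. \<psi> a b * N a b)"
        by (simp only: N_def sum_distrib_left)
      finally have "(\<Sum>i<r-k. \<psi> (y i) (y (i + k))) - real (r - k) / real K ^ 2 * (\<Sum>a<K. \<Sum>b<K. \<psi> a b)
         = (\<Sum>a<K. \<Sum>b<K. \<psi> a b * (N a b - real (r - k) / real K ^ 2))"
        by (simp add: sum_distrib_left sum_subtractf sum_divide_distrib right_diff_distrib mult.commute)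
      also have "\<bar>\<dots>\<bar> \<le> (\<Sum>a<K. \<Sum>b<K. \<bar>\<psi> a b * (N a b - real (r - k) / real K ^ 2)\<bar>)"
        by (intro order.trans[OF sum_abs] sum_mono sum_abs)
      also have "\<dots> \<le> (\<Sum>a<K. \<Sum>b<K. 1 * (\<delta> * r))"
        unfolding abs_mult using \<psi> y(2)[OF k] \<open>\<delta> > 0\<close>
        by (intro sum_mono mult_mono) (auto simp: N_def)
      also have "\<dots> = real e"
        using assms by (simp add: \<delta>_def r_def power2_eq_square del: of_nat_Suc mult_Suc)
      finally have d2: "\<bar>(\<Sum>i<r-k. \<psi> (y i) (y (i + k))) - real (r - k) / real K ^ 2 * (\<Sum>a<K. \<Sum>b<K. \<psi> a b)\<bar>
         \<le> real e" .
      have "\<bar>X - Z\<bar> \<le> 3 * real e" if "\<bar>X - Y\<bar> \<le> 2 * real e" "\<bar>Y - Z\<bar> \<le> real e" for X Y Z :: real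
        using that by linarith
      from this[OF d1 d2] show ?thesis .
    qed
    show "\<exists>x. (\<forall>i. x i < K) \<and> (\<forall>i<e. x i = 0) \<and> (\<forall>k\<ge>1. \<forall>\<psi> :: nat \<Rightarrow> nat \<Rightarrow> real.
       (\<forall>a<K. \<forall>b<K. \<bar>\<psi> a b\<bar> \<le> 1) \<longrightarrow>
        \<bar>(\<Sum>i<Suc n * e - k. \<psi> (x i) (x (i + k)))
           - real (Suc n * e - k) / real K ^ 2 * (\<Sum>a<K. \<Sum>b<K. \<psi> a b)\<bar> \<le> 3 * real e)"
      using xK main by (intro exI[of _ x]) (auto simp: x_def r_def simp del: mult_Suc)
  qed
qed

section \<open>Correlations of sequences\<close>

text \<open>
  A block of length \<open>L\<close> is encoded as a function on the integers that vanishes outside \<open>{0..<L}\<close>.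
  Shifted copies and overlaps of blocks then need no case distinctions.
\<close>

definition supported :: "nat \<Rightarrow> (int \<Rightarrow> real) \<Rightarrow> bool" where
  "supported L u \<longleftrightarrow> (\<forall>j. j < 0 \<or> int L \<le> j \<longrightarrow> u j = 0)"

definition corr :: "nat \<Rightarrow> (int \<Rightarrow> real) \<Rightarrow> (int \<Rightarrow> real) \<Rightarrow> int \<Rightarrow> real" where
  "corr L u v t = (\<Sum>j\<in>{0..<int L}. u j * v (j + t))"

definition prefix_sum :: "(int \<Rightarrow> real) \<Rightarrow> int \<Rightarrow> real" where
  "prefix_sum u z = (\<Sum>j\<in>{0..<z}. u j)"

lemma sum_supported:
  assumes "supported L u" "a \<le> 0" "int L \<le> b"
  shows "(\<Sum>j\<in>{a..<b}. u j * g j) = (\<Sum>j\<in>{0..<int L}. u j * g j)"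
  using assms by (intro sum.mono_neutral_right) (auto simp: supported_def)

lemma corr_eq_0:
  assumes "supported L v" "int L \<le> \<bar>t\<bar>"
  shows "corr L u v t = 0"
  unfolding corr_def
proof (intro sum.neutral ballI)
  fix j assume "j \<in> {0..<int L}"
  then have "j + t < 0 \<or> int L \<le> j + t" using assms(2) by auto
  then show "u j * v (j + t) = 0" using assms(1) by (auto simp: supported_def)
qed

lemma corr_bound:
  assumes "\<And>j. \<bar>u j\<bar> \<le> 1" "\<And>j. \<bar>v j\<bar> \<le> 1"
  shows "\<bar>corr L u v t\<bar> \<le> real L"
proof -
  have "\<bar>corr L u v t\<bar> \<le> (\<Sum>j\<in>{0..<int L}. \<bar>u j * v (j + t)\<bar>)"
    unfolding corr_def by (rule sum_abs)
  also have "\<dots> \<le> (\<Sum>j\<in>{0..<int L}. 1)"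
    using assms by (intro sum_mono) (auto simp: abs_mult intro: mult_le_one)
  finally show ?thesis by simp
qed

text \<open>
  The bound for shifts under which only the last \<open>t\<close> positions of one copy meet the other one.
\<close>

lemma corr_bound_overlap:
  assumes "\<And>j. \<bar>u j\<bar> \<le> 1" "\<And>j. \<bar>v j\<bar> \<le> 1" "supported L v" "0 \<le> t" "m \<le> t - int L"
  shows "\<bar>corr L u v m\<bar> \<le> real_of_int t"
proof -
  have "corr L u v m = (\<Sum>j\<in>{max 0 (int L - t)..<int L}. u j * v (j + m))"
    unfolding corr_def using assms by (intro sum.mono_neutral_right) (auto simp: supported_def)
  also have "\<bar>\<dots>\<bar> \<le> (\<Sum>j\<in>{max 0 (int L - t)..<int L}. \<bar>u j * v (j + m)\<bar>)"
    by (rule sum_abs)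
  also have "\<dots> \<le> (\<Sum>j\<in>{max 0 (int L - t)..<int L}. 1)"
    using assms by (intro sum_mono) (auto simp: abs_mult intro: mult_le_one)
  also have "\<dots> \<le> real_of_int t" using assms by simp
  finally show ?thesis .
qed

lemma prefix_sum_step:
  assumes "supported L u"
  shows "prefix_sum u (y + 1) - prefix_sum u y = u y"
proof (cases "0 \<le> y")
  case True
  then have "{0..<y+1} = insert y {0..<y}" by auto
  then show ?thesis by (simp add: prefix_sum_def)
qed (use assms in \<open>auto simp: prefix_sum_def supported_def\<close>)

lemma window_sum_eq:
  assumes "supported L u"
  shows "(\<Sum>b<N. u (z - int b)) = prefix_sum u (z + 1) - prefix_sum u (z + 1 - int N)"
proof (induction N)
  case (Suc N)
  have "u (z - int N) = prefix_sum u (z - int N + 1) - prefix_sum u (z - int N)"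
    using prefix_sum_step[OF assms, of "z - int N"] by simp
  then show ?case using Suc by (simp add: algebra_simps)
qed simp

text \<open>
  For a block with sum zero the prefix sums again form a block, so that everything known about
  concatenating blocks applies to them.
\<close>

lemma prefix_sum_supported:
  assumes "supported L u" "prefix_sum u (int L) = 0"
  shows "supported L (prefix_sum u)"
  unfolding supported_def
proof (intro allI impI)
  fix j assume "j < 0 \<or> int L \<le> j"
  then show "prefix_sum u j = 0"
  proof
    assume "int L \<le> j"
    then have "prefix_sum u j = prefix_sum u (int L)"
      unfolding prefix_sum_def using assms(1)
      by (intro sum.mono_neutral_right) (auto simp: supported_def)
    then show ?thesis using assms by simp
  qed (auto simp: prefix_sum_def)
qed

lemma prefix_sum_bound:
  assumes "supported L u" "\<And>j. \<bar>u j\<bar> \<le> 1"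
  shows "\<bar>prefix_sum u z\<bar> \<le> real L"
proof -
  have "prefix_sum u z = (\<Sum>j\<in>{0..<min z (int L)}. u j)"
    unfolding prefix_sum_def using assms(1)
    by (intro sum.mono_neutral_right) (auto simp: supported_def)
  also have "\<bar>\<dots>\<bar> \<le> (\<Sum>j\<in>{0..<min z (int L)}. \<bar>u j\<bar>)" by (rule sum_abs)
  also have "\<dots> \<le> (\<Sum>j\<in>{0..<min z (int L)}. 1)" using assms by (intro sum_mono) auto
  also have "\<dots> \<le> real L" by simp
  finally show ?thesis .
qed

section \<open>Blocks built from spaced copies, and the decay of their correlations\<close>

text \<open>
  The combinatorial data of the construction. At stage \<open>n\<close> a block has length \<open>h n\<close>, and the next
  block is made of \<open>Suc n * e n\<close> copies of it with offsets \<open>x n i\<close> below \<open>K n\<close>. The offset range of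
  stage \<open>Suc n\<close> is much longer than the previous block, \<open>K (Suc n) \<ge> 2 ^ n * h n\<close>, which makes
  averages over offsets small, and much shorter than the current block if \<open>e n\<close> grows fast, which
  keeps the total measure finite. The first \<open>e n\<close> offsets are zero; these are a fraction \<open>1 / Suc n\<close> of all.
\<close>

locale block_structure =
  fixes e h K :: "nat \<Rightarrow> nat" and x :: "nat \<Rightarrow> nat \<Rightarrow> nat"
  assumes h_0: "h 0 = 1" and K_0: "K 0 = 1"
    and h_Suc: "h (Suc n) = Suc n * e n * (h n + K n)"
    and K_Suc: "K (Suc n) = 2 ^ n * (h n + K n)"
    and e_ge: "2 * (Suc n)\<^sup>2 \<le> e n"
    and x_less: "x n i < K n"
    and x_zero: "i < e n \<Longrightarrow> x n i = 0"
    and x_equidistributed: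
      "1 \<le> k \<Longrightarrow> (\<And>a b. a < K n \<Longrightarrow> b < K n \<Longrightarrow> \<bar>\<psi> a b\<bar> \<le> (1::real)) \<Longrightarrow>
        \<bar>(\<Sum>i<Suc n * e n - k. \<psi> (x n i) (x n (i + k)))
           - real (Suc n * e n - k) / real (K n) ^ 2 * (\<Sum>a<K n. \<Sum>b<K n. \<psi> a b)\<bar> \<le> 3 * real (e n)"
begin

definition r :: "nat \<Rightarrow> nat" where "r n = Suc n * e n"
definition H :: "nat \<Rightarrow> nat" where "H n = h n + K n"
definition copy_start :: "nat \<Rightarrow> nat \<Rightarrow> int" where "copy_start n i = int i * int (H n) + int (x n i)"

lemma K_pos: "K n > 0"
  using x_less[of n 0] by auto

lemma e_pos: "e n > 0"
  using e_ge[of n] by (auto intro: gr0I)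

lemma r_ge: "2 * Suc n \<le> r n"
proof -
  have "2 * 1 \<le> 2 * (Suc n)\<^sup>2" by simp
  also have "\<dots> \<le> e n" by (rule e_ge)
  finally have "Suc n * 2 \<le> Suc n * e n" by (intro mult_le_mono) auto
  then show ?thesis by (simp add: r_def)
qed

lemma r_pos: "r n > 0"
  using r_ge[of n] by simp

lemma h_Suc': "h (Suc n) = r n * H n"
  by (simp add: h_Suc r_def H_def)

lemma h_pos: "h n > 0"
  by (cases n) (use r_pos K_pos in \<open>auto simp: h_0 h_Suc' H_def\<close>)

lemma h_less_H: "h n < H n"
  using K_pos by (simp add: H_def)

lemma H_le_h_Suc: "2 * H n \<le> h (Suc n)"
  unfolding h_Suc' using r_ge[of n] by (intro mult_le_mono) auto

lemma h_double: "2 * h n \<le> h (Suc n)"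
  using H_le_h_Suc[of n] h_less_H[of n] by simp

lemma h_ge_power: "2 ^ d * h n \<le> h (n + d)"
proof (induction d)
  case (Suc d)
  then show ?case using h_double[of "n + d"] by simp
qed simp

lemma H_gt: "n < H n"
  using order.strict_trans2[OF less_exp[of n] h_ge_power[of n 0, simplified h_0 mult_1_right add_0]] h_less_H[of n]
  by simp

lemma copy_start_nonneg: "0 \<le> copy_start n i"
  by (simp add: copy_start_def)

lemma copy_start_end: "i < r n \<Longrightarrow> copy_start n i + int (h n) < int (h (Suc n))"
proof -
  assume "i < r n"
  then have "Suc i * H n \<le> r n * H n" by (intro mult_le_mono) auto
  then have "int i * int (H n) + int (H n) \<le> int (h (Suc n))"
    unfolding h_Suc' of_nat_mult[symmetric] of_nat_add[symmetric] of_nat_le_iff by (simp add: add.commute)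
  then show ?thesis using x_less[of n i] by (simp add: copy_start_def H_def)
qed

lemma copy_start_gap:
  assumes "i < l"
  shows "copy_start n i + int (h n) < copy_start n l"
proof -
  have "Suc i * H n \<le> l * H n" using assms by (intro mult_le_mono) auto
  then have "int i * int (H n) + int (H n) \<le> int l * int (H n)"
    unfolding of_nat_mult[symmetric] of_nat_add[symmetric] of_nat_le_iff by (simp add: add.commute)
  then show ?thesis using x_less[of n i] by (simp add: copy_start_def H_def)
qed

text \<open>
  The block of stage \<open>Suc n\<close> that carries a copy of \<open>u\<close> at each start position and zeros on the
  spacers.
\<close>

definition concat_copies :: "nat \<Rightarrow> (int \<Rightarrow> real) \<Rightarrow> int \<Rightarrow> real" where
  "concat_copies n u j = (\<Sum>i<r n. u (j - copy_start n i))"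

lemma concat_copies_at:
  assumes "supported (h n) u" "i < r n" "0 \<le> j" "j < int (h n)"
  shows "concat_copies n u (copy_start n i + j) = u j"
proof -
  have "u (copy_start n i + j - copy_start n l) = 0" if "l < r n" "l \<noteq> i" for l
  proof (cases "l < i")
    case True
    then show ?thesis using copy_start_gap[OF True, of n] assms by (auto simp: supported_def)
  next
    case False
    then have "i < l" using that by simp
    then show ?thesis using copy_start_gap[of i l n] assms by (auto simp: supported_def)
  qed
  then have "concat_copies n u (copy_start n i + j) = (\<Sum>l\<in>{i}. u (copy_start n i + j - copy_start n l))"
    unfolding concat_copies_def using assms by (intro sum.mono_neutral_right) auto
  then show ?thesis by simp
qed

text \<open>
  Copies do not overlap, so at most one summand is nonzero.
\<close>

lemma concat_copies_cases:
  assumes "supported (h n) u"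
  obtains "concat_copies n u j = 0"
  | i where "i < r n" "0 \<le> j - copy_start n i" "j - copy_start n i < int (h n)" "concat_copies n u j = u (j - copy_start n i)"
proof (cases "\<exists>i<r n. 0 \<le> j - copy_start n i \<and> j - copy_start n i < int (h n)")
  case True
  then obtain i where i: "i < r n" "0 \<le> j - copy_start n i" "j - copy_start n i < int (h n)" by auto
  then show ?thesis using concat_copies_at[OF assms i] that(2) by simp
next
  case False
  then have "concat_copies n u j = 0"
    unfolding concat_copies_def
  proof (intro sum.neutral ballI)
    fix i assume "i \<in> {..<r n}"
    with False have "\<not> (0 \<le> j - copy_start n i \<and> j - copy_start n i < int (h n))" by blast
    then have "j - copy_start n i < 0 \<or> int (h n) \<le> j - copy_start n i" by linarith
    then show "u (j - copy_start n i) = 0" using assms by (auto simp: supported_def)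
  qed
  then show ?thesis using that(1) by simp
qed

lemma concat_copies_bound:
  assumes "supported (h n) u" "\<And>j. \<bar>u j\<bar> \<le> B"
  shows "\<bar>concat_copies n u j\<bar> \<le> B"
proof (cases rule: concat_copies_cases[OF assms(1), of j])
  case 1
  then show ?thesis using assms(2)[of 0] by simp
qed (use assms(2) in simp)

lemma concat_copies_supported:
  assumes "supported (h n) u"
  shows "supported (h (Suc n)) (concat_copies n u)"
  unfolding supported_def
proof (intro allI impI)
  fix j assume j: "j < 0 \<or> int (h (Suc n)) \<le> j"
  show "concat_copies n u j = 0"
  proof (cases rule: concat_copies_cases[OF assms, of j])
    case (2 i)
    then show ?thesis using j copy_start_nonneg[of n i] copy_start_end[of i n] by auto
  qed
qed

lemma prefix_sum_concat_copies:
  assumes "supported (h n) u"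
  shows "prefix_sum (concat_copies n u) z = concat_copies n (prefix_sum u) z"
proof -
  have "prefix_sum (concat_copies n u) z = (\<Sum>i<r n. \<Sum>j\<in>{0..<z}. u (j - copy_start n i))"
    unfolding prefix_sum_def concat_copies_def by (rule sum.swap)
  also have "\<dots> = (\<Sum>i<r n. prefix_sum u (z - copy_start n i))"
  proof (intro sum.cong refl)
    fix i
    have "(\<Sum>j\<in>{0..<z}. u (j - copy_start n i)) = (\<Sum>m\<in>{- copy_start n i..<z - copy_start n i}. u m)"
      by (rule sum.reindex_bij_witness[of _ "\<lambda>m. m + copy_start n i" "\<lambda>j. j - copy_start n i"]) auto
    also have "\<dots> = prefix_sum u (z - copy_start n i)"
      unfolding prefix_sum_def using assms copy_start_nonneg[of n i]
      by (intro sum.mono_neutral_right) (auto simp: supported_def)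
    finally show "(\<Sum>j\<in>{0..<z}. u (j - copy_start n i)) = prefix_sum u (z - copy_start n i)" .
  qed
  finally show ?thesis by (simp add: concat_copies_def)
qed

lemma concat_copies_sum_zero:
  assumes "supported (h n) u" "prefix_sum u (int (h n)) = 0"
  shows "prefix_sum (concat_copies n u) (int (h (Suc n))) = 0"
  using concat_copies_supported[OF prefix_sum_supported[OF assms]]
  by (simp add: prefix_sum_concat_copies[OF assms(1)] supported_def)

text \<open>
  A window meets at most two copies only partially, and complete copies sum to zero. In terms of
  prefix sums: those of the concatenation are the concatenation of the prefix sums of \<open>u\<close>, hence
  bounded by the length of one block however long the window is.
\<close>

lemma window_sum_bound:
  assumes "supported (h n) u" "prefix_sum u (int (h n)) = 0" "\<And>j. \<bar>u j\<bar> \<le> 1"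
  shows "\<bar>\<Sum>b<N. concat_copies n u (z - int b)\<bar> \<le> 2 * real (h n)"
proof -
  have B: "\<bar>prefix_sum (concat_copies n u) y\<bar> \<le> real (h n)" for y
    unfolding prefix_sum_concat_copies[OF assms(1)]
    by (rule concat_copies_bound[OF prefix_sum_supported[OF assms(1,2)]])
       (rule prefix_sum_bound[OF assms(1,3)])
  show ?thesis
    unfolding window_sum_eq[OF concat_copies_supported[OF assms(1)]]
    using B[of "z + 1"] B[of "z + 1 - int N"] by linarith
qed

lemma corr_concat_copies:
  assumes "supported (h n) u"
  shows "corr (h (Suc n)) (concat_copies n u) (concat_copies n v) t =
    (\<Sum>i<r n. \<Sum>l<r n. corr (h n) u v (t + copy_start n i - copy_start n l))"
proof -
  have "corr (h (Suc n)) (concat_copies n u) (concat_copies n v) t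
      = (\<Sum>j\<in>{0..<int (h (Suc n))}. \<Sum>i<r n. \<Sum>l<r n. u (j - copy_start n i) * v (j + t - copy_start n l))"
    unfolding corr_def concat_copies_def by (simp add: sum_product)
  also have "\<dots> = (\<Sum>i<r n. \<Sum>j\<in>{0..<int (h (Suc n))}. \<Sum>l<r n. u (j - copy_start n i) * v (j + t - copy_start n l))"
    by (rule sum.swap)
  also have "\<dots> = (\<Sum>i<r n. \<Sum>l<r n. \<Sum>j\<in>{0..<int (h (Suc n))}. u (j - copy_start n i) * v (j + t - copy_start n l))"
    by (intro sum.cong refl sum.swap)
  also have "\<dots> = (\<Sum>i<r n. \<Sum>l<r n. corr (h n) u v (t + copy_start n i - copy_start n l))"
  proof (intro sum.cong refl)
    fix i l assume "i \<in> {..<r n}"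
    then have i: "i < r n" by simp
    have "(\<Sum>j\<in>{0..<int (h (Suc n))}. u (j - copy_start n i) * v (j + t - copy_start n l))
        = (\<Sum>m\<in>{- copy_start n i..<int (h (Suc n)) - copy_start n i}. u m * v (m + (t + copy_start n i - copy_start n l)))"
      by (rule sum.reindex_bij_witness[of _ "\<lambda>m. m + copy_start n i" "\<lambda>j. j - copy_start n i"])
         (auto simp: algebra_simps)
    also have "\<dots> = corr (h n) u v (t + copy_start n i - copy_start n l)"
      unfolding corr_def using copy_start_nonneg[of n i] copy_start_end[OF i]
      by (intro sum_supported[OF assms]) auto
    finally show "(\<Sum>j\<in>{0..<int (h (Suc n))}. u (j - copy_start n i) * v (j + t - copy_start n l))
        = corr (h n) u v (t + copy_start n i - copy_start n l)" .
  qed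
  finally show ?thesis .
qed

definition lag_sum :: "nat \<Rightarrow> (int \<Rightarrow> real) \<Rightarrow> (int \<Rightarrow> real) \<Rightarrow> nat \<Rightarrow> int \<Rightarrow> real" where
  "lag_sum n u v k s = (\<Sum>i<r n - k. corr (h n) u v (s + int (x n i) - int (x n (i + k))))"

text \<open>
  Copies \<open>i\<close> and \<open>l\<close> are shifted against each other by \<open>(i - l) H + x\<^sub>i - x\<^sub>l\<close>, and offsets are
  shorter than \<open>K = H - h\<close>. With \<open>t = k H + s\<close>, the shifted copies can only overlap if \<open>l - i\<close> is
  \<open>k\<close> or \<open>k + 1\<close>.
\<close>

lemma corr_concat_copies_lags:
  assumes "supported (h n) u" "supported (h n) v"
  shows "corr (h (Suc n)) (concat_copies n u) (concat_copies n v) (int t) =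
    lag_sum n u v (t div H n) (int (t mod H n)) +
    lag_sum n u v (Suc (t div H n)) (int (t mod H n) - int (H n))"
proof -
  define k where "k = t div H n"
  define s where "s = t mod H n"
  have t: "int t = int k * int (H n) + int s"
    unfolding k_def s_def of_nat_mult[symmetric] of_nat_add[symmetric] by simp
  have Hpos: "int (H n) > 0" and sH: "int s < int (H n)"
    using h_less_H[of n] by (auto simp: s_def)
  define c where "c i l = corr (h n) u v (int t + copy_start n i - copy_start n l)" for i l
  (* All lags other than k and k + 1 shift the copies apart by at least h n. *)
  have c0: "c i l = 0" if "l \<noteq> i + k" "l \<noteq> Suc (i + k)" for i l
  proof -
    let ?d = "int k + int i - int l"
    have arg: "int t + copy_start n i - copy_start n l = ?d * int (H n) + int s + int (x n i) - int (x n l)"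
      unfolding t copy_start_def by (simp add: algebra_simps)
    have xi: "int (x n i) < int (K n)" "int (x n l) < int (K n)" using x_less by auto
    have HK: "int (H n) = int (h n) + int (K n)" by (simp add: H_def)
    have "?d \<ge> 1 \<or> ?d \<le> -2" using that by presburger
    then have "int (h n) \<le> \<bar>int t + copy_start n i - copy_start n l\<bar>"
    proof
      assume "?d \<ge> 1"
      then have "1 * int (H n) \<le> ?d * int (H n)" using Hpos by (intro mult_right_mono) auto
      then show ?thesis unfolding arg using xi HK by linarith
    next
      assume "?d \<le> -2"
      then have "?d * int (H n) \<le> (-2) * int (H n)" using Hpos by (intro mult_right_mono) auto
      then show ?thesis unfolding arg using xi HK sH by linarith
    qed
    then show ?thesis unfolding c_def by (rule corr_eq_0[OF assms(2)])
  qed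
  have row: "(\<Sum>l<r n. c i l) = (if i < r n - k then c i (i + k) else 0)
      + (if i < r n - Suc k then c i (i + Suc k) else 0)" for i
  proof -
    have "(\<Sum>l<r n. c i l) = (\<Sum>l<r n. (if l = i + k then c i (i + k) else 0)
        + (if l = i + Suc k then c i (i + Suc k) else 0))"
      using c0 by (intro sum.cong refl) auto
    also have "\<dots> = (if i + k < r n then c i (i + k) else 0)
      + (if i + Suc k < r n then c i (i + Suc k) else 0)"
      by (simp add: sum.distrib)
    finally show ?thesis by (simp add: less_diff_conv)
  qed
  have part: "(\<Sum>i<r n. if i < r n - m then c i (i + m) else 0) = (\<Sum>i<r n - m. c i (i + m))" for m
    by (rule sum.mono_neutral_cong_right) auto
  have "corr (h (Suc n)) (concat_copies n u) (concat_copies n v) (int t) = (\<Sum>i<r n. \<Sum>l<r n. c i l)"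
    unfolding c_def by (rule corr_concat_copies[OF assms(1)])
  also have "\<dots> = (\<Sum>i<r n - k. c i (i + k)) + (\<Sum>i<r n - Suc k. c i (i + Suc k))"
    unfolding row sum.distrib part ..
  also have "(\<Sum>i<r n - k. c i (i + k)) = lag_sum n u v k (int s)"
    unfolding lag_sum_def c_def t copy_start_def by (simp add: algebra_simps)
  also have "(\<Sum>i<r n - Suc k. c i (i + Suc k)) = lag_sum n u v (Suc k) (int s - int (H n))"
    unfolding lag_sum_def c_def t copy_start_def by (simp add: algebra_simps)
  finally show ?thesis unfolding k_def s_def .
qed

text \<open>
  The first summand is the equidistribution error \<open>3 e / r\<close> of the offsets, the second one a bound for
  the relative size \<open>2 h\<^sub>n\<^sub>-\<^sub>1 / K\<^sub>n\<close> of window sums, valid from stage \<open>1\<close> on.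
\<close>

definition lag_error :: "nat \<Rightarrow> real" where
  "lag_error n = 3 / (real n + 1) + 4 / 2 ^ n"

lemma lag_error_nonneg: "0 \<le> lag_error n"
  by (simp add: lag_error_def)

lemma smoothed_corr_bound:
  assumes "supported (h n) v" "prefix_sum v (int (h n)) = 0" "\<And>j. \<bar>v j\<bar> \<le> 1" "\<And>j. \<bar>u j\<bar> \<le> 1"
  shows "\<bar>\<Sum>a<K m. \<Sum>b<K m. corr L u (concat_copies n v) (s + int a - int b)\<bar>
    \<le> real (K m) * (real L * (2 * real (h n)))"
proof -
  have "(\<Sum>b<K m. corr L u (concat_copies n v) (s + int a - int b))
      = (\<Sum>j\<in>{0..<int L}. u j * (\<Sum>b<K m. concat_copies n v ((j + s + int a) - int b)))" for a
    unfolding corr_def by (subst sum.swap) (simp add: sum_distrib_left algebra_simps)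
  moreover have "\<bar>\<Sum>j\<in>{0..<int L}. u j * (\<Sum>b<K m. concat_copies n v ((j + s + int a) - int b))\<bar>
     \<le> real L * (2 * real (h n))" for a
  proof -
    have "\<bar>\<Sum>j\<in>{0..<int L}. u j * (\<Sum>b<K m. concat_copies n v ((j + s + int a) - int b))\<bar>
      \<le> (\<Sum>j\<in>{0..<int L}. \<bar>u j\<bar> * \<bar>\<Sum>b<K m. concat_copies n v ((j + s + int a) - int b)\<bar>)"
      unfolding abs_mult[symmetric] by (rule sum_abs)
    also have "\<dots> \<le> (\<Sum>j\<in>{0..<int L}. 1 * (2 * real (h n)))"
      using assms(4) by (intro sum_mono mult_mono window_sum_bound assms(1-3)) auto
    finally show ?thesis by simp
  qed
  ultimately have "\<bar>\<Sum>b<K m. corr L u (concat_copies n v) (s + int a - int b)\<bar> \<le> real L * (2 * real (h n))" for a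
    by simp
  then have "(\<Sum>a<K m. \<bar>\<Sum>b<K m. corr L u (concat_copies n v) (s + int a - int b)\<bar>)
      \<le> (\<Sum>a<K m. real L * (2 * real (h n)))"
    by (intro sum_mono)
  then show ?thesis by (intro order.trans[OF sum_abs]) simp
qed

text \<open>
  This is where the offsets produce decay: by equidistribution, the sum over copies at lag \<open>k \<ge> 1\<close>
  is close to \<open>r - k\<close> times the average over independent offsets \<open>a\<close> and \<open>b\<close>, and the average over
  \<open>b\<close> alone is already a window sum.
\<close>

lemma lag_sum_bound:
  assumes "supported (h n) v" "prefix_sum v (int (h n)) = 0" "\<And>j. \<bar>v j\<bar> \<le> 1" "\<And>j. \<bar>u j\<bar> \<le> 1" "1 \<le> k"
  shows "\<bar>lag_sum (Suc n) u (concat_copies n v) k s\<bar>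
    \<le> real (h (Suc n)) * real (r (Suc n)) * lag_error (Suc n)"
proof -
  define m where "m = Suc n"
  define V where "V = concat_copies n v"
  define \<psi> where "\<psi> a b = corr (h m) u V (s + int a - int b) / real (h m)" for a b
  have Vb: "\<bar>V j\<bar> \<le> 1" for j
    unfolding V_def by (rule concat_copies_bound[OF assms(1,3)])
  have hm: "real (h m) > 0" using h_pos by simp
  have Km: "real (K m) > 0" using K_pos by simp
  have "\<bar>\<psi> a b\<bar> \<le> 1" for a b
    using corr_bound[of u V "h m" "s + int a - int b", OF assms(4) Vb] hm by (simp add: \<psi>_def)
  then have 1: "\<bar>(\<Sum>i<r m - k. \<psi> (x m i) (x m (i + k)))
       - real (r m - k) / real (K m) ^ 2 * (\<Sum>a<K m. \<Sum>b<K m. \<psi> a b)\<bar> \<le> 3 * real (e m)"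
    unfolding r_def by (intro x_equidistributed assms(5)) auto
  have "(\<Sum>a<K m. \<Sum>b<K m. \<psi> a b) = (\<Sum>a<K m. \<Sum>b<K m. corr (h m) u V (s + int a - int b)) / real (h m)"
    by (simp add: \<psi>_def sum_divide_distrib)
  then have "\<bar>\<Sum>a<K m. \<Sum>b<K m. \<psi> a b\<bar> \<le> real (K m) * (real (h m) * (2 * real (h n))) / real (h m)"
    using smoothed_corr_bound[where n = n and v = v and u = u and m = m and L = "h m" and s = s, OF assms(1-4)] hm
    by (simp add: V_def pos_divide_le_eq mult_ac)
  then have 2: "\<bar>\<Sum>a<K m. \<Sum>b<K m. \<psi> a b\<bar> \<le> real (K m) * (2 * real (h n))"
    using hm by simp
  have "\<bar>real (r m - k) / real (K m) ^ 2 * (\<Sum>a<K m. \<Sum>b<K m. \<psi> a b)\<bar>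
      = real (r m - k) / real (K m) ^ 2 * \<bar>\<Sum>a<K m. \<Sum>b<K m. \<psi> a b\<bar>"
    by (simp add: abs_mult)
  also have "\<dots> \<le> real (r m) / real (K m) ^ 2 * (real (K m) * (2 * real (h n)))"
    by (intro mult_mono 2 divide_right_mono) auto
  also have "\<dots> = real (r m) * (2 * real (h n) / real (K m))"
    using Km by (simp add: power2_eq_square)
  also have "2 * real (h n) / real (K m) \<le> 4 / 2 ^ m"
    using h_pos[of n] K_pos[of n] by (simp add: m_def K_Suc divide_simps)
  finally have 3: "\<bar>real (r m - k) / real (K m) ^ 2 * (\<Sum>a<K m. \<Sum>b<K m. \<psi> a b)\<bar> \<le> real (r m) * (4 / 2 ^ m)"
    by (simp add: mult_left_mono)
  have "real (r m) = (real m + 1) * real (e m)" by (simp add: r_def algebra_simps)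
  then have 4: "3 * real (e m) = real (r m) * (3 / (real m + 1))" by simp
  have "lag_sum m u V k s = real (h m) * (\<Sum>i<r m - k. \<psi> (x m i) (x m (i + k)))"
    using hm by (simp add: lag_sum_def \<psi>_def sum_distrib_left)
  then have "\<bar>lag_sum m u V k s\<bar> = real (h m) * \<bar>\<Sum>i<r m - k. \<psi> (x m i) (x m (i + k))\<bar>"
    using hm by (simp add: abs_mult)
  also have "\<dots> \<le> real (h m) * (real (r m) * (3 / (real m + 1)) + real (r m) * (4 / 2 ^ m))"
  proof (intro mult_left_mono)
    have "\<bar>X\<bar> \<le> B + C" if "\<bar>X - Y\<bar> \<le> B" "\<bar>Y\<bar> \<le> C" for X Y B C :: real using that by linarith
    from this[OF 1[unfolded 4] 3]
    show "\<bar>\<Sum>i<r m - k. \<psi> (x m i) (x m (i + k))\<bar> \<le> real (r m) * (3 / (real m + 1)) + real (r m) * (4 / 2 ^ m)" .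
  qed simp
  also have "\<dots> = real (h m) * real (r m) * lag_error m"
    by (simp add: lag_error_def algebra_simps)
  finally show ?thesis by (simp add: m_def V_def)
qed

text \<open>
  The sequence of all later blocks generated by one block of stage \<open>q\<close>: the values, along the orbit
  block, of a function that is constant on the levels of stage \<open>q\<close> and vanishes on later spacers.
\<close>

definition block_lifts :: "nat \<Rightarrow> (nat \<Rightarrow> int \<Rightarrow> real) \<Rightarrow> bool" where
  "block_lifts q U \<longleftrightarrow> supported (h q) (U q) \<and> (\<forall>j. \<bar>U q j\<bar> \<le> 1) \<and>
     (\<forall>n\<ge>q. U (Suc n) = concat_copies n (U n))"

lemma block_lifts_props:
  assumes "block_lifts q U" "q \<le> n"
  shows "supported (h n) (U n)" "\<bar>U n j\<bar> \<le> 1" "U (Suc n) = concat_copies n (U n)"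
proof -
  have "supported (h n) (U n) \<and> (\<forall>j. \<bar>U n j\<bar> \<le> 1)"
    using assms(2)
  proof (induction n rule: dec_induct)
    case base
    then show ?case using assms(1) by (simp add: block_lifts_def)
  next
    case (step n)
    then show ?case
      using assms(1) concat_copies_supported concat_copies_bound by (simp add: block_lifts_def)
  qed
  then show "supported (h n) (U n)" "\<bar>U n j\<bar> \<le> 1" by auto
  show "U (Suc n) = concat_copies n (U n)" using assms by (simp add: block_lifts_def)
qed

lemma block_lifts_sum_zero:
  assumes "block_lifts q V" "prefix_sum (V q) (int (h q)) = 0" "q \<le> n"
  shows "prefix_sum (V n) (int (h n)) = 0"
  using assms(3)
proof (induction n rule: dec_induct)
  case (step n)
  then show ?case
    using block_lifts_props[OF assms(1), of n] concat_copies_sum_zero[of n "V n"] by simp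
qed (rule assms(2))

text \<open>
  Beyond \<open>H n\<close> both contributing lags are positive.
\<close>

lemma corr_far:
  assumes "block_lifts q U" "block_lifts q V" "prefix_sum (V q) (int (h q)) = 0" "q < n" "H n \<le> t"
  shows "\<bar>corr (h (Suc n)) (U (Suc n)) (V (Suc n)) (int t)\<bar> \<le> 2 * lag_error n * real (h (Suc n))"
proof -
  obtain m where n: "n = Suc m" using assms(4) by (cases n) auto
  have qm: "q \<le> m" and qn: "q \<le> n" using assms(4) n by auto
  note U = block_lifts_props[OF assms(1) qn]
  note V = block_lifts_props[OF assms(2) qn]
  note Vm = block_lifts_props[OF assms(2) qm]
  have lag: "\<bar>lag_sum n (U n) (V n) k s\<bar> \<le> real (h n) * real (r n) * lag_error n" if "1 \<le> k" for k s
    using lag_sum_bound[of m "V m" "U n" k s, OF Vm(1) block_lifts_sum_zero[OF assms(2,3) qm] Vm(2) U(2) that]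
    unfolding n[symmetric] Vm(3)[symmetric] .
  have "1 \<le> t div H n" using assms(5) h_less_H[of n] by (simp add: div_greater_zero_iff Suc_le_eq)
  then have "\<bar>corr (h (Suc n)) (U (Suc n)) (V (Suc n)) (int t)\<bar> \<le> 2 * (real (h n) * real (r n) * lag_error n)"
    unfolding U(3) V(3) corr_concat_copies_lags[OF U(1) V(1)]
    using lag[of "t div H n" "int (t mod H n)"] lag[of "Suc (t div H n)" "int (t mod H n) - int (H n)"]
    by linarith
  also have "real (h n) * real (r n) * lag_error n \<le> real (H n) * real (r n) * lag_error n"
    using h_less_H[of n] lag_error_nonneg by (intro mult_right_mono) auto
  finally show ?thesis by (simp add: h_Suc' mult_ac)
qed

text \<open>
  Below \<open>H n\<close> lag \<open>0\<close> reproduces the correlation of stage \<open>n\<close>, and lag \<open>1\<close> adds an error. The error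
  has two bounds: the one from equidistribution, and the trivial one \<open>t / h n\<close>, which is summable
  over the later stages.
\<close>

lemma corr_near:
  assumes "block_lifts q U" "block_lifts q V" "prefix_sum (V q) (int (h q)) = 0" "q < n" "t < H n"
  shows "\<bar>corr (h (Suc n)) (U (Suc n)) (V (Suc n)) (int t)\<bar> / real (h (Suc n))
     \<le> \<bar>corr (h n) (U n) (V n) (int t)\<bar> / real (h n) + min (lag_error n) (real t / real (h n))"
proof -
  obtain m where n: "n = Suc m" using assms(4) by (cases n) auto
  have qm: "q \<le> m" and qn: "q \<le> n" using assms(4) n by auto
  note U = block_lifts_props[OF assms(1) qn]
  note V = block_lifts_props[OF assms(2) qn]
  note Vm = block_lifts_props[OF assms(2) qm]
  let ?s = "int t - int (H n)"
  have lag1: "\<bar>lag_sum n (U n) (V n) 1 ?s\<bar> \<le> real (h n) * real (r n) * lag_error n"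
    using lag_sum_bound[of m "V m" "U n" 1 ?s, OF Vm(1) block_lifts_sum_zero[OF assms(2,3) qm] Vm(2) U(2) order_refl]
    unfolding n[symmetric] Vm(3)[symmetric] .
  have "\<bar>lag_sum n (U n) (V n) 1 ?s\<bar> \<le> (\<Sum>i<r n - 1. real t)"
    unfolding lag_sum_def
  proof (intro order.trans[OF sum_abs] sum_mono)
    fix i
    have "?s + int (x n i) - int (x n (i + 1)) \<le> int t - int (h n)"
      using x_less[of n i] by (simp add: H_def)
    from corr_bound_overlap[of "U n" "V n" "h n" "int t", OF U(2) V(2) V(1) _ this]
    show "\<bar>corr (h n) (U n) (V n) (?s + int (x n i) - int (x n (i + 1)))\<bar> \<le> real t" by simp
  qed
  also have "\<dots> \<le> real (r n) * real t" by (simp add: mult_right_mono)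
  finally have lag2: "\<bar>lag_sum n (U n) (V n) 1 ?s\<bar> \<le> real (r n) * real t" .
  have lag0: "lag_sum n (U n) (V n) 0 (int t) = real (r n) * corr (h n) (U n) (V n) (int t)"
    by (simp add: lag_sum_def)
  have split: "corr (h (Suc n)) (U (Suc n)) (V (Suc n)) (int t)
     = real (r n) * corr (h n) (U n) (V n) (int t) + lag_sum n (U n) (V n) 1 ?s"
    unfolding U(3) V(3) corr_concat_copies_lags[OF U(1) V(1)] using assms(5) lag0 by simp
  have pos: "real (h n) > 0" "real (r n) > 0" "real (H n) > 0" "real (h n) \<le> real (H n)"
    using h_pos r_pos h_less_H[of n] by auto
  have "\<bar>corr (h (Suc n)) (U (Suc n)) (V (Suc n)) (int t)\<bar>
      \<le> real (r n) * \<bar>corr (h n) (U n) (V n) (int t)\<bar> + real (r n) * real (h n) * min (lag_error n) (real t / real (h n))"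
  proof -
    have "\<bar>lag_sum n (U n) (V n) 1 ?s\<bar> \<le> real (r n) * real (h n) * min (lag_error n) (real t / real (h n))"
      using lag1 lag2 pos by (auto simp: min_def mult_ac)
    then show ?thesis unfolding split
      by (intro order.trans[OF abs_triangle_ineq] add_mono) (simp_all add: abs_mult)
  qed
  also have "\<dots> = real (r n) * real (h n) * (\<bar>corr (h n) (U n) (V n) (int t)\<bar> / real (h n) + min (lag_error n) (real t / real (h n)))"
    using pos by (simp add: field_simps)
  also have "\<dots> \<le> real (r n) * real (H n) * (\<bar>corr (h n) (U n) (V n) (int t)\<bar> / real (h n) + min (lag_error n) (real t / real (h n)))"
    using pos lag_error_nonneg[of n] by (intro mult_right_mono mult_left_mono add_nonneg_nonneg) auto
  finally show ?thesis
    using pos by (simp add: h_Suc' divide_simps mult_ac)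
qed

definition mixing_error :: "nat \<Rightarrow> real" where
  "mixing_error m = 2 * lag_error m + lag_error (Suc m) + 2 / (real m + 2)"

lemma mixing_error_tendsto_0: "mixing_error \<longlonglongrightarrow> 0"
  unfolding mixing_error_def lag_error_def by real_asymp

text \<open>
  Once \<open>t\<close> lies between \<open>H m\<close> and \<open>H (Suc m)\<close>, stage \<open>Suc m\<close> gives the bound \<open>2 * lag_error m\<close>,
  stage \<open>m + 2\<close> adds \<open>lag_error (Suc m)\<close>, and all later stages together add a geometric series whose
  first term is at most \<open>1 / r (Suc m)\<close>.
\<close>

lemma corr_between:
  assumes "block_lifts q U" "block_lifts q V" "prefix_sum (V q) (int (h q)) = 0" "q < m"
    "H m \<le> t" "t < H (Suc m)" "m + 2 \<le> n"
  shows "\<bar>corr (h n) (U n) (V n) (int t)\<bar> \<le> mixing_error m * real (h n)"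
proof -
  define F where "F l = \<bar>corr (h l) (U l) (V l) (int t)\<bar> / real (h l)" for l
  define \<tau> where "\<tau> = 1 / real (r (Suc m))"
  have hpos: "real (h l) > 0" for l using h_pos by simp
  have F1: "F (Suc m) \<le> 2 * lag_error m"
    unfolding F_def using corr_far[OF assms(1-5)] hpos by (simp add: divide_le_eq)
  (* From stage Suc m on only lags 0 and 1 occur. *)
  have tH: "t < H l" if "l \<ge> Suc m" for l
    using that
  proof (induction l rule: dec_induct)
    case (step l)
    then show ?case using H_le_h_Suc[of l] h_less_H[of "Suc l"] by simp
  qed (rule assms(6))
  have F_step: "F (Suc l) \<le> F l + min (lag_error l) (real t / real (h l))" if "l \<ge> Suc m" for l
    unfolding F_def using that assms(4) by (intro corr_near[OF assms(1-3) _ tH[OF that]]) simp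
  have F2: "F (m + 2) \<le> 2 * lag_error m + lag_error (Suc m)"
    using F_step[of "Suc m"] F1 by simp
  have small: "real t / real (h (m + 2 + d)) \<le> \<tau> / 2 ^ d" for d
  proof -
    have "2 ^ d * (r (Suc m) * H (Suc m)) \<le> h (m + 2 + d)"
      using h_ge_power[of d "m + 2"] h_Suc'[of "Suc m"] by simp
    then have "real (2 ^ d * (r (Suc m) * H (Suc m))) \<le> real (h (m + 2 + d))"
      by (rule of_nat_mono)
    then have "real t / real (h (m + 2 + d)) \<le> real (H (Suc m)) / (2 ^ d * (real (r (Suc m)) * real (H (Suc m))))"
      using assms(6) r_pos[of "Suc m"] by (intro frac_le) auto
    also have "\<dots> = \<tau> / 2 ^ d" using assms(6) by (simp add: \<tau>_def)
    finally show ?thesis .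
  qed
  have "F (m + 2 + d) \<le> 2 * lag_error m + lag_error (Suc m) + \<tau> * (2 - 2 / 2 ^ d)" for d
  proof (induction d)
    case 0
    then show ?case using F2 by simp
  next
    case (Suc d)
    have "F (m + 2 + Suc d) \<le> F (m + 2 + d) + \<tau> / 2 ^ d"
      using F_step[of "m + 2 + d"] small[of d] by simp
    also have "\<dots> \<le> 2 * lag_error m + lag_error (Suc m) + \<tau> * (2 - 2 / 2 ^ Suc d)"
    proof -
      have "\<tau> * (2 - 2 / 2 ^ d) + \<tau> / 2 ^ d = \<tau> * (2 - 2 / 2 ^ Suc d)" by (simp add: field_simps)
      then show ?thesis using Suc by linarith
    qed
    finally show ?case .
  qed
  moreover have "\<tau> * (2 - 2 / 2 ^ d) \<le> 2 / (real m + 2)" for d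
  proof -
    have "\<tau> * (2 - 2 / 2 ^ d) \<le> \<tau> * 2" by (intro mult_left_mono) (auto simp: \<tau>_def)
    also have "\<dots> \<le> 2 / (real m + 2)"
      unfolding \<tau>_def using r_ge[of "Suc m"] by (auto simp: divide_simps)
    finally show ?thesis .
  qed
  ultimately have "F (m + 2 + d) \<le> mixing_error m" for d
    unfolding mixing_error_def by (meson add_left_mono order.trans)
  from this[of "n - (m + 2)"] have "F n \<le> mixing_error m"
    unfolding le_add_diff_inverse[OF assms(7)] .
  then show ?thesis unfolding F_def using hpos[of n] by (simp add: divide_le_eq)
qed

theorem corr_tends_to_zero:
  assumes "block_lifts q U" "block_lifts q V" "prefix_sum (V q) (int (h q)) = 0" "\<delta> > 0"
  shows "\<exists>t0. \<forall>t\<ge>t0. \<exists>N. \<forall>n\<ge>N. \<bar>corr (h n) (U n) (V n) (int t)\<bar> \<le> \<delta> * real (h n)"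
proof -
  have "eventually (\<lambda>m. mixing_error m < \<delta>) sequentially"
    using mixing_error_tendsto_0 assms(4) by (rule order_tendstoD)
  then obtain m0 where m0: "\<And>m. m \<ge> m0 \<Longrightarrow> mixing_error m < \<delta>"
    by (auto simp: eventually_sequentially)
  define m1 where "m1 = max m0 (Suc q)"
  show ?thesis
  proof (rule exI[of _ "H m1"], intro allI impI)
    fix t assume t: "H m1 \<le> t"
    define m' where "m' = (LEAST l. t < H l)"
    have ex: "t < H t" by (rule H_gt)
    have m': "t < H m'" unfolding m'_def using ex by (rule LeastI)
    have Hmono: "H i \<le> H l" if "i \<le> l" for i l
      using that
    proof (induction l rule: dec_induct)
      case (step l)
      then show ?case using H_le_h_Suc[of l] h_less_H[of "Suc l"] by simp
    qed simp
    have "m1 < m'"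
    proof (rule ccontr)
      assume "\<not> m1 < m'"
      then have "H m' \<le> H m1" by (intro Hmono) simp
      then show False using m' t by simp
    qed
    then obtain m where m: "m' = Suc m" "m1 \<le> m" by (cases m') auto
    have "\<not> t < H m" using not_less_Least[of m "\<lambda>l. t < H l"] m by (simp add: m'_def[symmetric])
    then have Hm: "H m \<le> t" "t < H (Suc m)" using m' m by auto
    show "\<exists>N. \<forall>n\<ge>N. \<bar>corr (h n) (U n) (V n) (int t)\<bar> \<le> \<delta> * real (h n)"
    proof (rule exI[of _ "m + 2"], intro allI impI)
      fix n assume n: "m + 2 \<le> n"
      have "\<bar>corr (h n) (U n) (V n) (int t)\<bar> \<le> mixing_error m * real (h n)"
        using m by (intro corr_between[OF assms(1-3) _ Hm n]) (simp add: m1_def)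
      also have "\<dots> \<le> \<delta> * real (h n)"
        using m0[of m] m by (intro mult_right_mono) (auto simp: m1_def)
      finally show "\<bar>corr (h n) (U n) (V n) (int t)\<bar> \<le> \<delta> * real (h n)" .
    qed
  qed
qed

end

section \<open>Piecewise translations preserve Lebesgue measure\<close>

lemma translate_lebesgue_set:
  fixes S :: "real set"
  assumes "S \<in> sets lebesgue"
  shows "(\<lambda>y. y + c) ` S \<in> sets lebesgue" "emeasure lebesgue ((\<lambda>y. y + c) ` S) = emeasure lebesgue S"
proof -
  have "(\<lambda>y. - c + y) \<in> lebesgue \<rightarrow>\<^sub>M lebesgue"
    using lebesgue_affine_measurable[of "\<lambda>_. 1" "- c"] by simp
  from measurable_sets[OF this assms] have "(\<lambda>y. - c + y) -` S \<in> sets lebesgue" by simp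
  moreover have "(\<lambda>y. - c + y) -` S = (\<lambda>y. y + c) ` S"
    by (force simp: image_iff)
  ultimately show "(\<lambda>y. y + c) ` S \<in> sets lebesgue" by simp
  show "emeasure lebesgue ((\<lambda>y. y + c) ` S) = emeasure lebesgue S"
    using emeasure_lebesgue_affine[of 1 c S] by simp
qed

text \<open>
  A map that is a translation on each of countably many pieces preserves measure as soon as it is
  injective, because then the translated pieces are still disjoint.
\<close>

lemma piecewise_translation_lebesgue:
  fixes f :: "real \<Rightarrow> real" and lab :: "real \<Rightarrow> nat"
  assumes "inj_on f A" "\<And>k. {y\<in>A. lab y = k} \<in> sets lebesgue"
    and f: "\<And>y. y \<in> A \<Longrightarrow> f y = y + c (lab y)"
  shows "f ` A \<in> sets lebesgue" "emeasure lebesgue (f ` A) = emeasure lebesgue A"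
proof -
  define P where "P k = {y\<in>A. lab y = k}" for k
  have A: "A = (\<Union>k. P k)" by (auto simp: P_def)
  have fP: "f ` P k = (\<lambda>y. y + c k) ` P k" for k
    using f by (intro image_cong) (auto simp: P_def)
  have sets: "range P \<subseteq> sets lebesgue" "range (\<lambda>k. f ` P k) \<subseteq> sets lebesgue"
    using assms(2) translate_lebesgue_set(1) fP by (auto simp: P_def)
  have img: "f ` A = (\<Union>k. f ` P k)" by (auto simp: P_def)
  show "f ` A \<in> sets lebesgue" unfolding img using sets(2) by auto
  have disj: "disjoint_family P" by (auto simp: disjoint_family_on_def P_def)
  have disj': "disjoint_family (\<lambda>k. f ` P k)"
    unfolding disjoint_family_on_def
  proof (intro ballI impI)
    fix m n :: nat assume "m \<noteq> n"
    then have "P m \<inter> P n = {}" by (auto simp: P_def)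
    then show "f ` P m \<inter> f ` P n = {}"
      using inj_on_image_Int[OF assms(1), of "P m" "P n"] by (auto simp: P_def)
  qed
  have "emeasure lebesgue (f ` A) = (\<Sum>k. emeasure lebesgue (f ` P k))"
    unfolding img by (rule suminf_emeasure[OF sets(2) disj', symmetric])
  also have "\<dots> = (\<Sum>k. emeasure lebesgue (P k))"
    unfolding fP using sets(1) translate_lebesgue_set(2) by (intro suminf_cong) auto
  also have "\<dots> = emeasure lebesgue A"
    unfolding A by (rule suminf_emeasure[OF sets(1) disj])
  finally show "emeasure lebesgue (f ` A) = emeasure lebesgue A" .
qed

section \<open>Cutting and stacking on the unit interval\<close>

context block_structure
begin

definition copy_start_nat :: "nat \<Rightarrow> nat \<Rightarrow> nat" where "copy_start_nat n i = i * H n + x n i"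

lemma copy_start_eq_nat: "copy_start n i = int (copy_start_nat n i)"
  by (simp add: copy_start_def copy_start_nat_def)

lemma copy_start_nat_end: "i < r n \<Longrightarrow> copy_start_nat n i + h n < h (Suc n)"
  using copy_start_end[of i n] by (simp add: copy_start_eq_nat)

text \<open>
  At stage \<open>n\<close> the interval is divided into cells of equal width, numbered from the left, and
  \<open>tau n a\<close> is the height of cell \<open>a\<close> in the tower. Each cell is cut into \<open>r n\<close> cells; the \<open>i\<close>-th
  piece goes into the \<open>i\<close>-th copy of the tower. New cells appended on the right fill the gaps
  between the copies: \<open>K n\<close> of them for each \<open>i\<close>, of which \<open>x n i\<close> go below the copy and the others
  above it.
\<close>

fun tau :: "nat \<Rightarrow> nat \<Rightarrow> nat" where
  "tau 0 a = a"
| "tau (Suc n) a =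
    (if a < h n * r n then copy_start_nat n (a mod r n) + tau n (a div r n)
     else let b = a - h n * r n; i = b div K n; c = b mod K n
          in i * H n + (if c < x n i then c else c + h n))"

declare tau.simps(2) [simp del]

lemma H_cell:
  assumes "o' < H n"
  shows "(i * H n + o') div H n = i" "(i * H n + o') mod H n = o'"
  using assms by auto

lemma tau_column:
  assumes "a < h n * r n" "tau n (a div r n) < h n"
  shows "tau (Suc n) a div H n = a mod r n"
    "tau (Suc n) a mod H n = x n (a mod r n) + tau n (a div r n)"
proof -
  have lt: "x n (a mod r n) + tau n (a div r n) < H n"
    using assms(2) x_less[of n "a mod r n"] by (simp add: H_def)
  have "tau (Suc n) a = (a mod r n) * H n + (x n (a mod r n) + tau n (a div r n))"
    using assms(1) by (simp add: tau.simps(2) copy_start_nat_def)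
  then show "tau (Suc n) a div H n = a mod r n"
    "tau (Suc n) a mod H n = x n (a mod r n) + tau n (a div r n)"
    using H_cell[OF lt] by simp_all
qed

lemma tau_spacer:
  assumes "\<not> a < h n * r n" "a < h (Suc n)"
  defines "b \<equiv> a - h n * r n"
  defines "i \<equiv> b div K n"
  defines "c \<equiv> b mod K n"
  shows "tau (Suc n) a div H n = i" "tau (Suc n) a mod H n = (if c < x n i then c else c + h n)"
    "i < r n" "c < K n"
proof -
  show c: "c < K n" unfolding c_def using K_pos by simp
  have "b < r n * K n" using assms(1,2) by (simp add: b_def h_Suc' H_def algebra_simps)
  then show "i < r n" unfolding i_def by (simp add: less_mult_imp_div_less)
  have t: "tau (Suc n) a = i * H n + (if c < x n i then c else c + h n)"
    using assms(1) by (simp add: tau.simps(2) b_def i_def c_def Let_def)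
  have lt: "(if c < x n i then c else c + h n) < H n" using c by (simp add: H_def)
  show "tau (Suc n) a div H n = i" "tau (Suc n) a mod H n = (if c < x n i then c else c + h n)"
    unfolding t using H_cell[OF lt] by simp_all
qed

lemma tau_bij: "bij_betw (tau n) {..<h n} {..<h n}"
proof (induction n)
  case 0
  then show ?case by (simp add: h_0 bij_betw_def)
next
  case (Suc n)
  have IH: "inj_on (tau n) {..<h n}" "\<And>q. q < h n \<Longrightarrow> tau n q < h n"
    using Suc by (auto simp: bij_betw_def)
  have col: "a div r n < h n" if "a < h n * r n" for a
    using that by (simp add: less_mult_imp_div_less)
  have rpos: "r n > 0" by (rule r_pos)
  have "tau (Suc n) a < h (Suc n)" if a: "a < h (Suc n)" for a
  proof (cases "a < h n * r n")
    case True
    then have "tau (Suc n) a = copy_start_nat n (a mod r n) + tau n (a div r n)" by (simp add: tau.simps(2))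
    also have "\<dots> < copy_start_nat n (a mod r n) + h n" using IH(2)[OF col[OF True]] by simp
    also have "\<dots> < h (Suc n)" using rpos by (intro copy_start_nat_end) simp
    finally show ?thesis .
  next
    case False
    from tau_spacer[OF this a] have "tau (Suc n) a div H n < r n" by simp
    then show ?thesis unfolding h_Suc' using h_less_H[of n] by (simp add: div_less_iff_less_mult)
  qed
  then have into: "tau (Suc n) ` {..<h (Suc n)} \<subseteq> {..<h (Suc n)}" by auto
  have mixed: False if "a < h n * r n" "\<not> a' < h n * r n" "a' < h (Suc n)" "tau (Suc n) a = tau (Suc n) a'" for a a'
  proof -
    note t = tau_column[OF that(1) IH(2)[OF col[OF that(1)]]]
    note s = tau_spacer[OF that(2,3)]
    have "a mod r n = (a' - h n * r n) div K n" using t(1) s(1) that(4) by simp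
    then have "x n (a mod r n) + tau n (a div r n) =
       (if (a' - h n * r n) mod K n < x n (a mod r n) then (a' - h n * r n) mod K n
        else (a' - h n * r n) mod K n + h n)"
      using t(2) s(2) that(4) by simp
    then show False using IH(2)[OF col[OF that(1)]] by (auto split: if_splits)
  qed
  have "inj_on (tau (Suc n)) {..<h (Suc n)}"
  proof (rule inj_onI)
    fix a a' assume a: "a \<in> {..<h (Suc n)}" "a' \<in> {..<h (Suc n)}" and eq: "tau (Suc n) a = tau (Suc n) a'"
    consider (block) "a < h n * r n" "a' < h n * r n" | (spacer) "\<not> a < h n * r n" "\<not> a' < h n * r n"
      using mixed[of a a'] mixed[of a' a] a eq by fastforce
    then show "a = a'"
    proof cases
      case block
      note t = tau_column[OF block(1) IH(2)[OF col[OF block(1)]]]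
      note t' = tau_column[OF block(2) IH(2)[OF col[OF block(2)]]]
      have m: "a mod r n = a' mod r n" using t(1) t'(1) eq by simp
      then have "tau n (a div r n) = tau n (a' div r n)" using t(2) t'(2) eq by simp
      then have "a div r n = a' div r n"
        using IH(1) col[OF block(1)] col[OF block(2)] by (auto dest: inj_onD)
      then show ?thesis using m by (metis div_mult_mod_eq)
    next
      case spacer
      have ah: "a < h (Suc n)" "a' < h (Suc n)" using a by auto
      note s = tau_spacer[OF spacer(1) ah(1)] and s' = tau_spacer[OF spacer(2) ah(2)]
      define b b' where "b = a - h n * r n" and "b' = a' - h n * r n"
      have i: "b div K n = b' div K n" using s(1) s'(1) eq by (simp add: b_def b'_def)
      have "(if b mod K n < x n (b div K n) then b mod K n else b mod K n + h n)
          = (if b' mod K n < x n (b' div K n) then b' mod K n else b' mod K n + h n)"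
        using s(2)[symmetric] s'(2)[symmetric] eq by (simp only: b_def b'_def)
      moreover have "x n (b div K n) < K n" by (rule x_less)
      ultimately have "b mod K n = b' mod K n" unfolding i
        by (auto split: if_splits)
      then have "b = b'" using i by (metis div_mult_mod_eq)
      then show ?thesis using spacer by (simp add: b_def b'_def)
    qed
  qed
  then show ?case
    unfolding bij_betw_def using into endo_inj_surj[of "{..<h (Suc n)}" "tau (Suc n)"] by simp
qed

lemma tau_less: "a < h n \<Longrightarrow> tau n a < h n"
  using tau_bij[of n] by (auto simp: bij_betw_def)

definition sigma :: "nat \<Rightarrow> nat \<Rightarrow> nat" where
  "sigma n = inv_into {..<h n} (tau n)"

lemma sigma_less: "j < h n \<Longrightarrow> sigma n j < h n"
  using tau_bij[of n] inv_into_into[of j "tau n" "{..<h n}"] by (auto simp: bij_betw_def sigma_def)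

lemma tau_sigma: "j < h n \<Longrightarrow> tau n (sigma n j) = j"
  using tau_bij[of n] f_inv_into_f[of j "tau n" "{..<h n}"] by (auto simp: bij_betw_def sigma_def)

lemma sigma_tau: "a < h n \<Longrightarrow> sigma n (tau n a) = a"
  using tau_bij[of n] by (simp add: bij_betw_def sigma_def)

lemma h_r_le: "h n * r n \<le> h (Suc n)"
  by (simp add: h_Suc' H_def)

lemma column_less:
  assumes "q < h n" "i < r n"
  shows "q * r n + i < h n * r n"
proof -
  have "Suc q * r n \<le> h n * r n" using assms by (intro mult_le_mono) auto
  then show ?thesis using assms by simp
qed

lemma sigma_Suc:
  assumes "j < h n" "i < r n"
  shows "sigma (Suc n) (copy_start_nat n i + j) = sigma n j * r n + i"
proof -
  have lt: "sigma n j * r n + i < h n * r n" by (rule column_less[OF sigma_less[OF assms(1)] assms(2)])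
  then have "tau (Suc n) (sigma n j * r n + i) = copy_start_nat n i + j"
    using assms by (simp add: tau_sigma tau.simps(2))
  moreover have "sigma n j * r n + i < h (Suc n)" using lt h_r_le[of n] by linarith
  ultimately show ?thesis using sigma_tau[of "sigma n j * r n + i" "Suc n"] by simp
qed

end

text \<open>
  Cells of stage \<open>n\<close> have width \<open>W n\<close>. The widths are normalised so that the towers fill the unit
  interval in the limit.
\<close>

locale cut_and_stack = block_structure +
  fixes W :: "nat \<Rightarrow> real"
  assumes W_pos: "W n > 0"
    and W_Suc: "W n = real (Suc n * e n) * W (Suc n)"
    and total_width: "(\<lambda>n. real (h n) * W n) \<longlonglongrightarrow> 1"
begin

lemma W_Suc': "W n = real (r n) * W (Suc n)"
  using W_Suc[of n] by (simp add: r_def)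

lemma width_mono: "real (h n) * W n \<le> real (h (Suc n)) * W (Suc n)"
proof -
  have "real (h n) * W n \<le> real (H n) * (real (r n) * W (Suc n))"
    unfolding W_Suc'[symmetric] using h_less_H[of n] W_pos[of n] by (intro mult_right_mono) auto
  then show ?thesis by (simp add: h_Suc' mult_ac)
qed

lemma width_le_1: "real (h n) * W n \<le> 1"
proof -
  have "incseq (\<lambda>n. real (h n) * W n)" by (rule incseq_SucI) (rule width_mono)
  from incseq_le[OF this total_width] show ?thesis .
qed

lemma W_tendsto_0: "W \<longlonglongrightarrow> 0"
proof (rule tendsto_sandwich[of "\<lambda>_. 0" W sequentially "\<lambda>n. 1 / 2 ^ n" 0])
  show "\<forall>\<^sub>F n in sequentially. W n \<le> 1 / 2 ^ n"
  proof (intro always_eventually allI)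
    fix n
    have "2 ^ n \<le> h n" using h_ge_power[of n 0] by (simp add: h_0)
    then have "(2 :: real) ^ n \<le> real (h n)" by (metis of_nat_le_iff of_nat_numeral of_nat_power)
    then have "2 ^ n * W n \<le> real (h n) * W n" using W_pos[of n] by (intro mult_right_mono) auto
    also have "\<dots> \<le> 1" by (rule width_le_1)
    finally show "W n \<le> 1 / 2 ^ n" by (simp add: field_simps)
  qed
  show "\<forall>\<^sub>F n in sequentially. 0 \<le> W n" using W_pos by (intro always_eventually allI less_imp_le)
qed (auto intro!: tendsto_eq_intros LIMSEQ_divide_realpow_zero)

definition idx :: "nat \<Rightarrow> real \<Rightarrow> nat" where
  "idx n y = nat \<lfloor>y / W n\<rfloor>"

definition cells :: "nat \<Rightarrow> nat set \<Rightarrow> real set" where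
  "cells n S = {y. 0 \<le> y \<and> idx n y \<in> S}"

lemma idx_bounds:
  assumes "0 \<le> y"
  shows "real (idx n y) * W n \<le> y" "y < (real (idx n y) + 1) * W n"
proof -
  have "real (idx n y) = of_int \<lfloor>y / W n\<rfloor>"
    unfolding idx_def using assms W_pos[of n] by (simp add: zero_le_floor)
  then have "real (idx n y) \<le> y / W n" "y / W n < real (idx n y) + 1"
    using of_int_floor_le[of "y / W n"] by linarith+
  then show "real (idx n y) * W n \<le> y" "y < (real (idx n y) + 1) * W n"
    using W_pos[of n] by (simp_all add: field_simps)
qed

lemma idx_eqI:
  assumes "real a * W n \<le> y" "y < (real a + 1) * W n"
  shows "idx n y = a" "0 \<le> y"
proof -
  have "real a \<le> y / W n" "y / W n < real a + 1" using assms W_pos[of n] by (simp_all add: field_simps)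
  then have "\<lfloor>y / W n\<rfloor> = int a" by (simp add: floor_unique)
  then show "idx n y = a" by (simp add: idx_def)
  have "0 \<le> real a * W n" using W_pos[of n] by simp
  then show "0 \<le> y" using assms(1) by linarith
qed

lemma cells_single: "cells n {a} = {real a * W n ..< (real a + 1) * W n}"
  using idx_bounds idx_eqI by (fastforce simp: cells_def)

lemma cells_borel: "finite S \<Longrightarrow> cells n S \<in> sets borel"
proof -
  assume "finite S"
  moreover have "cells n S = (\<Union>a\<in>S. cells n {a})" by (auto simp: cells_def)
  ultimately show ?thesis by (simp add: cells_single)
qed

lemma cells_lebesgue: "finite S \<Longrightarrow> cells n S \<in> sets lebesgue"
  using cells_borel by (simp add: sets_completionI_sets)

lemma emeasure_cells:
  assumes "finite S"
  shows "emeasure lebesgue (cells n S) = ennreal (real (card S) * W n)"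
proof -
  have "disjoint_family_on (\<lambda>a. cells n {a}) S" by (auto simp: disjoint_family_on_def cells_def)
  then have "(\<Sum>a\<in>S. emeasure lebesgue (cells n {a})) = emeasure lebesgue (\<Union>a\<in>S. cells n {a})"
    using assms cells_lebesgue by (intro sum_emeasure) auto
  also have "(\<Union>a\<in>S. cells n {a}) = cells n S" by (auto simp: cells_def)
  finally have "emeasure lebesgue (cells n S) = (\<Sum>a\<in>S. emeasure lebesgue (cells n {a}))" ..
  also have "\<dots> = (\<Sum>a\<in>S. ennreal (W n))"
    unfolding cells_single using W_pos[of n] by (intro sum.cong refl) (simp add: algebra_simps)
  also have "\<dots> = ennreal (real (card S) * W n)"
    using W_pos[of n] by (simp add: ennreal_mult ennreal_of_nat_eq_real_of_nat)
  finally show ?thesis .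
qed

lemma idx_div:
  assumes "0 \<le> y"
  shows "idx n y = idx (Suc n) y div r n"
proof -
  have "y / W n = (y / W (Suc n)) / of_int (int (r n))" using W_Suc'[of n] by (simp add: field_simps)
  then have "\<lfloor>y / W n\<rfloor> = \<lfloor>y / W (Suc n)\<rfloor> div int (r n)"
    by (simp only: floor_divide_real_eq_div of_nat_0_le_iff)
  moreover have "0 \<le> \<lfloor>y / W (Suc n)\<rfloor>" using assms W_pos[of "Suc n"] by simp
  ultimately show ?thesis by (simp add: idx_def nat_div_distrib)
qed

definition in_tower :: "nat \<Rightarrow> real \<Rightarrow> bool" where
  "in_tower n y \<longleftrightarrow> 0 \<le> y \<and> idx n y < h n"

definition height :: "nat \<Rightarrow> real \<Rightarrow> nat" where
  "height n y = tau n (idx n y)"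

definition column :: "nat \<Rightarrow> real \<Rightarrow> nat" where
  "column n y = idx (Suc n) y mod r n"

text \<open>
  The point at height \<open>j\<close> vertically above or below \<open>y\<close>: same relative position in another cell.
\<close>

definition at_height :: "nat \<Rightarrow> nat \<Rightarrow> real \<Rightarrow> real" where
  "at_height n j y = real (sigma n j) * W n + (y - real (idx n y) * W n)"

lemma column_less_r: "column n y < r n"
  using r_pos by (simp add: column_def)

lemma height_less: "in_tower n y \<Longrightarrow> height n y < h n"
  by (simp add: in_tower_def height_def tau_less)

lemma in_tower_Suc:
  assumes "in_tower n y"
  shows "idx (Suc n) y < h n * r n" "in_tower (Suc n) y" "height (Suc n) y = copy_start_nat n (column n y) + height n y"
proof -
  have "idx (Suc n) y div r n < h n" using assms idx_div[of y n] by (simp add: in_tower_def)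
  then show lt: "idx (Suc n) y < h n * r n" using r_pos[of n] by (simp add: div_less_iff_less_mult)
  then show "in_tower (Suc n) y" using assms h_r_le[of n] by (simp add: in_tower_def)
  show "height (Suc n) y = copy_start_nat n (column n y) + height n y"
    using lt assms idx_div[of y n] by (simp add: height_def column_def in_tower_def tau.simps(2))
qed

lemma at_height_props:
  assumes "0 \<le> y" "j < h n"
  shows "idx n (at_height n j y) = sigma n j" "in_tower n (at_height n j y)"
    "height n (at_height n j y) = j"
    "at_height n j y - real (sigma n j) * W n = y - real (idx n y) * W n"
proof -
  show off: "at_height n j y - real (sigma n j) * W n = y - real (idx n y) * W n"
    by (simp add: at_height_def)
  have "real (sigma n j) * W n \<le> at_height n j y" "at_height n j y < (real (sigma n j) + 1) * W n"
    using idx_bounds[OF assms(1), of n] by (simp_all add: at_height_def algebra_simps)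
  from idx_eqI[OF this] show i: "idx n (at_height n j y) = sigma n j"
    and "in_tower n (at_height n j y)"
    using sigma_less[OF assms(2)] by (simp_all add: in_tower_def)
  show "height n (at_height n j y) = j"
    using assms(2) by (simp add: height_def i tau_sigma)
qed

lemma at_height_at_height:
  assumes "0 \<le> y" "j < h n"
  shows "at_height n l (at_height n j y) = at_height n l y"
  using at_height_props[OF assms] by (simp add: at_height_def)

lemma at_height_self:
  assumes "in_tower n y"
  shows "at_height n (height n y) y = y"
  using assms by (simp add: at_height_def height_def in_tower_def sigma_tau)

text \<open>
  Moving vertically within the tower of stage \<open>n\<close> agrees with moving vertically within the column of
  the next tower that contains the point, so the partial maps of all stages are compatible.
\<close>

lemma at_height_Suc:
  assumes "in_tower n y" "j < h n"
  shows "at_height (Suc n) (copy_start_nat n (column n y) + j) y = at_height n j y"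
proof -
  have "idx (Suc n) y = idx n y * r n + column n y"
    using assms(1) idx_div[of y n] unfolding in_tower_def column_def by (metis div_mult_mod_eq)
  then show ?thesis
    using sigma_Suc[OF assms(2) column_less_r[of n y]]
    by (simp add: at_height_def W_Suc'[of n] algebra_simps)
qed

text \<open>
  The time \<open>t\<close> map is visible at stage \<open>n\<close>: the point lies in the tower and moving it by \<open>t\<close> levels
  does not leave the tower.
\<close>

definition stays :: "nat \<Rightarrow> int \<Rightarrow> real \<Rightarrow> bool" where
  "stays n t y \<longleftrightarrow> in_tower n y \<and> 0 \<le> int (height n y) + t \<and> int (height n y) + t < int (h n)"

lemma stays_Suc:
  assumes "stays n t y"
  shows "stays (Suc n) t y"
    "at_height (Suc n) (nat (int (height (Suc n) y) + t)) y = at_height n (nat (int (height n y) + t)) y"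
proof -
  have y: "in_tower n y" and j: "0 \<le> int (height n y) + t" "int (height n y) + t < int (h n)"
    using assms by (auto simp: stays_def)
  note S = in_tower_Suc[OF y]
  have "int (height (Suc n) y) + t < int (copy_start_nat n (column n y) + h n)" using j S(3) by simp
  also have "\<dots> < int (h (Suc n))" using copy_start_nat_end[OF column_less_r] by (simp only: of_nat_less_iff)
  finally show "stays (Suc n) t y" using j S by (simp add: stays_def)
  have "nat (int (height (Suc n) y) + t) = copy_start_nat n (column n y) + nat (int (height n y) + t)"
    using j S(3) by simp
  then show "at_height (Suc n) (nat (int (height (Suc n) y) + t)) y = at_height n (nat (int (height n y) + t)) y"
    using at_height_Suc[OF y, of "nat (int (height n y) + t)"] j by simp
qed

lemma stays_mono:
  assumes "stays n t y" "n \<le> m"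
  shows "stays m t y \<and>
    at_height m (nat (int (height m y) + t)) y = at_height n (nat (int (height n y) + t)) y"
  using assms(2)
proof (induction m rule: dec_induct)
  case (step m)
  then show ?case using stays_Suc[of m t y] by simp
qed (use assms(1) in simp)

definition flow :: "int \<Rightarrow> real \<Rightarrow> real" where
  "flow t y = (let n = LEAST n. stays n t y in at_height n (nat (int (height n y) + t)) y)"

lemma flow_eq:
  assumes "stays n t y"
  shows "flow t y = at_height n (nat (int (height n y) + t)) y"
proof -
  define m where "m = (LEAST n. stays n t y)"
  have "stays m t y" "m \<le> n" unfolding m_def using assms by (auto intro: LeastI Least_le)
  from stays_mono[OF this] show ?thesis by (simp add: flow_def m_def[symmetric])
qed

lemma flow_height:
  assumes "stays n t y"
  shows "in_tower n (flow t y)" "int (height n (flow t y)) = int (height n y) + t"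
proof -
  have "0 \<le> y" "nat (int (height n y) + t) < h n" using assms by (auto simp: stays_def in_tower_def)
  note P = at_height_props[OF this]
  show "in_tower n (flow t y)" "int (height n (flow t y)) = int (height n y) + t"
    unfolding flow_eq[OF assms] using P assms by (auto simp: stays_def)
qed

text \<open>
  The points whose whole orbit, forwards and backwards, is eventually visible. On this set, which
  turns out to be conull in the unit interval, the flow is an action of the integers.
\<close>

definition X :: "real set" where
  "X = {y. \<forall>t. \<exists>n. stays n t y}"

lemma eventually_stays: "y \<in> X \<Longrightarrow> eventually (\<lambda>n. stays n t y) sequentially"
  unfolding X_def eventually_sequentially using stays_mono by blast

lemma flow_add_stays:
  assumes "stays n s y" "stays n (s + t) y"
  shows "stays n t (flow s y)" "flow t (flow s y) = flow (s + t) y"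
proof -
  note F = flow_height[OF assms(1)]
  show ok: "stays n t (flow s y)" using assms F by (simp add: stays_def)
  have y: "0 \<le> y" "nat (int (height n y) + s) < h n" using assms(1) by (auto simp: stays_def in_tower_def)
  show "flow t (flow s y) = flow (s + t) y"
    unfolding flow_eq[OF ok] flow_eq[OF assms(2)]
    unfolding F(2) unfolding flow_eq[OF assms(1)] at_height_at_height[OF y] by (simp add: add.assoc)
qed

lemma flow_in_X:
  assumes "y \<in> X"
  shows "flow s y \<in> X"
  unfolding X_def
proof (intro CollectI allI)
  fix t
  have "eventually (\<lambda>n. stays n s y \<and> stays n (s + t) y) sequentially"
    using eventually_stays[OF assms] by (simp add: eventually_conj)
  then obtain n where "stays n s y" "stays n (s + t) y" by (auto dest: eventually_happens)
  then show "\<exists>n. stays n t (flow s y)" using flow_add_stays by blast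
qed

lemma flow_flow:
  assumes "y \<in> X"
  shows "flow t (flow s y) = flow (s + t) y"
proof -
  have "eventually (\<lambda>n. stays n s y \<and> stays n (s + t) y) sequentially"
    using eventually_stays[OF assms] by (simp add: eventually_conj)
  then obtain n where "stays n s y" "stays n (s + t) y" by (auto dest: eventually_happens)
  then show ?thesis using flow_add_stays by blast
qed

lemma flow_0:
  assumes "y \<in> X"
  shows "flow 0 y = y"
proof -
  obtain n where n: "stays n 0 y" using assms by (auto simp: X_def)
  then show ?thesis using flow_eq[OF n] at_height_self[of n y] by (simp add: stays_def)
qed

lemma flow_bij: "bij_betw (flow t) X X"
  by (rule bij_betw_byWitness[where f' = "flow (- t)"]) (auto simp: flow_flow flow_0 flow_in_X)

lemma flow_inj: "inj_on (flow t) X"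
  using flow_bij by (rule bij_betw_imp_inj_on)

lemma flow_funpow: "y \<in> X \<Longrightarrow> (flow 1 ^^ n) y = flow (int n) y"
  by (induction n) (auto simp: flow_0 flow_flow add.commute)

lemma flow_funpow_image: "A \<subseteq> X \<Longrightarrow> (flow 1 ^^ n) ` A = flow (int n) ` A"
  using flow_funpow by (intro image_cong) auto

lemma stays_eq_cells: "{y. stays n t y} = cells n {a. a < h n \<and> 0 \<le> int (tau n a) + t \<and> int (tau n a) + t < int (h n)}"
  by (auto simp: stays_def cells_def in_tower_def height_def)

lemma stays_lebesgue: "{y. stays n t y} \<in> sets lebesgue"
  unfolding stays_eq_cells by (rule cells_lebesgue) auto

lemma X_lebesgue: "X \<in> sets lebesgue"
proof -
  have "X = (\<Inter>t. \<Union>n. {y. stays n t y})" by (auto simp: X_def)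
  moreover have "(\<Union>n. {y. stays n t y}) \<in> sets lebesgue" for t
    using stays_lebesgue by (intro sets.countable_UN) auto
  ultimately show ?thesis by (auto intro!: sets.countable_INT')
qed

text \<open>
  The pieces are indexed by the first stage that sees the time \<open>t\<close> map and by the cell of that stage.
\<close>

lemma flow_preserves_lebesgue:
  assumes "A \<in> sets lebesgue" "A \<subseteq> X"
  shows "flow t ` A \<in> sets lebesgue" "emeasure lebesgue (flow t ` A) = emeasure lebesgue A"
proof -
  define N where "N y = (LEAST n. stays n t y)" for y
  define lab where "lab y = prod_encode (N y, idx (N y) y)" for y
  define c where "c k = (case prod_decode k of (n, a) \<Rightarrow>
      (real (sigma n (nat (int (tau n a) + t))) - real a) * W n)" for k
  have okN: "stays (N y) t y" if "y \<in> A" for y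
  proof -
    have "y \<in> X" using assms(2) that by blast
    then obtain n where "stays n t y" by (auto simp: X_def)
    then show ?thesis unfolding N_def by (rule LeastI)
  qed
  have f: "flow t y = y + c (lab y)" if "y \<in> A" for y
    unfolding flow_eq[OF okN[OF that]]
    by (simp add: c_def lab_def at_height_def height_def algebra_simps)
  have m: "{y \<in> A. lab y = k} \<in> sets lebesgue" for k
  proof -
    obtain n a where k: "k = prod_encode (n, a)" by (metis prod_decode_inverse surj_pair)
    have "{y \<in> A. lab y = k} = (A \<inter> {y. stays n t y} \<inter> cells n {a}) - (\<Union>m<n. {y. stays m t y})"
    proof (intro equalityI subsetI)
      fix y assume y: "y \<in> {y \<in> A. lab y = k}"
      then have N: "N y = n" "idx n y = a" by (auto simp: lab_def k)
      have "\<not> stays m t y" if "m < n" for m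
        using not_less_Least[of m "\<lambda>n. stays n t y"] that N by (auto simp: N_def)
      then show "y \<in> (A \<inter> {y. stays n t y} \<inter> cells n {a}) - (\<Union>m<n. {y. stays m t y})"
        using y N okN[of y] by (auto simp: cells_def stays_def in_tower_def)
    next
      fix y assume y: "y \<in> (A \<inter> {y. stays n t y} \<inter> cells n {a}) - (\<Union>m<n. {y. stays m t y})"
      then have "N y = n" unfolding N_def by (intro Least_equality) (auto simp: not_less[symmetric])
      then show "y \<in> {y \<in> A. lab y = k}" using y by (auto simp: lab_def k cells_def)
    qed
    then show ?thesis using assms(1) stays_lebesgue cells_lebesgue[of "{a}" n]
      by (auto intro!: sets.Diff sets.Int sets.countable_UN')
  qed
  have inj: "inj_on (flow t) A" using flow_inj assms(2) by (rule inj_on_subset)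
  show "flow t ` A \<in> sets lebesgue" "emeasure lebesgue (flow t ` A) = emeasure lebesgue A"
    by (rule piecewise_translation_lebesgue[OF inj m f]; assumption)+
qed

lemma cells_full: "cells n {..<h n} = {y. in_tower n y}"
  by (auto simp: cells_def in_tower_def)

lemma cells_subset: 
  assumes "S \<subseteq> {..<h n}"
  shows "cells n S \<subseteq> {0..<1}"
proof
  fix y assume "y \<in> cells n S"
  then have y: "0 \<le> y" "idx n y < h n" using assms by (auto simp: cells_def)
  have "y < (real (idx n y) + 1) * W n" by (rule idx_bounds(2)[OF y(1)])
  also have "\<dots> \<le> real (h n) * W n" using y W_pos[of n] by (intro mult_right_mono) auto
  also have "\<dots> \<le> 1" by (rule width_le_1)
  finally show "y \<in> {0..<1}" using y by simp
qed

lemma X_subset: "X \<subseteq> {0..<1}"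
proof
  fix y assume "y \<in> X"
  then obtain n where "stays n 0 y" by (auto simp: X_def)
  then have "y \<in> cells n {..<h n}" by (auto simp: stays_def cells_full)
  then show "y \<in> {0..<1}" using cells_subset[of "{..<h n}" n] by auto
qed

lemma card_stays: "h n - nat \<bar>t\<bar> \<le> card {a. a < h n \<and> 0 \<le> int (tau n a) + t \<and> int (tau n a) + t < int (h n)}"
proof -
  define J where "J = {nat (- t)..<h n - nat t}"
  have "J \<subseteq> tau n ` {a. a < h n \<and> 0 \<le> int (tau n a) + t \<and> int (tau n a) + t < int (h n)}"
  proof
    fix j assume "j \<in> J"
    then have j: "j < h n" "0 \<le> int j + t" "int j + t < int (h n)" by (auto simp: J_def)
    then show "j \<in> tau n ` {a. a < h n \<and> 0 \<le> int (tau n a) + t \<and> int (tau n a) + t < int (h n)}"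
      using tau_sigma[OF j(1)] sigma_less[OF j(1)] by (intro image_eqI[of _ _ "sigma n j"]) auto
  qed
  then have "card J \<le> card {a. a < h n \<and> 0 \<le> int (tau n a) + t \<and> int (tau n a) + t < int (h n)}"
    by (intro surj_card_le) auto
  moreover have "h n - nat \<bar>t\<bar> \<le> card J" by (auto simp: J_def abs_if)
  ultimately show ?thesis by linarith
qed

text \<open>
  Outside of the tower of stage \<open>n\<close> there is measure \<open>1 - h n * W n\<close>, and at most \<open>\<bar>t\<bar>\<close> levels of
  the tower leave it in time \<open>t\<close>.
\<close>

lemma not_stays_measure:
  "emeasure lebesgue ({0..<1} - {y. stays n t y}) \<le> ennreal (1 - real (h n) * W n + \<bar>real_of_int t\<bar> * W n)"
proof -
  define S where "S = {a. a < h n \<and> 0 \<le> int (tau n a) + t \<and> int (tau n a) + t < int (h n)}"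
  have fin: "finite S" and sub: "S \<subseteq> {..<h n}" by (auto simp: S_def)
  have "emeasure lebesgue ({0..<1} - {y. stays n t y}) = emeasure lebesgue {0..<1::real} - emeasure lebesgue (cells n S)"
    unfolding stays_eq_cells S_def[symmetric]
    using cells_subset[OF sub] cells_lebesgue[OF fin] emeasure_cells[OF fin] by (intro emeasure_Diff) auto
  also have "\<dots> = ennreal (1 - real (card S) * W n)"
    unfolding emeasure_cells[OF fin] using W_pos[of n] by (simp add: ennreal_minus flip: ennreal_1)
  also have "\<dots> \<le> ennreal (1 - real (h n) * W n + \<bar>real_of_int t\<bar> * W n)"
  proof (rule ennreal_leI)
    have "real (h n) - \<bar>real_of_int t\<bar> \<le> real (card S)"
      using card_stays[of n t] unfolding S_def[symmetric] by linarith
    then have "(real (h n) - \<bar>real_of_int t\<bar>) * W n \<le> real (card S) * W n"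
      using W_pos[of n] by (intro mult_right_mono) auto
    then show "1 - real (card S) * W n \<le> 1 - real (h n) * W n + \<bar>real_of_int t\<bar> * W n"
      by (simp add: algebra_simps)
  qed
  finally show ?thesis .
qed

lemma not_stays_bound_tendsto: "(\<lambda>n. 1 - real (h n) * W n + c * W n) \<longlonglongrightarrow> 0"
  by (rule tendsto_eq_intros total_width W_tendsto_0 refl | simp)+

lemma X_conull: "{0..<1} - X \<in> null_sets lebesgue"
proof -
  have "{0..<1} - X = (\<Union>t. \<Inter>n. {0..<1} - {y. stays n t y})" by (auto simp: X_def)
  moreover have "(\<Inter>n. {0..<1} - {y. stays n t y}) \<in> null_sets lebesgue" for t
  proof (rule null_setsI)
    show "(\<Inter>n. {0..<1} - {y. stays n t y}) \<in> sets lebesgue"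
      using stays_lebesgue by (intro sets.countable_INT) auto
    have "emeasure lebesgue (\<Inter>n. {0..<1} - {y. stays n t y}) \<le> ennreal (1 - real (h n) * W n + \<bar>real_of_int t\<bar> * W n)" for n
      using stays_lebesgue by (intro order.trans[OF emeasure_mono not_stays_measure[of n t]]) auto
    moreover have "(\<lambda>n. ennreal (1 - real (h n) * W n + \<bar>real_of_int t\<bar> * W n)) \<longlonglongrightarrow> ennreal 0"
      by (intro tendsto_ennrealI not_stays_bound_tendsto)
    ultimately have "emeasure lebesgue (\<Inter>n. {0..<1} - {y. stays n t y}) \<le> ennreal 0"
      by (intro LIMSEQ_le_const) auto
    then show "emeasure lebesgue (\<Inter>n. {0..<1} - {y. stays n t y}) = 0" by simp
  qed
  ultimately show ?thesis by (simp only: null_sets_UN)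
qed

end

section \<open>Levels as measurable sets, and mixing\<close>

lemma (in finite_measure) measure_diff_le_symdiff:
  assumes "A \<in> sets M" "B \<in> sets M"
  shows "\<bar>measure M A - measure M B\<bar> \<le> measure M ((A - B) \<union> (B - A))"
proof -
  have "measure M A \<le> measure M (B \<union> ((A - B) \<union> (B - A)))"
    using assms by (intro finite_measure_mono) auto
  also have "\<dots> \<le> measure M B + measure M ((A - B) \<union> (B - A))"
    using assms by (intro measure_Un_le) auto
  finally have 1: "measure M A \<le> measure M B + measure M ((A - B) \<union> (B - A))" .
  have "measure M B \<le> measure M (A \<union> ((A - B) \<union> (B - A)))"
    using assms by (intro finite_measure_mono) auto
  also have "\<dots> \<le> measure M A + measure M ((A - B) \<union> (B - A))"
    using assms by (intro measure_Un_le) auto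
  finally show ?thesis using 1 by linarith
qed

context block_structure
begin

text \<open>
  The cells of stage \<open>Suc n\<close> into which the cells in \<open>S\<close> are cut; \<open>refined q S n\<close> iterates this
  from stage \<open>q\<close> to stage \<open>n\<close>.
\<close>

definition refine :: "nat \<Rightarrow> nat set \<Rightarrow> nat set" where
  "refine n S = {a. a < h n * r n \<and> a div r n \<in> S}"

primrec refined :: "nat \<Rightarrow> nat set \<Rightarrow> nat \<Rightarrow> nat set" where
  "refined q S 0 = S"
| "refined q S (Suc n) = (if n < q then S else refine n (refined q S n))"

definition level_fun :: "nat \<Rightarrow> nat set \<Rightarrow> int \<Rightarrow> real" where
  "level_fun n S j = of_bool (0 \<le> j \<and> j < int (h n) \<and> sigma n (nat j) \<in> S)"

lemma refined_self [simp]: "refined q S q = S"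
  by (cases q) auto

lemma refined_Suc: "q \<le> n \<Longrightarrow> refined q S (Suc n) = refine n (refined q S n)"
  by simp

lemma refine_subset: "refine n S \<subseteq> {..<h (Suc n)}"
  using h_r_le[of n] by (auto simp: refine_def)

lemma refined_subset:
  assumes "S \<subseteq> {..<h q}" "q \<le> n"
  shows "refined q S n \<subseteq> {..<h n}"
  using assms(2)
proof (cases rule: le_imp_less_or_eq[THEN disjE])
  assume "q < n"
  then obtain m where "n = Suc m" "q \<le> m" by (cases n) auto
  then show ?thesis using refine_subset[of m] by simp
qed (use assms(1) in auto)

lemma level_fun_supported: "supported (h n) (level_fun n S)"
  by (auto simp: supported_def level_fun_def)

text \<open>
  The link between the geometry and the blocks: cutting cells on the interval is copying on orbits.
\<close>

lemma level_fun_refine: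
  assumes "S \<subseteq> {..<h n}"
  shows "level_fun (Suc n) (refine n S) = concat_copies n (level_fun n S)"
proof
  fix j
  have at: "level_fun (Suc n) (refine n S) (int (copy_start_nat n i + l)) = level_fun n S (int l)"
    "concat_copies n (level_fun n S) (int (copy_start_nat n i + l)) = level_fun n S (int l)"
    if il: "i < r n" "l < h n" for i l
  proof -
    have "copy_start_nat n i + l < h (Suc n)" using copy_start_nat_end[OF il(1)] il(2) by linarith
    moreover have "sigma n l * r n + i < h n * r n"
      by (rule column_less[OF sigma_less[OF il(2)] il(1)])
    ultimately show "level_fun (Suc n) (refine n S) (int (copy_start_nat n i + l)) = level_fun n S (int l)"
      using il sigma_Suc[OF il(2,1)] by (simp add: level_fun_def refine_def nat_add_distrib)
    show "concat_copies n (level_fun n S) (int (copy_start_nat n i + l)) = level_fun n S (int l)"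
      using concat_copies_at[OF level_fun_supported il(1), of "int l" S] il(2) by (simp add: copy_start_eq_nat)
  qed
  show "level_fun (Suc n) (refine n S) j = concat_copies n (level_fun n S) j"
  proof (cases "\<exists>i<r n. \<exists>l<h n. j = int (copy_start_nat n i + l)")
    case True
    then show ?thesis using at by metis
  next
    case False
    have "concat_copies n (level_fun n S) j = 0"
    proof (cases rule: concat_copies_cases[OF level_fun_supported[of n S], of j])
      case (2 i)
      then have "j = int (copy_start_nat n i + nat (j - copy_start n i))" "nat (j - copy_start n i) < h n" by (auto simp: copy_start_eq_nat)
      then show ?thesis using False 2(1) by blast
    qed
    moreover have "level_fun (Suc n) (refine n S) j = 0"
    proof (rule ccontr)
      assume "level_fun (Suc n) (refine n S) j \<noteq> 0"
      then have j: "0 \<le> j" "nat j < h (Suc n)" and a: "sigma (Suc n) (nat j) \<in> refine n S"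
        by (auto simp: level_fun_def split: if_splits)
      let ?a = "sigma (Suc n) (nat j)"
      have lt: "?a < h n * r n" "?a div r n < h n"
        using a assms by (auto simp: refine_def)
      have "nat j = tau (Suc n) ?a" using tau_sigma[OF j(2)] by simp
      also have "\<dots> = copy_start_nat n (?a mod r n) + tau n (?a div r n)" using lt by (simp add: tau.simps(2))
      finally have "j = int (copy_start_nat n (?a mod r n) + tau n (?a div r n))" using j(1) by linarith
      moreover have "?a mod r n < r n" using r_pos by simp
      ultimately show False using False tau_less[OF lt(2)] by blast
    qed
    ultimately show ?thesis by simp
  qed
qed

lemma level_fun_block_lifts:
  assumes "S \<subseteq> {..<h q}"
  shows "block_lifts q (\<lambda>n. level_fun n (refined q S n))"
  unfolding block_lifts_def
proof (intro conjI allI impI)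
  fix n assume n: "q \<le> n"
  show "level_fun (Suc n) (refined q S (Suc n)) = concat_copies n (level_fun n (refined q S n))"
    unfolding refined_Suc[OF n] by (rule level_fun_refine[OF refined_subset[OF assms n]])
qed (auto simp: level_fun_supported level_fun_def)

lemma sum_level_fun:
  assumes "S \<subseteq> {..<h n}"
  shows "prefix_sum (level_fun n S) (int (h n)) = real (card S)"
proof -
  have "prefix_sum (level_fun n S) (int (h n)) = (\<Sum>j<h n. level_fun n S (int j))"
    unfolding prefix_sum_def
    by (rule sum.reindex_bij_witness[of _ int nat]) auto
  also have "\<dots> = (\<Sum>a<h n. level_fun n S (int (tau n a)))"
    by (rule sum.reindex_bij_betw[OF tau_bij, symmetric])
  also have "\<dots> = (\<Sum>a<h n. of_bool (a \<in> S))"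
    by (intro sum.cong refl) (auto simp: level_fun_def sigma_tau tau_less)
  also have "\<dots> = real (card S)"
    using assms by (simp add: Int_absorb1)
  finally show ?thesis .
qed

lemma corr_level_fun:
  "corr (h n) (level_fun n S) (level_fun n S') (int t) =
     real (card {a. a < h n \<and> a \<in> S \<and> tau n a + t < h n \<and> sigma n (tau n a + t) \<in> S'})"
proof -
  have "corr (h n) (level_fun n S) (level_fun n S') (int t) =
      (\<Sum>j<h n. level_fun n S (int j) * level_fun n S' (int j + int t))"
    unfolding corr_def by (rule sum.reindex_bij_witness[of _ int nat]) auto
  also have "\<dots> = (\<Sum>a<h n. level_fun n S (int (tau n a)) * level_fun n S' (int (tau n a) + int t))"
    by (rule sum.reindex_bij_betw[OF tau_bij, symmetric])
  also have "\<dots> = (\<Sum>a<h n. of_bool (a \<in> S \<and> tau n a + t < h n \<and> sigma n (tau n a + t) \<in> S'))"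
    by (intro sum.cong refl) (auto simp: level_fun_def sigma_tau tau_less nat_add_distrib)
  also have "\<dots> = real (card ({..<h n} \<inter> {a. a \<in> S \<and> tau n a + t < h n \<and> sigma n (tau n a + t) \<in> S'}))"
    by simp
  also have "{..<h n} \<inter> {a. a \<in> S \<and> tau n a + t < h n \<and> sigma n (tau n a + t) \<in> S'} =
     {a. a < h n \<and> a \<in> S \<and> tau n a + t < h n \<and> sigma n (tau n a + t) \<in> S'}" by auto
  finally show ?thesis .
qed

lemma corr_diff: "corr L u (\<lambda>j. v j - c * w j) t = corr L u v t - c * corr L u w t"
  by (simp add: corr_def sum_subtractf sum_distrib_left algebra_simps)

lemma concat_copies_diff:
  "concat_copies n (\<lambda>j. v j - c * w j) = (\<lambda>j. concat_copies n v j - c * concat_copies n w j)"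
  by (auto simp: concat_copies_def sum_subtractf sum_distrib_left)

end

context cut_and_stack
begin

definition M :: "real measure" where "M = lebesgue_on X"

lemma space_M: "space M = X"
  by (simp add: M_def)

lemma sets_M: "A \<in> sets M \<longleftrightarrow> A \<subseteq> X \<and> A \<in> sets lebesgue"
  using X_lebesgue by (simp add: M_def sets_restrict_space_iff)

lemma emeasure_M: "A \<subseteq> X \<Longrightarrow> emeasure M A = emeasure lebesgue A"
  using X_lebesgue by (simp add: M_def emeasure_restrict_space)

lemma emeasure_X_Int:
  assumes "A \<in> sets lebesgue" "A \<subseteq> {0..<1}"
  shows "emeasure M (X \<inter> A) = emeasure lebesgue A"
proof -
  have "A - X \<in> null_sets lebesgue"
    using assms X_lebesgue by (intro null_sets_subset[OF X_conull]) auto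
  then have "emeasure lebesgue ((X \<inter> A) \<union> (A - X)) = emeasure lebesgue (X \<inter> A)"
    using assms X_lebesgue by (intro emeasure_Un_null_set) auto
  moreover have "(X \<inter> A) \<union> (A - X) = A" by auto
  ultimately show ?thesis by (simp add: emeasure_M)
qed

lemma prob_space_M: "prob_space M"
proof
  have "emeasure M (X \<inter> {0..<1}) = 1" by (subst emeasure_X_Int) auto
  then show "emeasure M (space M) = 1" using X_subset by (simp add: space_M Int_absorb2)
qed

sublocale M: prob_space M by (rule prob_space_M)

lemma flow_M:
  assumes "A \<in> sets M"
  shows "flow t ` A \<in> sets M" "measure M (flow t ` A) = measure M A"
    "emeasure M (flow t ` A) = emeasure M A"
proof -
  have A: "A \<in> sets lebesgue" "A \<subseteq> X" using assms by (auto simp: sets_M)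
  have sub: "flow t ` A \<subseteq> X" using A flow_in_X by auto
  note F = flow_preserves_lebesgue[OF A, of t]
  show "flow t ` A \<in> sets M" using F sub by (simp add: sets_M)
  show "emeasure M (flow t ` A) = emeasure M A" using F sub A by (simp add: emeasure_M)
  then show "measure M (flow t ` A) = measure M A" by (simp add: measure_def)
qed

definition level :: "nat \<Rightarrow> nat set \<Rightarrow> real set" where
  "level n S = X \<inter> cells n S"

lemma level_sets: "finite S \<Longrightarrow> level n S \<in> sets M"
  using X_lebesgue cells_lebesgue by (auto simp: sets_M level_def)

lemma level_sets': "S \<subseteq> {..<h n} \<Longrightarrow> level n S \<in> sets M"
  by (rule level_sets) (rule finite_subset[of _ "{..<h n}"], auto)

lemma measure_level:
  assumes "S \<subseteq> {..<h n}"
  shows "measure M (level n S) = real (card S) * W n"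
proof -
  have fin: "finite S" using assms by (rule finite_subset) simp
  have "emeasure M (level n S) = ennreal (real (card S) * W n)"
    unfolding level_def using cells_subset[OF assms] cells_lebesgue[OF fin]
    by (simp add: emeasure_X_Int emeasure_cells[OF fin])
  then show ?thesis using W_pos[of n] by (simp add: measure_def)
qed

lemma level_refine:
  assumes "S \<subseteq> {..<h n}"
  shows "level n S = level (Suc n) (refine n S)"
proof -
  have "y \<in> cells n S \<longleftrightarrow> y \<in> cells (Suc n) (refine n S)" for y
  proof (cases "0 \<le> y")
    case True
    have "idx (Suc n) y < h n * r n" if "idx (Suc n) y div r n \<in> S"
      using that assms r_pos[of n] by (auto simp: div_less_iff_less_mult)
    then show ?thesis using True idx_div[OF True, of n] by (auto simp: cells_def refine_def)
  qed (simp add: cells_def)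
  then show ?thesis by (auto simp: level_def)
qed

lemma level_refined:
  assumes "S \<subseteq> {..<h q}" "q \<le> n"
  shows "level q S = level n (refined q S n)"
  using assms(2)
proof (induction n rule: dec_induct)
  case (step n)
  then show ?case using level_refine[OF refined_subset[OF assms(1) step(1)]] by simp
qed simp

lemma measure_not_stays: "measure M (X - {y. stays n (int t) y}) \<le> 1 - real (h n) * W n + real t * W n"
proof -
  have "emeasure M (X - {y. stays n (int t) y}) \<le> emeasure lebesgue ({0..<1} - {y. stays n (int t) y})"
    using X_subset stays_lebesgue by (subst emeasure_M) (auto intro!: emeasure_mono)
  also have "\<dots> \<le> ennreal (1 - real (h n) * W n + real t * W n)"
    using not_stays_measure[of n "int t"] by simp
  finally have le: "ennreal (measure M (X - {y. stays n (int t) y})) \<le> ennreal (1 - real (h n) * W n + real t * W n)"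
    unfolding M.emeasure_eq_measure .
  have "0 \<le> 1 - real (h n) * W n + real t * W n"
    using width_le_1[of n] W_pos[of n] by simp
  from le[unfolded ennreal_le_iff[OF this]] show ?thesis .
qed

text \<open>
  On points that remain in the tower of stage \<open>n\<close> for time \<open>t\<close>, both memberships can be read off from
  the height, so that the measure of the intersection is a count of levels.
\<close>

lemma measure_flow_Int_level:
  assumes "S \<subseteq> {..<h n}" "S' \<subseteq> {..<h n}"
  shows "\<bar>measure M (flow (int t) ` level n S \<inter> level n S')
      - W n * corr (h n) (level_fun n S) (level_fun n S') (int t)\<bar> \<le> 1 - real (h n) * W n + real t * W n"
proof -
  define S'' where "S'' = {a. a < h n \<and> a \<in> S \<and> tau n a + t < h n \<and> sigma n (tau n a + t) \<in> S'}"
  define E where "E = {y \<in> level n S. flow (int t) y \<in> level n S'}"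
  define B where "B = X - {y. stays n (int t) y}"
  have S'': "S'' \<subseteq> {..<h n}" by (auto simp: S''_def)
  have A: "level n S \<in> sets M" "level n S' \<in> sets M" using assms level_sets' by auto
  have AX: "level n S \<subseteq> X" "level n S' \<subseteq> X" by (auto simp: level_def)
  have img: "flow (int t) ` E = flow (int t) ` level n S \<inter> level n S'" by (auto simp: E_def)
  have "E = flow (- int t) ` (flow (int t) ` level n S \<inter> level n S')"
    unfolding img[symmetric] using AX by (force simp: E_def image_image flow_flow flow_0)
  then have E: "E \<in> sets M"
    using flow_M(1)[OF A(1)] A(2) flow_M(1) by (metis sets.Int)
  have mE: "measure M (flow (int t) ` level n S \<inter> level n S') = measure M E"
    unfolding img[symmetric] by (rule flow_M(2)[OF E])
  have B: "B \<in> sets M" using stays_lebesgue X_lebesgue by (auto simp: B_def sets_M)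
  have iff: "y \<in> E \<longleftrightarrow> y \<in> level n S''" if y: "y \<in> X" "stays n (int t) y" for y
  proof -
    have y0: "0 \<le> y" "idx n y < h n" "tau n (idx n y) + t < h n"
      using y(2) by (auto simp: stays_def in_tower_def height_def)
    have "nat (int (height n y) + int t) = tau n (idx n y) + t" by (simp add: height_def)
    then have "flow (int t) y = at_height n (tau n (idx n y) + t) y" using flow_eq[OF y(2)] by simp
    then have "idx n (flow (int t) y) = sigma n (tau n (idx n y) + t)" "in_tower n (flow (int t) y)"
      using at_height_props[OF y0(1,3)] by auto
    then show ?thesis
      using y y0 flow_in_X[OF y(1)] by (auto simp: E_def level_def cells_def S''_def in_tower_def)
  qed
  have "(E - level n S'') \<union> (level n S'' - E) \<subseteq> B"
    using iff AX by (auto simp: B_def E_def level_def)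
  then have "measure M ((E - level n S'') \<union> (level n S'' - E)) \<le> measure M B"
    using B by (intro M.finite_measure_mono)
  then have "\<bar>measure M E - measure M (level n S'')\<bar> \<le> measure M B"
    using M.measure_diff_le_symdiff[OF E level_sets'[OF S'']] by linarith
  also have "measure M B \<le> 1 - real (h n) * W n + real t * W n"
    unfolding B_def by (rule measure_not_stays)
  finally show ?thesis
    unfolding mE measure_level[OF S''] corr_level_fun S''_def[symmetric] by (simp add: mult.commute)
qed

lemma flow_measure_correlation_bound:
  assumes "S \<subseteq> {..<h q}" "S' \<subseteq> {..<h q}" "q \<le> n"
  shows "\<bar>measure M (flow (int t) ` level q S \<inter> level q S')
      - W n * corr (h n) (level_fun n (refined q S n)) (level_fun n (refined q S' n)) (int t)\<bar>
     \<le> 1 - real (h n) * W n + real t * W n"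
  unfolding level_refined[OF assms(1,3)] level_refined[OF assms(2,3)]
  by (rule measure_flow_Int_level[OF refined_subset[OF assms(1,3)] refined_subset[OF assms(2,3)]])

text \<open>
  Subtracting from the indicator of \<open>S'\<close> its average \<open>\<alpha>\<close> over the tower of stage \<open>q\<close> gives a block
  with sum zero, whose correlations decay. What remains is \<open>\<alpha>\<close> times the measure of the part of the
  moved first set inside the tower; replacing the tower by the whole space costs its complement.
\<close>

lemma mixing_levels:
  assumes S: "S \<subseteq> {..<h q}" and S': "S' \<subseteq> {..<h q}" and "\<delta> > 0"
  shows "\<exists>t0. \<forall>t\<ge>t0. \<bar>measure M (flow (int t) ` level q S \<inter> level q S')
      - measure M (level q S) * measure M (level q S')\<bar> \<le> \<delta> + 2 * (1 - real (h q) * W q)"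
proof -
  define \<alpha> where "\<alpha> = real (card S') / real (h q)"
  define F where "F S n = level_fun n (refined q S n)" for S n
  define V where "V n j = F S' n j - \<alpha> * F {..<h q} n j" for n j
  have hq: "real (h q) > 0" using h_pos by simp
  have "card S' \<le> h q" using card_mono[OF _ S'] by simp
  then have \<alpha>: "0 \<le> \<alpha>" "\<alpha> \<le> 1" using hq by (simp_all add: \<alpha>_def)
  have U: "block_lifts q (F S)" and V1: "block_lifts q (F S')" and P: "block_lifts q (F {..<h q})"
    unfolding F_def using S S' by (intro level_fun_block_lifts; simp)+
  have V: "block_lifts q V"
    unfolding block_lifts_def
  proof (intro conjI allI impI)
    show "supported (h q) (V q)"
      using V1 P by (auto simp: block_lifts_def supported_def V_def)
    show "\<bar>V q j\<bar> \<le> 1" for j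
      using \<alpha> by (auto simp: V_def F_def level_fun_def)
    fix n assume n: "q \<le> n"
    have "V (Suc n) = (\<lambda>j. concat_copies n (F S' n) j - \<alpha> * concat_copies n (F {..<h q} n) j)"
      using block_lifts_props(3)[OF V1 n] block_lifts_props(3)[OF P n] by (simp add: V_def fun_eq_iff)
    then show "V (Suc n) = concat_copies n (V n)"
      by (simp add: concat_copies_diff[symmetric] V_def[abs_def])
  qed
  have "prefix_sum (V q) (int (h q)) =
      prefix_sum (level_fun q S') (int (h q)) - \<alpha> * prefix_sum (level_fun q {..<h q}) (int (h q))"
    by (simp add: prefix_sum_def V_def F_def sum_subtractf sum_distrib_left)
  also have "\<dots> = 0" using sum_level_fun[OF S'] sum_level_fun[of "{..<h q}" q] hq by (simp add: \<alpha>_def)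
  finally have V0: "prefix_sum (V q) (int (h q)) = 0" .
  from corr_tends_to_zero[OF U V V0 \<open>\<delta> > 0\<close>] obtain t0 where
    t0: "\<And>t. t \<ge> t0 \<Longrightarrow> \<exists>N. \<forall>n\<ge>N. \<bar>corr (h n) (F S n) (V n) (int t)\<bar> \<le> \<delta> * real (h n)" by blast
  let ?A = "level q S" and ?B = "level q S'" and ?Q = "level q {..<h q}"
  have sets: "?A \<in> sets M" "?B \<in> sets M" "?Q \<in> sets M" using S S' level_sets' by auto
  have mQ: "measure M ?Q = real (h q) * W q" using measure_level[of "{..<h q}" q] by simp
  have mB: "measure M ?B = \<alpha> * (real (h q) * W q)"
    using measure_level[OF S'] hq by (simp add: \<alpha>_def)
  show ?thesis
  proof (rule exI[of _ t0], intro allI impI)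
    fix t assume t: "t0 \<le> t"
    from t0[OF t] obtain N where
      N: "\<And>n. n \<ge> N \<Longrightarrow> \<bar>corr (h n) (F S n) (V n) (int t)\<bar> \<le> \<delta> * real (h n)" by blast
    let ?m = "\<lambda>S. measure M (flow (int t) ` ?A \<inter> level q S)"
    define b where "b n = 1 - real (h n) * W n + real t * W n" for n
    have b0: "b \<longlonglongrightarrow> 0" unfolding b_def by (rule not_stays_bound_tendsto)
    have "\<bar>?m S' - \<alpha> * ?m {..<h q}\<bar> \<le> \<delta> + 2 * b n" if n: "n \<ge> max N q" for n
    proof -
      have e1: "\<bar>?m S' - W n * corr (h n) (F S n) (F S' n) (int t)\<bar> \<le> b n"
        unfolding F_def b_def using n by (intro flow_measure_correlation_bound S S') simp
      have e2: "\<bar>?m {..<h q} - W n * corr (h n) (F S n) (F {..<h q} n) (int t)\<bar> \<le> b n"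
        unfolding F_def b_def using n by (intro flow_measure_correlation_bound S) simp_all
      have "\<bar>\<alpha> * (?m {..<h q} - W n * corr (h n) (F S n) (F {..<h q} n) (int t))\<bar> \<le> 1 * b n"
        unfolding abs_mult using \<alpha> e2 by (intro mult_mono) auto
      then have e3: "\<bar>\<alpha> * ?m {..<h q} - \<alpha> * (W n * corr (h n) (F S n) (F {..<h q} n) (int t))\<bar> \<le> b n"
        by (simp add: right_diff_distrib)
      have "W n * corr (h n) (F S n) (V n) (int t) =
         W n * corr (h n) (F S n) (F S' n) (int t) - \<alpha> * (W n * corr (h n) (F S n) (F {..<h q} n) (int t))"
        unfolding V_def[abs_def] corr_diff by (simp add: algebra_simps)
      moreover have "\<bar>W n * corr (h n) (F S n) (V n) (int t)\<bar> \<le> \<delta>"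
      proof -
        have "\<bar>W n * corr (h n) (F S n) (V n) (int t)\<bar> \<le> W n * (\<delta> * real (h n))"
          using N[of n] n W_pos[of n] by (simp add: abs_mult mult_left_mono)
        also have "\<dots> = \<delta> * (real (h n) * W n)" by simp
        also have "\<dots> \<le> \<delta> * 1" using width_le_1[of n] \<open>\<delta> > 0\<close> by (intro mult_left_mono) auto
        finally show ?thesis by simp
      qed
      ultimately show ?thesis using e1 e3 by linarith
    qed
    moreover have "(\<lambda>n. \<delta> + 2 * b n) \<longlonglongrightarrow> \<delta>"
      using tendsto_add[OF tendsto_const tendsto_mult_left[OF b0, of 2], of \<delta>] by simp
    ultimately have D: "\<bar>?m S' - \<alpha> * ?m {..<h q}\<bar> \<le> \<delta>"
      by (intro LIMSEQ_le_const[where X = "\<lambda>n. \<delta> + 2 * b n"]) (auto intro!: exI[of _ "max N q"])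
    have fA: "flow (int t) ` ?A \<in> sets M" "measure M (flow (int t) ` ?A) = measure M ?A"
      using flow_M[OF sets(1)] by auto
    have "measure M (flow (int t) ` ?A - ?Q) \<le> measure M (space M - ?Q)"
      using sets fA sets.sets_into_space[OF fA(1)] by (intro M.finite_measure_mono) auto
    also have "\<dots> = 1 - real (h q) * W q" using M.prob_compl[OF sets(3)] mQ by simp
    finally have "measure M ?A - ?m {..<h q} \<le> 1 - real (h q) * W q"
      using M.finite_measure_Diff'[OF fA(1) sets(3)] fA(2) by simp
    moreover have "?m {..<h q} \<le> measure M ?A"
      using fA sets by (metis M.finite_measure_mono inf_le1)
    ultimately have "\<bar>\<alpha> * (?m {..<h q} - measure M ?A)\<bar> \<le> 1 * (1 - real (h q) * W q)"
      unfolding abs_mult using \<alpha> by (intro mult_mono) auto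
    then have D2: "\<bar>\<alpha> * ?m {..<h q} - \<alpha> * measure M ?A\<bar> \<le> 1 - real (h q) * W q"
      by (simp add: right_diff_distrib)
    have "\<bar>\<alpha> * measure M ?A * (1 - real (h q) * W q)\<bar> \<le> 1 * 1 * (1 - real (h q) * W q)"
      unfolding abs_mult using \<alpha> width_le_1[of q] by (intro mult_mono) auto
    then have D3: "\<bar>\<alpha> * measure M ?A - measure M ?A * measure M ?B\<bar> \<le> 1 - real (h q) * W q"
      unfolding mB by (simp add: algebra_simps)
    show "\<bar>?m S' - measure M ?A * measure M ?B\<bar> \<le> \<delta> + 2 * (1 - real (h q) * W q)"
    proof -
      have "\<bar>x - w\<bar> \<le> \<delta> + 2 * u" if "\<bar>x - y\<bar> \<le> \<delta>" "\<bar>y - z\<bar> \<le> u" "\<bar>z - w\<bar> \<le> u" for x y z w u :: real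
        using that by linarith
      from this[OF D D2 D3] show ?thesis .
    qed
  qed
qed

text \<open>
  Inside an open set, the cells that are contained in it exhaust it as their width tends to zero; an
  arbitrary set is nearly open by outer regularity.
\<close>

lemma level_approximation:
  assumes A: "A \<in> sets M" and "\<eta> > 0"
  shows "\<exists>n0. \<forall>n\<ge>n0. \<exists>S. S \<subseteq> {..<h n} \<and> measure M ((A - level n S) \<union> (level n S - A)) < \<eta>"
proof -
  have AX: "A \<subseteq> X" and Al: "A \<in> sets lebesgue" using A by (auto simp: sets_M)
  obtain T where T: "open T" "A \<subseteq> T" "T - A \<in> lmeasurable" "emeasure lebesgue (T - A) < ennreal (\<eta> / 2)"
    using sets_lebesgue_outer_open[OF Al, of "\<eta> / 2"] \<open>\<eta> > 0\<close> by auto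
  have Tl: "X \<inter> T \<in> sets M" using T(1) X_lebesgue by (auto simp: sets_M)
  define D where "D n = {a. a < h n \<and> cells n {a} \<subseteq> T}" for n
  have Dsub: "D n \<subseteq> {..<h n}" for n by (auto simp: D_def)
  define L where "L n = level n (D n)" for n
  have L_iff: "y \<in> L n \<longleftrightarrow> y \<in> X \<and> in_tower n y \<and> cells n {idx n y} \<subseteq> T" for y n
    by (auto simp: L_def level_def D_def in_tower_def cells_def)
  have LT: "L n \<subseteq> X \<inter> T" for n
    unfolding subset_iff L_iff by (auto simp: cells_def in_tower_def)
  have inc: "incseq L"
  proof (rule incseq_SucI, rule subsetI)
    fix n y assume y: "y \<in> L n"
    then have y': "y \<in> X" "in_tower n y" "cells n {idx n y} \<subseteq> T" by (auto simp: L_iff)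
    have "cells (Suc n) {idx (Suc n) y} \<subseteq> cells n {idx n y}"
      using idx_div[of _ n] y'(2) by (auto simp: cells_def in_tower_def)
    then show "y \<in> L (Suc n)" using y' in_tower_Suc[OF y'(2)] by (auto simp: L_iff)
  qed
  have UL: "(\<Union>n. L n) = X \<inter> T"
  proof
    show "(\<Union>n. L n) \<subseteq> X \<inter> T" using LT by auto
    show "X \<inter> T \<subseteq> (\<Union>n. L n)"
    proof
      fix y assume y: "y \<in> X \<inter> T"
      then obtain \<epsilon> where \<epsilon>: "\<epsilon> > 0" "ball y \<epsilon> \<subseteq> T" using T(1) open_contains_ball by blast
      have "eventually (\<lambda>n. W n < \<epsilon>) sequentially" using W_tendsto_0 \<epsilon>(1) by (rule order_tendstoD)
      moreover have "eventually (\<lambda>n. stays n 0 y) sequentially" using y eventually_stays by auto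
      ultimately have "eventually (\<lambda>n. W n < \<epsilon> \<and> stays n 0 y) sequentially" by (rule eventually_conj)
      then obtain n where n: "W n < \<epsilon>" "stays n 0 y" by (auto dest: eventually_happens)
      have y0: "0 \<le> y" "in_tower n y" using n(2) by (auto simp: stays_def in_tower_def)
      have "cells n {idx n y} \<subseteq> ball y \<epsilon>"
      proof
        fix z assume "z \<in> cells n {idx n y}"
        then have "\<bar>z - y\<bar> < W n"
          using idx_bounds[OF y0(1), of n] unfolding cells_single by (auto simp: algebra_simps)
        then show "z \<in> ball y \<epsilon>" using n(1) by (simp add: dist_real_def)
      qed
      then have "y \<in> L n" using y y0 \<epsilon> by (auto simp: L_iff)
      then show "y \<in> (\<Union>n. L n)" by auto
    qed
  qed
  have Ls: "L n \<in> sets M" for n unfolding L_def by (rule level_sets'[OF Dsub])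
  have "(\<lambda>n. measure M (L n)) \<longlonglongrightarrow> measure M (\<Union>n. L n)"
    using Ls inc by (intro M.finite_Lim_measure_incseq) auto
  then have "eventually (\<lambda>n. measure M (L n) > measure M (X \<inter> T) - \<eta> / 2) sequentially"
    unfolding UL using \<open>\<eta> > 0\<close> by (intro order_tendstoD) auto
  then obtain n0 where n0: "\<And>n. n \<ge> n0 \<Longrightarrow> measure M (L n) > measure M (X \<inter> T) - \<eta> / 2"
    by (auto simp: eventually_sequentially)
  have out: "measure M (X \<inter> T - A) < \<eta> / 2"
  proof -
    have "emeasure M (X \<inter> T - A) = emeasure lebesgue (X \<inter> T - A)" by (intro emeasure_M) auto
    also have "\<dots> \<le> emeasure lebesgue (T - A)" using T(3) by (intro emeasure_mono) auto
    also have "\<dots> < ennreal (\<eta> / 2)" by (rule T(4))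
    finally show ?thesis using \<open>\<eta> > 0\<close> by (simp add: M.emeasure_eq_measure ennreal_less_iff)
  qed
  show ?thesis
  proof (rule exI[of _ n0], intro allI impI)
    fix n assume n: "n0 \<le> n"
    have "measure M ((A - L n) \<union> (L n - A)) \<le> measure M ((X \<inter> T - L n) \<union> (X \<inter> T - A))"
      using T(2) AX LT[of n] Ls Tl A by (intro M.finite_measure_mono) auto
    also have "\<dots> \<le> measure M (X \<inter> T - L n) + measure M (X \<inter> T - A)"
      using Ls Tl A by (intro measure_Un_le) auto
    also have "measure M (X \<inter> T - L n) = measure M (X \<inter> T) - measure M (L n)"
      by (rule M.finite_measure_Diff[OF Tl Ls LT])
    finally have "measure M ((A - L n) \<union> (L n - A)) < \<eta>" using out n0[OF n] by linarith
    then show "\<exists>S. S \<subseteq> {..<h n} \<and> measure M ((A - level n S) \<union> (level n S - A)) < \<eta>"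
      using Dsub by (auto simp: L_def)
  qed
qed

lemma flow_Int_symdiff_bound:
  assumes "A \<in> sets M" "A' \<in> sets M" "B \<in> sets M" "B' \<in> sets M"
  shows "\<bar>measure M (flow t ` A \<inter> B) - measure M (flow t ` A' \<inter> B')\<bar>
    \<le> measure M ((A - A') \<union> (A' - A)) + measure M ((B - B') \<union> (B' - B))"
proof -
  have f: "flow t ` A \<in> sets M" "flow t ` A' \<in> sets M" using assms flow_M by auto
  have AX: "A \<subseteq> X" "A' \<subseteq> X" using assms by (auto simp: sets_M)
  have img: "(flow t ` A - flow t ` A') \<union> (flow t ` A' - flow t ` A) = flow t ` ((A - A') \<union> (A' - A))"
    using AX inj_on_image_set_diff[OF flow_inj, of A A' t] inj_on_image_set_diff[OF flow_inj, of A' A t] by auto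
  have "\<bar>measure M (flow t ` A \<inter> B) - measure M (flow t ` A' \<inter> B')\<bar>
      \<le> measure M ((flow t ` A \<inter> B - flow t ` A' \<inter> B') \<union> (flow t ` A' \<inter> B' - flow t ` A \<inter> B))"
    using f assms by (intro M.measure_diff_le_symdiff) auto
  also have "\<dots> \<le> measure M (flow t ` ((A - A') \<union> (A' - A)) \<union> ((B - B') \<union> (B' - B)))"
    unfolding img[symmetric] using f assms by (intro M.finite_measure_mono) auto
  also have "\<dots> \<le> measure M (flow t ` ((A - A') \<union> (A' - A))) + measure M ((B - B') \<union> (B' - B))"
    unfolding img[symmetric] using f assms by (intro measure_Un_le) auto
  also have "measure M (flow t ` ((A - A') \<union> (A' - A))) = measure M ((A - A') \<union> (A' - A))"
    using assms by (intro flow_M) auto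
  finally show ?thesis .
qed

theorem flow_mixing:
  assumes A: "A \<in> sets M" and B: "B \<in> sets M"
  shows "(\<lambda>t. measure M (flow (int t) ` A \<inter> B)) \<longlonglongrightarrow> measure M A * measure M B"
proof (rule LIMSEQ_I)
  fix \<epsilon> :: real assume "\<epsilon> > 0"
  define \<eta> where "\<eta> = \<epsilon> / 8"
  have \<eta>: "\<eta> > 0" using \<open>\<epsilon> > 0\<close> by (simp add: \<eta>_def)
  obtain nA where nA: "\<And>n. n \<ge> nA \<Longrightarrow> \<exists>S. S \<subseteq> {..<h n} \<and> measure M ((A - level n S) \<union> (level n S - A)) < \<eta>"
    using level_approximation[OF A \<eta>] by blast
  obtain nB where nB: "\<And>n. n \<ge> nB \<Longrightarrow> \<exists>S. S \<subseteq> {..<h n} \<and> measure M ((B - level n S) \<union> (level n S - B)) < \<eta>"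
    using level_approximation[OF B \<eta>] by blast
  have "eventually (\<lambda>n. real (h n) * W n > 1 - \<eta>) sequentially"
    using total_width \<eta> by (intro order_tendstoD) auto
  then obtain nC where nC: "\<And>n. n \<ge> nC \<Longrightarrow> real (h n) * W n > 1 - \<eta>"
    by (auto simp: eventually_sequentially)
  define q where "q = max nA (max nB nC)"
  have q: "q \<ge> nA" "q \<ge> nB" "q \<ge> nC" by (auto simp: q_def)
  obtain S where S: "S \<subseteq> {..<h q}" "measure M ((A - level q S) \<union> (level q S - A)) < \<eta>"
    using nA[OF q(1)] by blast
  obtain S' where S': "S' \<subseteq> {..<h q}" "measure M ((B - level q S') \<union> (level q S' - B)) < \<eta>"
    using nB[OF q(2)] by blast
  have Wq: "1 - real (h q) * W q < \<eta>" using nC[OF q(3)] by simp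
  let ?A = "level q S" and ?B = "level q S'"
  have sets: "?A \<in> sets M" "?B \<in> sets M" using S S' level_sets' by auto
  obtain t0 where t0: "\<And>t. t \<ge> t0 \<Longrightarrow> \<bar>measure M (flow (int t) ` ?A \<inter> ?B) - measure M ?A * measure M ?B\<bar>
      \<le> \<eta> + 2 * (1 - real (h q) * W q)"
    using mixing_levels[OF S(1) S'(1) \<eta>] by blast
  have dA: "\<bar>measure M A - measure M ?A\<bar> < \<eta>" and dB: "\<bar>measure M B - measure M ?B\<bar> < \<eta>"
    using M.measure_diff_le_symdiff[OF A sets(1)] M.measure_diff_le_symdiff[OF B sets(2)] S S' by linarith+
  have "\<bar>measure M A * measure M B - measure M ?A * measure M ?B\<bar>
      = \<bar>(measure M A - measure M ?A) * measure M B + measure M ?A * (measure M B - measure M ?B)\<bar>"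
    by (simp add: algebra_simps)
  also have "\<dots> \<le> \<bar>measure M A - measure M ?A\<bar> * measure M B + measure M ?A * \<bar>measure M B - measure M ?B\<bar>"
    by (rule order.trans[OF abs_triangle_ineq]) (simp add: abs_mult)
  also have "\<dots> \<le> \<eta> * 1 + 1 * \<eta>"
    using dA dB by (intro add_mono mult_mono) auto
  finally have prod: "\<bar>measure M A * measure M B - measure M ?A * measure M ?B\<bar> \<le> 2 * \<eta>" by simp
  show "\<exists>N. \<forall>t\<ge>N. norm (measure M (flow (int t) ` A \<inter> B) - measure M A * measure M B) < \<epsilon>"
  proof (rule exI[of _ t0], intro allI impI)
    fix t assume t: "t0 \<le> t"
    have d: "\<bar>measure M (flow (int t) ` A \<inter> B) - measure M (flow (int t) ` ?A \<inter> ?B)\<bar> < 2 * \<eta>"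
      using flow_Int_symdiff_bound[OF A sets(1) B sets(2), of "int t"] S S' by linarith
    have "\<bar>x - z\<bar> < 8 * \<eta>"
      if "\<bar>x - y\<bar> < 2 * \<eta>" "\<bar>y - w\<bar> \<le> \<eta> + 2 * u" "\<bar>z - w\<bar> \<le> 2 * \<eta>" "u < \<eta>" for x y z w u
      using that by linarith
    from this[OF d t0[OF t] prod Wq] show "norm (measure M (flow (int t) ` A \<inter> B) - measure M A * measure M B) < \<epsilon>"
      by (simp add: \<eta>_def)
  qed
qed

end

section \<open>Rigid parts and over-independence\<close>

context cut_and_stack
begin

definition column_cells :: "nat \<Rightarrow> nat set \<Rightarrow> nat \<Rightarrow> nat set" where
  "column_cells n T k = {a. a < h n * r n \<and> a div r n \<in> T \<and> a mod r n < k}"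

definition columns_part :: "nat \<Rightarrow> nat \<Rightarrow> real set" where
  "columns_part n k = level (Suc n) (column_cells n {..<h n} k)"

lemma column_cells_subset: "column_cells n T k \<subseteq> {..<h (Suc n)}"
  using h_r_le[of n] by (auto simp: column_cells_def)

lemma card_column_cells:
  assumes "T \<subseteq> {..<h n}" "k \<le> r n"
  shows "card (column_cells n T k) = card T * k"
proof -
  have into: "q * r n + i \<in> column_cells n T k" if "q \<in> T" "i < k" for q i
  proof -
    have "q < h n" "i < r n" using that assms by auto
    then show ?thesis using column_less[of q n i] that by (simp add: column_cells_def)
  qed
  have "bij_betw (\<lambda>(q, i). q * r n + i) (T \<times> {..<k}) (column_cells n T k)"
  proof (rule bij_betw_byWitness[where f' = "\<lambda>a. (a div r n, a mod r n)"])
    show "(\<lambda>(q, i). q * r n + i) ` (T \<times> {..<k}) \<subseteq> column_cells n T k" using into by auto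
  qed (use assms in \<open>auto simp: column_cells_def div_mult_mod_eq\<close>)
  from bij_betw_same_card[OF this] show ?thesis by (simp add: card_cartesian_product)
qed

lemma level_Int_columns_part:
  assumes "T \<subseteq> {..<h n}"
  shows "level n T \<inter> columns_part n k = level (Suc n) (column_cells n T k)"
  unfolding level_refine[OF assms] columns_part_def
  using assms by (auto simp: level_def cells_def refine_def column_cells_def)

lemma measure_level_Int_columns_part:
  assumes "T \<subseteq> {..<h n}" "k \<le> r n"
  shows "measure M (level n T \<inter> columns_part n k) = measure M (level n T) * (real k / real (r n))"
proof -
  have "real (r n) > 0" using r_pos by simp
  then show ?thesis
    unfolding level_Int_columns_part[OF assms(1)] measure_level[OF column_cells_subset]
      card_column_cells[OF assms] measure_level[OF assms(1)] W_Suc'[of n]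
    by (simp add: field_simps)
qed

lemma columns_part_sets: "columns_part n k \<in> sets M"
  unfolding columns_part_def by (rule level_sets'[OF column_cells_subset])

lemma measure_columns_part:
  assumes "k \<le> r n"
  shows "measure M (columns_part n k) = real (h n) * W n * (real k / real (r n))"
proof -
  have "columns_part n k = level n {..<h n} \<inter> columns_part n k"
    unfolding level_Int_columns_part[OF order_refl] by (simp add: columns_part_def)
  then show ?thesis
    using measure_level_Int_columns_part[OF order_refl assms] measure_level[of "{..<h n}" n] by simp
qed

text \<open>
  The columns whose copies have offset zero. Consecutive ones are exactly \<open>H n\<close> apart.
\<close>

definition rigid_part :: "nat \<Rightarrow> real set" where
  "rigid_part n = columns_part n (e n)"

lemma e_le_r: "e n \<le> r n"
  by (simp add: r_def)

lemma e_div_r: "real (e n) / real (r n) = 1 / real (Suc n)"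
  using e_pos[of n] by (simp add: r_def del: of_nat_Suc mult_Suc)

lemma rigid_part_sets: "rigid_part n \<in> sets M"
  by (simp add: rigid_part_def columns_part_sets)

lemma measure_rigid_part: "measure M (rigid_part n) \<le> 1 / real (Suc n)"
proof -
  have "real (h n) * W n * (1 / real (Suc n)) \<le> 1 * (1 / real (Suc n))"
    using width_le_1[of n] by (intro mult_right_mono) auto
  then show ?thesis
    unfolding rigid_part_def measure_columns_part[OF e_le_r] e_div_r by simp
qed

text \<open>
  The set \<open>rigid_part n\<close> is a union of cells of stage \<open>Suc n \<le> m\<close>, and \<open>rigid_part m\<close> takes the same
  proportion of each cell of stage \<open>m\<close> in the tower.
\<close>

lemma measure_rigid_part_Int:
  assumes "n < m"
  shows "measure M (rigid_part n \<inter> rigid_part m) \<le> 1 / real (Suc n) * (1 / real (Suc m))"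
proof -
  define T where "T = refined (Suc n) (column_cells n {..<h n} (e n)) m"
  have T: "T \<subseteq> {..<h m}" "rigid_part n = level m T"
    using refined_subset[OF column_cells_subset, of n m] level_refined[OF column_cells_subset, of n m] assms
    by (auto simp: T_def rigid_part_def columns_part_def)
  have "measure M (rigid_part n \<inter> rigid_part m) = measure M (rigid_part n) * (1 / real (Suc m))"
    unfolding T(2) unfolding rigid_part_def measure_level_Int_columns_part[OF T(1) e_le_r] e_div_r ..
  also have "\<dots> \<le> 1 / real (Suc n) * (1 / real (Suc m))"
    using measure_rigid_part[of n] by (intro mult_right_mono) auto
  finally show ?thesis .
qed

lemma harmonic_block_ge_1: "\<exists>N'. 1 \<le> (\<Sum>n\<in>{N..<N'}. 1 / real (Suc n))"
proof (rule ccontr)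
  assume "\<not> ?thesis"
  then have lt: "(\<Sum>n\<in>{N..<N'}. 1 / real (Suc n)) < 1" for N' by (auto simp: not_le)
  have "summable (\<lambda>n. 1 / real (Suc (n + N)))"
  proof (rule summableI_nonneg_bounded)
    fix k
    have "(\<Sum>n<k. 1 / real (Suc (n + N))) = (\<Sum>n\<in>{N..<N+k}. 1 / real (Suc n))"
      by (rule sum.reindex_bij_witness[of _ "\<lambda>n. n - N" "\<lambda>n. n + N"]) auto
    then show "(\<Sum>n<k. 1 / real (Suc (n + N))) \<le> 1" using lt[of "N + k"] by simp
  qed simp
  then have "summable (\<lambda>n. 1 / real (Suc n))" by (subst (asm) summable_iff_shift[where f = "\<lambda>n. 1 / real (Suc n)"])
  then have "summable (\<lambda>n. inverse (real n))"
    by (subst summable_Suc_iff[symmetric]) (simp add: field_simps)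
  then show False using not_summable_harmonic[where 'a = real] by simp
qed

text \<open>
  If \<open>E\<close> took more than the proportion \<open>\<kappa>\<close> of every rigid part from \<open>N\<close> on, the number \<open>Z\<close> of rigid
  parts containing a point would satisfy \<open>\<integral>\<^sub>E Z \<ge> \<kappa> s\<close>, where \<open>s\<close> is a partial sum of the harmonic
  series. Since \<open>\<integral> Z\<^sup>2 \<le> s\<^sup>2 + s\<close> by near independence, the Cauchy-Schwarz inequality bounds the
  measure of \<open>E\<close> from below as soon as \<open>s \<ge> 1\<close>.
\<close>

lemma exists_rigid_part_avoiding:
  assumes E: "E \<in> sets M" and "\<kappa> > 0" and small: "2 * measure M E < \<kappa>\<^sup>2"
  shows "\<exists>n\<ge>N. measure M (rigid_part n \<inter> E) \<le> \<kappa> / real (Suc n)"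
proof (rule ccontr)
  assume "\<not> ?thesis"
  then have big: "\<kappa> / real (Suc n) < measure M (rigid_part n \<inter> E)" if "n \<ge> N" for n
    using that by (meson not_le)
  obtain N' where N': "1 \<le> (\<Sum>n\<in>{N..<N'}. 1 / real (Suc n))" using harmonic_block_ge_1 by blast
  define J where "J = {N..<N'}"
  define s where "s = (\<Sum>n\<in>J. 1 / real (Suc n))"
  have s1: "1 \<le> s" using N' by (simp add: s_def J_def)
  define Z where "Z y = (\<Sum>n\<in>J. indicator (rigid_part n) y :: real)" for y
  note R = rigid_part_sets
  have int: "integrable M (indicator A :: real \<Rightarrow> real)" if "A \<in> sets M" for A
    using that by (simp add: M.emeasure_eq_measure)
  have ZE: "Z y * indicator E y = (\<Sum>n\<in>J. indicator (rigid_part n \<inter> E) y)" for y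
    by (simp add: Z_def sum_distrib_right indicator_inter_arith)
  have ZZ: "Z y ^ 2 = (\<Sum>n\<in>J. \<Sum>m\<in>J. indicator (rigid_part n \<inter> rigid_part m) y)" for y
    by (simp add: Z_def power2_eq_square sum_product indicator_inter_arith)
  have iZE: "integrable M (\<lambda>y. Z y * indicator E y)"
    unfolding ZE using R E by (intro Bochner_Integration.integrable_sum int) auto
  have iZZ: "integrable M (\<lambda>y. Z y ^ 2)"
    unfolding ZZ using R by (intro Bochner_Integration.integrable_sum int) auto
  have eZE: "(\<integral>y. Z y * indicator E y \<partial>M) = (\<Sum>n\<in>J. measure M (rigid_part n \<inter> E))"
  proof -
    have "(\<integral>y. Z y * indicator E y \<partial>M) = (\<Sum>n\<in>J. \<integral>y. indicator (rigid_part n \<inter> E) y \<partial>M)"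
      unfolding ZE using R E by (intro Bochner_Integration.integral_sum int) auto
    also have "\<dots> = (\<Sum>n\<in>J. measure M (rigid_part n \<inter> E))"
      using R E sets.sets_into_space by (intro sum.cong refl) (simp add: Int_absorb2 Int_absorb1)
    finally show ?thesis .
  qed
  have eZZ: "(\<integral>y. Z y ^ 2 \<partial>M) = (\<Sum>n\<in>J. \<Sum>m\<in>J. measure M (rigid_part n \<inter> rigid_part m))"
  proof -
    have "(\<integral>y. Z y ^ 2 \<partial>M) = (\<Sum>n\<in>J. \<integral>y. (\<Sum>m\<in>J. indicator (rigid_part n \<inter> rigid_part m) y) \<partial>M)"
      unfolding ZZ using R by (intro Bochner_Integration.integral_sum Bochner_Integration.integrable_sum int) auto
    also have "\<dots> = (\<Sum>n\<in>J. \<Sum>m\<in>J. \<integral>y. indicator (rigid_part n \<inter> rigid_part m) y \<partial>M)"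
      using R by (intro sum.cong refl Bochner_Integration.integral_sum int) auto
    also have "\<dots> = (\<Sum>n\<in>J. \<Sum>m\<in>J. measure M (rigid_part n \<inter> rigid_part m))"
      using R sets.sets_into_space by (intro sum.cong refl) (simp add: Int_absorb2 Int_absorb1)
    finally show ?thesis .
  qed
  have "\<kappa> * s = (\<Sum>n\<in>J. \<kappa> / real (Suc n))" by (simp add: s_def sum_distrib_left)
  also have "\<dots> \<le> (\<Sum>n\<in>J. measure M (rigid_part n \<inter> E))"
    using big by (intro sum_mono less_imp_le) (auto simp: J_def)
  finally have lower: "\<kappa> * s \<le> (\<integral>y. Z y * indicator E y \<partial>M)" unfolding eZE .
  have "(\<Sum>n\<in>J. \<Sum>m\<in>J. measure M (rigid_part n \<inter> rigid_part m))
     \<le> (\<Sum>n\<in>J. \<Sum>m\<in>J. 1 / real (Suc n) * (1 / real (Suc m)) + (if n = m then 1 / real (Suc n) else 0))"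
  proof (intro sum_mono)
    fix n m :: nat
    consider "n < m" | "m < n" | "n = m" by linarith
    then show "measure M (rigid_part n \<inter> rigid_part m)
       \<le> 1 / real (Suc n) * (1 / real (Suc m)) + (if n = m then 1 / real (Suc n) else 0)"
    proof cases
      case 1
      then show ?thesis using measure_rigid_part_Int[OF 1] by simp
    next
      case 2
      then show ?thesis using measure_rigid_part_Int[OF 2] by (simp add: Int_commute mult.commute)
    next
      case 3
      then have "measure M (rigid_part n \<inter> rigid_part m) \<le> 0 + 1 / real (Suc n)"
        using measure_rigid_part[of n] by simp
      also have "\<dots> \<le> 1 / real (Suc n) * (1 / real (Suc m)) + (if n = m then 1 / real (Suc n) else 0)"
        using 3 by (intro add_mono) auto
      finally show ?thesis .
    qed
  qed
  also have "\<dots> = s * s + s"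
    by (simp add: sum.distrib s_def sum_product J_def)
  finally have upper: "(\<integral>y. Z y ^ 2 \<partial>M) \<le> s * s + s" unfolding eZZ .
  (* Integrating 2 Z 1_E \<le> (s / \<rho>) 1_E + (\<rho> / s) Z^2 with this weight leaves, after division by s,
     2 \<kappa> \<le> 2 measure M E / \<kappa> + \<kappa>. *)
  define \<rho> where "\<rho> = \<kappa> / 2"
  have \<rho>: "\<rho> > 0" using \<open>\<kappa> > 0\<close> by (simp add: \<rho>_def)
  have "(\<integral>y. 2 * (Z y * indicator E y) \<partial>M) \<le> (\<integral>y. s / \<rho> * indicator E y + \<rho> / s * Z y ^ 2 \<partial>M)"
  proof (intro integral_mono Bochner_Integration.integrable_add integrable_mult_right iZE iZZ int E)
    fix y
    have "0 \<le> (s * indicator E y - \<rho> * Z y) ^ 2 / (\<rho> * s)" using \<rho> s1 by simp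
    also have "\<dots> = s / \<rho> * indicator E y ^ 2 + \<rho> / s * Z y ^ 2 - 2 * (Z y * indicator E y)"
      using \<rho> s1 by (simp add: power2_eq_square field_simps)
    also have "(indicator E y :: real) ^ 2 = indicator E y" by (simp add: indicator_def)
    finally show "2 * (Z y * indicator E y) \<le> s / \<rho> * indicator E y + \<rho> / s * Z y ^ 2" by simp
  qed
  also have "\<dots> = s / \<rho> * measure M E + \<rho> / s * (\<integral>y. Z y ^ 2 \<partial>M)"
    using int[OF E] iZZ sets.sets_into_space[OF E] by (simp add: Int_absorb2 Int_absorb1)
  also have "\<dots> \<le> s / \<rho> * measure M E + \<rho> / s * (s * s + s)"
    using upper \<rho> s1 by (intro add_left_mono mult_left_mono) auto
  also have "\<dots> = s / \<rho> * measure M E + \<rho> * (s + 1)"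
    using s1 by (simp add: field_simps)
  also have "\<dots> \<le> s / \<rho> * measure M E + \<rho> * (2 * s)"
    using s1 \<rho> by (intro add_left_mono mult_left_mono) auto
  also have "\<dots> = s * (2 * measure M E / \<kappa> + \<kappa>)"
    using \<open>\<kappa> > 0\<close> by (simp add: \<rho>_def field_simps)
  finally have "2 * (\<kappa> * s) \<le> s * (2 * measure M E / \<kappa> + \<kappa>)"
    using lower by simp
  then have "s * (2 * \<kappa>) \<le> s * (2 * measure M E / \<kappa> + \<kappa>)" by (simp add: mult_ac)
  then have "2 * \<kappa> \<le> 2 * measure M E / \<kappa> + \<kappa>" using s1 by simp
  then have "\<kappa> ^ 2 \<le> 2 * measure M E" using \<open>\<kappa> > 0\<close> by (simp add: field_simps power2_eq_square)
  then show False using small by simp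
qed

text \<open>
  As long as the column stays among the first \<open>e n\<close>, moving by \<open>H n\<close> means moving to the same height
  in the next copy.
\<close>

lemma rigid_return:
  assumes y: "y \<in> columns_part n (e n - m)" and "m \<le> e n" "k \<le> m"
  shows "flow (int (k * H n)) y \<in> rigid_part n"
    "idx n (flow (int (k * H n)) y) = idx n y" "in_tower n y" "in_tower n (flow (int (k * H n)) y)"
proof -
  have yX: "y \<in> X" and a: "idx (Suc n) y < h n * r n" "column n y < e n - m" "0 \<le> y"
    using y by (auto simp: columns_part_def level_def cells_def column_cells_def column_def)
  define i where "i = column n y"
  define j where "j = height n y"
  have "idx (Suc n) y div r n < h n" using a(1) by (simp add: less_mult_imp_div_less)
  then show tow: "in_tower n y" using idx_div[OF a(3), of n] a(3) by (simp add: in_tower_def)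
  have j: "j < h n" unfolding j_def by (rule height_less[OF tow])
  have ik: "i + k < e n" using a(2) assms(2,3) by (simp add: i_def)
  then have ikr: "i + k < r n" using e_le_r[of n] by simp
  have pos: "copy_start_nat n i = i * H n" "copy_start_nat n (i + k) = (i + k) * H n"
    using ik x_zero[of i n] x_zero[of "i + k" n] by (simp_all add: copy_start_nat_def)
  have hS: "height (Suc n) y = copy_start_nat n i + j" using in_tower_Suc(3)[OF tow] by (simp add: i_def j_def)
  have "int (height (Suc n) y) + int (k * H n) = int (copy_start_nat n (i + k) + j)"
    unfolding hS pos by (simp add: algebra_simps)
  then have arg: "nat (int (height (Suc n) y) + int (k * H n)) = copy_start_nat n (i + k) + j"
    by (simp only: nat_int)
  have lt: "copy_start_nat n (i + k) + j < h (Suc n)" using copy_start_nat_end[OF ikr] j by simp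
  have ok: "stays (Suc n) (int (k * H n)) y"
    using in_tower_Suc(2)[OF tow] lt arg by (simp add: stays_def)
  let ?z = "flow (int (k * H n)) y"
  have z: "?z = at_height (Suc n) (copy_start_nat n (i + k) + j) y" using flow_eq[OF ok] arg by simp
  note P = at_height_props[OF a(3) lt]
  have "sigma n j = idx n y" using tow by (simp add: j_def height_def in_tower_def sigma_tau)
  then have iS: "idx (Suc n) ?z = idx n y * r n + (i + k)"
    unfolding z P(1) sigma_Suc[OF j ikr] by simp
  have z0: "0 \<le> ?z" unfolding z using P(2) by (simp add: in_tower_def)
  show iz: "idx n ?z = idx n y" using idx_div[OF z0, of n] iS ikr by simp
  then show "in_tower n ?z" using tow z0 by (simp add: in_tower_def)
  have "idx (Suc n) ?z < h n * r n" unfolding iS using tow ikr by (intro column_less) (simp add: in_tower_def)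
  moreover have "idx (Suc n) ?z div r n < h n" "idx (Suc n) ?z mod r n < e n"
    using iS ikr ik tow by (simp_all add: in_tower_def)
  ultimately show "?z \<in> rigid_part n"
    using flow_in_X[OF yX] z0 by (simp add: rigid_part_def columns_part_def level_def cells_def column_cells_def)
qed

text \<open>
  Let \<open>G\<close> be the number of visits to \<open>A\<close> at the times \<open>k H\<^sub>n\<close>, \<open>k < m\<close>, minus its mean. If
  \<open>A\<close> is not over-independent at the positive multiples of \<open>H\<^sub>n\<close>, the variance is at most \<open>m\<close>.
  On the part \<open>C\<close> of the rigid set, \<open>G\<close> equals \<open>m\<close> times the deviation of the indicator of a
  union of levels from the measure of \<open>A\<close>, up to the number of visits to the error set \<open>E\<close>; so
  the variance is at least of order \<open>m\<^sup>2 / n\<close>. With \<open>m = (n+1)\<^sup>2\<close> this exceeds \<open>m\<close> for large \<open>n\<close>.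
\<close>

theorem over_independence:
  assumes A: "A \<in> sets M" and "0 < measure M A" "measure M A < 1"
  shows "\<exists>t\<ge>N. 1 \<le> t \<and> (measure M A)\<^sup>2 < measure M (flow (int t) ` A \<inter> A)"
proof (rule ccontr)
  assume neg: "\<not> ?thesis"
  define a where "a = measure M A"
  have le: "measure M (flow (int t) ` A \<inter> A) \<le> a\<^sup>2" if "N \<le> t" "1 \<le> t" for t
    using neg that by (auto simp: a_def not_less)
  define b where "b = min a (1 - a)"
  have b: "b > 0" "b \<le> 1" using assms by (auto simp: b_def a_def)
  define \<kappa> where "\<kappa> = b / 16"
  have \<kappa>: "\<kappa> > 0" using b by (simp add: \<kappa>_def)
  have \<kappa>2: "\<kappa>\<^sup>2 / 2 > 0" using \<kappa> by simp
  obtain q where q: "\<And>n. n \<ge> q \<Longrightarrow> \<exists>S. S \<subseteq> {..<h n} \<and> measure M ((A - level n S) \<union> (level n S - A)) < \<kappa>\<^sup>2 / 2"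
    using level_approximation[OF A \<kappa>2] by blast
  obtain S where S: "S \<subseteq> {..<h q}" "measure M ((A - level q S) \<union> (level q S - A)) < \<kappa>\<^sup>2 / 2"
    using q[OF order_refl] by blast
  define L where "L = level q S"
  define E where "E = (A - L) \<union> (L - A)"
  have Ls: "L \<in> sets M" unfolding L_def by (rule level_sets'[OF S(1)])
  have Es: "E \<in> sets M" using A Ls by (auto simp: E_def)
  have AX: "A \<subseteq> X" using A by (simp add: sets_M)
  have smallE: "2 * measure M E < \<kappa>\<^sup>2" using S(2) by (simp add: E_def L_def)
  have "eventually (\<lambda>n. real (h n) * W n > 1 / 2) sequentially"
    using total_width by (rule order_tendstoD) simp
  then obtain n1 where n1: "\<And>n. n \<ge> n1 \<Longrightarrow> real (h n) * W n > 1 / 2"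
    by (auto simp: eventually_sequentially)
  obtain n2 where n2: "8 / b\<^sup>2 < real n2" using reals_Archimedean2 by blast
  obtain n where n: "n \<ge> max (max n1 n2) (max N q)"
    and nE: "measure M (rigid_part n \<inter> E) \<le> \<kappa> / real (Suc n)"
    using exists_rigid_part_avoiding[OF Es \<kappa> smallE] by blast
  define m where "m = (Suc n)\<^sup>2"
  have me: "2 * m \<le> e n" using e_ge[of n] by (simp add: m_def)
  have mpos: "real m > 0" by (simp add: m_def)
  define C where "C = columns_part n (e n - m)"
  have Cs: "C \<in> sets M" unfolding C_def by (rule columns_part_sets)
  (* C drops the last m rigid columns, so that m steps stay among them; by e_ge these are at most
     half of all. *)
  have mC: "measure M C \<ge> 1 / (4 * real (Suc n))"
  proof -
    have "1 / (4 * real (Suc n)) = 1 / 2 * (1 / 2 * (real (e n) / real (r n)))"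
      unfolding e_div_r by simp
    also have "\<dots> \<le> real (h n) * W n * (real (e n - m) / real (r n))"
    proof (intro mult_mono)
      have "real (e n) \<le> 2 * real (e n - m)" using me by linarith
      then show "1 / 2 * (real (e n) / real (r n)) \<le> real (e n - m) / real (r n)"
        using r_pos[of n] by (simp add: divide_simps)
      show "1 / 2 \<le> real (h n) * W n" using n1[of n] n by simp
      then show "0 \<le> real (h n) * W n" by simp
    qed auto
    also have "\<dots> = measure M C"
      unfolding C_def using e_le_r[of n] by (intro measure_columns_part[symmetric]) simp
    finally show ?thesis .
  qed
  define B where "B k = flow (- int (k * H n)) ` A" for k
  have B_iff: "y \<in> B k \<longleftrightarrow> flow (int (k * H n)) y \<in> A" if "y \<in> X" for y k
    unfolding B_def using that AX by (force simp: image_iff flow_flow flow_0)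
  have BX: "B k \<subseteq> X" for k unfolding B_def using AX flow_in_X by auto
  have Bs: "B k \<in> sets M" "measure M (B k) = a" for k unfolding B_def a_def using flow_M[OF A] by auto
  have BB: "measure M (B k \<inter> B l) \<le> a\<^sup>2" if "k < l" for k l
  proof -
    have "flow (int (l * H n)) ` (B k \<inter> B l) = flow (int (l * H n)) ` B k \<inter> flow (int (l * H n)) ` B l"
      by (rule inj_on_image_Int[OF flow_inj BX BX])
    also have "flow (int (l * H n)) ` B l = A"
      using AX by (force simp: B_def image_image flow_flow flow_0)
    also have "flow (int (l * H n)) ` B k = flow (int ((l - k) * H n)) ` A"
      unfolding B_def image_image
      using AX that by (intro image_cong refl) (auto simp: flow_flow subset_iff diff_mult_distrib algebra_simps)
    finally have "measure M (B k \<inter> B l) = measure M (flow (int ((l - k) * H n)) ` A \<inter> A)"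
      using flow_M(2)[of "B k \<inter> B l" "int (l * H n)"] Bs by auto
    also have "\<dots> \<le> a\<^sup>2"
    proof (rule le)
      have "1 * H n \<le> (l - k) * H n" using that by (intro mult_right_mono) auto
      then show "N \<le> (l - k) * H n" "1 \<le> (l - k) * H n" using H_gt[of n] n by linarith+
    qed
    finally show ?thesis .
  qed
  have BB': "measure M (B k \<inter> B l) - a\<^sup>2 \<le> (if k = l then 1 else 0)" for k l
  proof -
    consider "k < l" | "l < k" | "k = l" by linarith
    then show ?thesis
    proof cases
      case 3
      have "measure M (B k \<inter> B l) \<le> 1" "0 \<le> a\<^sup>2" by simp_all
      then have "measure M (B k \<inter> B l) - a\<^sup>2 \<le> 1" by linarith
      then show ?thesis using 3 by simp
    qed (use BB[of k l] BB[of l k] in \<open>auto simp: Int_commute\<close>)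
  qed
  have int: "integrable M (indicator D :: real \<Rightarrow> real)" if "D \<in> sets M" for D
    using that by (simp add: M.emeasure_eq_measure)
  have eI: "(\<integral>y. indicator D y \<partial>M) = measure M D" if "D \<in> sets M" for D
    using sets.sets_into_space[OF that] by (simp add: Int_absorb2 Int_absorb1)
  define G where "G y = (\<Sum>k<m. indicator (B k) y - a)" for y
  define c where "c k l y = indicator (B k \<inter> B l) y - a * indicator (B k) y - a * indicator (B l) y + a\<^sup>2" for k l y
  have GG: "G y ^ 2 = (\<Sum>k<m. \<Sum>l<m. c k l y)" for y
    unfolding G_def c_def power2_eq_square sum_product
    by (intro sum.cong refl) (simp add: indicator_inter_arith algebra_simps)
  have ic: "integrable M (c k l)" for k l
    unfolding c_def using Bs
    by (intro Bochner_Integration.integrable_add Bochner_Integration.integrable_diff integrable_mult_right int) auto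
  have ec: "(\<integral>y. c k l y \<partial>M) = measure M (B k \<inter> B l) - a\<^sup>2" for k l
  proof -
    have "(\<integral>y. c k l y \<partial>M) = (\<integral>y. indicator (B k \<inter> B l) y \<partial>M) - a * (\<integral>y. indicator (B k) y \<partial>M)
        - a * (\<integral>y. indicator (B l) y \<partial>M) + a\<^sup>2"
      unfolding c_def using Bs int by (simp add: M.prob_space)
    also have "\<dots> = measure M (B k \<inter> B l) - a\<^sup>2"
      using Bs by (simp add: eI power2_eq_square del: integral_indicator)
    finally show ?thesis .
  qed
  have iGG: "integrable M (\<lambda>y. G y ^ 2)" unfolding GG using ic by simp
  have "(\<integral>y. G y ^ 2 \<partial>M) = (\<Sum>k<m. \<Sum>l<m. measure M (B k \<inter> B l) - a\<^sup>2)"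
    unfolding GG using ic ec by simp
  also have "\<dots> \<le> (\<Sum>k<m. \<Sum>l<m. if k = l then 1 else 0)" by (intro sum_mono BB')
  also have "\<dots> = real m" by simp
  finally have upper: "(\<integral>y. G y ^ 2 \<partial>M) \<le> real m" .
  define P where "P k = C \<inter> flow (- int (k * H n)) ` E" for k
  have EX: "E \<subseteq> X" using Es by (simp add: sets_M)
  have Ps: "P k \<in> sets M" for k unfolding P_def using Cs flow_M(1)[OF Es] by auto
  have CX: "C \<subseteq> X" using Cs by (simp add: sets_M)
  have P_iff: "y \<in> P k \<longleftrightarrow> flow (int (k * H n)) y \<in> E" if "y \<in> C" for y k
    unfolding P_def using that EX CX by (force simp: image_iff flow_flow flow_0)
  have mP: "measure M (P k) \<le> \<kappa> / real (Suc n)" if "k < m" for k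
  proof -
    have "flow (int (k * H n)) ` P k \<subseteq> rigid_part n \<inter> E"
    proof (intro image_subsetI IntI)
      fix y assume y: "y \<in> P k"
      then have yC: "y \<in> C" by (simp add: P_def)
      then show "flow (int (k * H n)) y \<in> E" using P_iff y by blast
      show "flow (int (k * H n)) y \<in> rigid_part n"
        using yC me that by (intro rigid_return[of y n m k]) (auto simp: C_def)
    qed
    then have "measure M (flow (int (k * H n)) ` P k) \<le> measure M (rigid_part n \<inter> E)"
      using rigid_part_sets Es by (intro M.finite_measure_mono) auto
    then show ?thesis using flow_M(2)[OF Ps] nE by simp
  qed
  have pointwise: "(real m * b)\<^sup>2 * indicator C y - 2 * (real m * b) * (\<Sum>k<m. indicator (P k) y) \<le> G y ^ 2"
    if yX: "y \<in> X" for y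
  proof (cases "y \<in> C")
    case False
    then show ?thesis by (simp add: P_def)
  next
    case True
    define v where "v = indicator L y - a"
    define Er where "Er = (\<Sum>k<m. indicator (P k) y :: real)"
    have Er0: "0 \<le> Er" by (simp add: Er_def sum_nonneg)
    have vb: "b \<le> \<bar>v\<bar>" using assms by (auto simp: v_def b_def a_def indicator_def)
    have "\<bar>(indicator (B k) y - a) - v\<bar> \<le> indicator (P k) y" if k: "k < m" for k
    proof -
      let ?z = "flow (int (k * H n)) y"
      have yC: "y \<in> columns_part n (e n - m)" using True by (simp add: C_def)
      have "m \<le> e n" "k \<le> m" using me k by auto
      note ret = rigid_return[OF yC this]
      have zX: "?z \<in> X" by (rule flow_in_X[OF yX])
      have "q \<le> n" using n by simp
      then have "L = level n (refined q S n)" unfolding L_def by (rule level_refined[OF S(1)])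
      then have "?z \<in> L \<longleftrightarrow> y \<in> L"
        using ret zX yX by (simp add: level_def cells_def in_tower_def)
      then show ?thesis
        using B_iff[OF yX, of k] P_iff[OF True, of k]
        by (auto simp: v_def E_def indicator_def)
    qed
    then have "(\<Sum>k<m. \<bar>(indicator (B k) y - a) - v\<bar>) \<le> Er" unfolding Er_def by (intro sum_mono) simp
    then have "\<bar>\<Sum>k<m. (indicator (B k) y - a) - v\<bar> \<le> Er" by (rule order.trans[OF sum_abs])
    then have "\<bar>G y - real m * v\<bar> \<le> Er" by (simp add: G_def sum_subtractf)
    moreover have "real m * b \<le> \<bar>real m * v\<bar>" using vb by (simp add: abs_mult mult_left_mono)
    ultimately have G: "real m * b - Er \<le> \<bar>G y\<bar>" by linarith
    have "(real m * b)\<^sup>2 - 2 * (real m * b) * Er \<le> G y ^ 2"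
    proof (cases "Er \<le> real m * b")
      case True
      then have "(real m * b - Er)\<^sup>2 \<le> \<bar>G y\<bar>\<^sup>2" using G by (intro power_mono) auto
      then show ?thesis by (simp add: power2_diff) (smt (verit) zero_le_power2)
    next
      case False
      have "0 \<le> real m * b" using b by simp
      then have "real m * b * (real m * b - 2 * Er) \<le> 0"
        using False Er0 by (intro mult_nonneg_nonpos) auto
      then have "(real m * b)\<^sup>2 - 2 * (real m * b) * Er \<le> 0" by (simp add: power2_eq_square algebra_simps)
      then show ?thesis by (rule order.trans) simp
    qed
    then show ?thesis using True by (simp add: Er_def)
  qed
  have "(\<integral>y. (real m * b)\<^sup>2 * indicator C y - 2 * (real m * b) * (\<Sum>k<m. indicator (P k) y) \<partial>M)
      \<le> (\<integral>y. G y ^ 2 \<partial>M)"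
    using Ps Cs pointwise
    by (intro integral_mono Bochner_Integration.integrable_diff integrable_mult_right
        Bochner_Integration.integrable_sum int iGG) (auto simp: space_M)
  also have "(\<integral>y. (real m * b)\<^sup>2 * indicator C y - 2 * (real m * b) * (\<Sum>k<m. indicator (P k) y) \<partial>M)
     = (real m * b)\<^sup>2 * measure M C - 2 * (real m * b) * (\<Sum>k<m. measure M (P k))"
    using Ps Cs int by (simp add: eI del: integral_indicator)
  finally have "(real m * b)\<^sup>2 * measure M C - 2 * (real m * b) * (\<Sum>k<m. measure M (P k)) \<le> real m"
    using upper by simp
  moreover have "(real m * b)\<^sup>2 * (1 / (4 * real (Suc n))) \<le> (real m * b)\<^sup>2 * measure M C"
    by (intro mult_left_mono mC) simp
  moreover have "2 * (real m * b) * (\<Sum>k<m. measure M (P k)) \<le> 2 * (real m * b) * (real m * (\<kappa> / real (Suc n)))"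
  proof (rule mult_left_mono)
    have "(\<Sum>k<m. measure M (P k)) \<le> (\<Sum>k<m. \<kappa> / real (Suc n))" using mP by (intro sum_mono) simp
    then show "(\<Sum>k<m. measure M (P k)) \<le> real m * (\<kappa> / real (Suc n))" by simp
  qed (use b in simp)
  ultimately have total: "(real m * b)\<^sup>2 * (1 / (4 * real (Suc n)))
     - 2 * (real m * b) * (real m * (\<kappa> / real (Suc n))) \<le> real m" by linarith
  have value_eq: "(real m * b)\<^sup>2 * (1 / (4 * real (Suc n))) - 2 * (real m * b) * (real m * (\<kappa> / real (Suc n)))
     = real m * (real (Suc n) * b\<^sup>2 / 8)"
  proof -
    have "real m = real (Suc n) * real (Suc n)" by (simp only: m_def power2_eq_square of_nat_mult)
    then show ?thesis by (simp add: \<kappa>_def power2_eq_square field_simps del: of_nat_Suc)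
  qed
  from total have "real (Suc n) * b\<^sup>2 / 8 \<le> 1"
    unfolding value_eq by (simp only: mpos mult_le_cancel_left2)
  moreover have "real n2 * b\<^sup>2 \<le> real (Suc n) * b\<^sup>2" using n by (intro mult_right_mono) auto
  moreover have "8 < real n2 * b\<^sup>2" using n2 b by (simp add: field_simps)
  ultimately show False by linarith
qed

end

section \<open>Existence of the parameters\<close>

text \<open>
  The parameters are chosen by recursion: \<open>e n\<close> and \<open>x n\<close> depend only on \<open>n\<close> and \<open>K n\<close>, and they
  determine the next lengths.
\<close>

lemma exists_block_structure:
  "\<exists>e h K x. block_structure e h K x \<and> (\<forall>n. 4 ^ n \<le> e n)"
proof -
  define good where "good n K e x \<longleftrightarrow> (\<forall>i. x i < K) \<and> (\<forall>i<e. x i = 0) \<and>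
     (\<forall>k\<ge>1. \<forall>\<psi> :: nat \<Rightarrow> nat \<Rightarrow> real. (\<forall>a<K. \<forall>b<K. \<bar>\<psi> a b\<bar> \<le> 1) \<longrightarrow>
        \<bar>(\<Sum>i<Suc n * e - k. \<psi> (x i) (x (i + k)))
           - real (Suc n * e - k) / real K ^ 2 * (\<Sum>a<K. \<Sum>b<K. \<psi> a b)\<bar> \<le> 3 * real e)"
    for n K e :: nat and x :: "nat \<Rightarrow> nat"
  define admissible where "admissible n K ex \<longleftrightarrow>
      2 * (Suc n)\<^sup>2 \<le> fst ex \<and> 4 ^ n \<le> fst ex \<and> good n K (fst ex) (snd ex)" for n K ex
  have "\<exists>ex. K > 0 \<longrightarrow> admissible n K ex" for n K
  proof (cases "K > 0")
    case True
    from exists_spacer_word[OF this, of n] obtain E where E: "\<And>e. e \<ge> E \<Longrightarrow> \<exists>x. good n K e x"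
      unfolding good_def by blast
    define e where "e = max E (max (2 * (Suc n)\<^sup>2) (4 ^ n))"
    have e: "E \<le> e" "2 * (Suc n)\<^sup>2 \<le> e" "4 ^ n \<le> e" unfolding e_def by linarith+
    obtain x where "good n K e x" using E[OF e(1)] by blast
    then show ?thesis using e by (intro exI[of _ "(e, x)"]) (simp add: admissible_def)
  qed simp
  then have "\<forall>n. \<exists>f. \<forall>K. K > 0 \<longrightarrow> admissible n K (f K)" by (intro allI choice) simp
  then have "\<exists>c. \<forall>n K. K > 0 \<longrightarrow> admissible n K (c n K)" by (rule choice)
  then obtain c where c: "\<And>n K. K > 0 \<Longrightarrow> admissible n K (c n K)" by auto
  define st where "st = rec_nat (1 :: nat, 1 :: nat)
    (\<lambda>n (h, K). (Suc n * fst (c n K) * (h + K), 2 ^ n * (h + K)))"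
  define h where "h n = fst (st n)" for n
  define K where "K n = snd (st n)" for n
  have st_Suc: "st (Suc n) = (Suc n * fst (c n (K n)) * (h n + K n), 2 ^ n * (h n + K n))" for n
    by (simp add: st_def h_def K_def split: prod.split)
  have Kpos: "K n > 0" for n
  proof (induction n)
    case 0
    then show ?case by (simp add: K_def st_def)
  next
    case (Suc n)
    then show ?case unfolding K_def[of "Suc n"] st_Suc by simp
  qed
  define e where "e n = fst (c n (K n))" for n
  define x where "x n = snd (c n (K n))" for n
  have good: "good n (K n) (e n) (x n)" "2 * (Suc n)\<^sup>2 \<le> e n" "4 ^ n \<le> e n" for n
    using c[OF Kpos, of n n] by (auto simp: e_def x_def admissible_def)
  have "block_structure e h K x"
  proof
    show "h 0 = 1" "K 0 = 1" by (simp_all add: h_def K_def st_def)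
    show "h (Suc n) = Suc n * e n * (h n + K n)" "K (Suc n) = 2 ^ n * (h n + K n)" for n
      unfolding h_def[of "Suc n"] K_def[of "Suc n"] st_Suc by (simp_all add: e_def)
    show "2 * (Suc n)\<^sup>2 \<le> e n" for n by (rule good(2))
    show "x n i < K n" for n i using good(1) by (simp add: good_def)
    show "x n i = 0" if "i < e n" for n i using good(1)[of n] that by (simp add: good_def)
    show "\<bar>(\<Sum>i<Suc n * e n - k. \<psi> (x n i) (x n (i + k)))
           - real (Suc n * e n - k) / real (K n) ^ 2 * (\<Sum>a<K n. \<Sum>b<K n. \<psi> a b)\<bar> \<le> 3 * real (e n)"
      if "1 \<le> k" "\<And>a b. a < K n \<Longrightarrow> b < K n \<Longrightarrow> \<bar>\<psi> a b\<bar> \<le> (1::real)" for n k \<psi>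
      using good(1)[of n] that unfolding good_def by blast
  qed
  then show ?thesis using good(3) by blast
qed

text \<open>
  From stage \<open>n\<close> to \<open>n + 1\<close> the measure of the tower grows by the factor \<open>1 + K n / h n\<close>. The growth
  condition on \<open>e\<close> makes these ratios summable, so the total is finite and can be scaled to one.
\<close>

lemma (in block_structure) exists_widths:
  assumes "\<And>n. 4 ^ n \<le> e n"
  shows "\<exists>W. cut_and_stack e h K x W"
proof -
  define R where "R n = (\<Prod>i<n. real (r i))" for n
  define c where "c n = real (h n) / R n" for n
  define d where "d n = real (K n) / real (h n)" for n
  have Rpos: "R n > 0" for n unfolding R_def using r_pos by (intro prod_pos) auto
  have hpos: "real (h n) > 0" for n using h_pos by simp
  have R_Suc: "R (Suc n) = R n * real (r n)" for n by (simp add: R_def)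
  have c_Suc: "c (Suc n) = c n * (1 + d n)" for n
    using Rpos[of n] r_pos[of n] hpos[of n] by (simp add: c_def d_def R_Suc h_Suc' H_def field_simps)
  have d0: "d n \<ge> 0" for n by (simp add: d_def)
  have d_le: "d n \<le> 2 * (1 / 2) ^ n" for n
  proof (cases n)
    case 0
    then show ?thesis by (simp add: d_def h_0 K_0)
  next
    case (Suc m)
    have "4 ^ m \<le> r m" using assms[of m] by (simp add: r_def trans_le_add1)
    then have 4: "(4 :: real) ^ m \<le> real (r m)" by (metis of_nat_le_iff of_nat_numeral of_nat_power)
    have "d n = 2 ^ m / real (r m)"
      using h_pos[of m] by (simp add: d_def Suc K_Suc h_Suc' H_def[symmetric]) (simp add: H_def)
    also have "\<dots> \<le> 2 ^ m / 4 ^ m" using 4 r_pos[of m] by (intro divide_left_mono) auto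
    also have "\<dots> = (1 / 2) ^ m" by (simp add: power_divide[symmetric])
    also have "\<dots> = 2 * (1 / 2) ^ n" by (simp add: Suc)
    finally show ?thesis .
  qed
  have c1: "c 0 = 1" by (simp add: c_def h_0 R_def)
  have cpos: "c n > 0" for n unfolding c_def using hpos Rpos by simp
  have c_exp: "c n \<le> exp (\<Sum>i<n. d i)" for n
  proof (induction n)
    case (Suc n)
    have "c (Suc n) \<le> exp (\<Sum>i<n. d i) * exp (d n)"
      unfolding c_Suc using Suc d0[of n] by (intro mult_mono exp_ge_add_one_self) auto
    then show ?case by (simp add: exp_add)
  qed (simp add: c1)
  have bound: "c n \<le> exp 4" for n
  proof -
    have "(\<Sum>i<n. d i) \<le> (\<Sum>i<n. 2 * (1 / 2) ^ i)" by (intro sum_mono d_le)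
    also have "\<dots> = 2 * (\<Sum>i<n. (1 / 2 :: real) ^ i)" by (simp add: sum_distrib_left)
    also have "(\<Sum>i<n. (1 / 2 :: real) ^ i) \<le> 2" by (simp add: sum_gp_strict)
    finally have "(\<Sum>i<n. d i) \<le> 4" by simp
    then show ?thesis using c_exp[of n] by (meson exp_le_cancel_iff order.trans)
  qed
  have inc: "incseq c"
  proof (rule incseq_SucI)
    fix n
    have "c n * 1 \<le> c n * (1 + d n)" using cpos[of n] d0[of n] by (intro mult_left_mono) auto
    then show "c n \<le> c (Suc n)" by (simp add: c_Suc)
  qed
  obtain l where l: "c \<longlonglongrightarrow> l" "\<And>n. c n \<le> l" using incseq_convergent[OF inc, of "exp 4"] bound by auto
  have lpos: "l > 0" using l(2)[of 0] c1 by simp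
  define W where "W n = 1 / (l * R n)" for n
  have "cut_and_stack e h K x W"
  proof
    show "W n > 0" for n using lpos Rpos by (simp add: W_def)
    show "W n = real (Suc n * e n) * W (Suc n)" for n
      unfolding r_def[symmetric] using lpos Rpos[of n] r_pos[of n] by (simp add: W_def R_Suc)
    have "(\<lambda>n. c n / l) \<longlonglongrightarrow> l / l" using l(1) lpos by (intro tendsto_divide tendsto_const) auto
    then show "(\<lambda>n. real (h n) * W n) \<longlonglongrightarrow> 1" using lpos by (simp add: W_def c_def mult.commute)
  qed
  then show ?thesis by blast
qed

section \<open>The transformation\<close>

context cut_and_stack
begin

text \<open>
  The space is a conull subset of the unit interval, so the identity is the required isomorphism.
\<close>

lemma M_lebesgue_prob_space: "lebesgue_prob_space M"
proof -
  define V where "V = {0..1} - X"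
  have V: "V \<in> null_sets (lebesgue_on {0..1::real})"
  proof -
    have "({0..<1} - X) \<union> {1} \<in> null_sets lebesgue" using X_conull by (intro null_sets.Un) auto
    moreover have "V \<in> sets lebesgue" using X_lebesgue by (auto simp: V_def)
    ultimately have "V \<in> null_sets lebesgue" by (rule null_sets_subset) (auto simp: V_def)
    then show ?thesis by (subst null_sets_restrict_space) (auto simp: V_def)
  qed
  have 1: "restrict_space M (space M - {}) = lebesgue_on X"
    using X_lebesgue by (simp add: space_M M_def restrict_restrict_space)
  have 2: "restrict_space (lebesgue_on {0..1}) (space (lebesgue_on {0..1}) - V) = lebesgue_on X"
  proof -
    have "{0..1} - V = X" using X_subset by (auto simp: V_def)
    moreover have "{0..1} \<inter> X = X" using X_subset by auto
    ultimately show ?thesis using X_lebesgue by (simp add: restrict_restrict_space)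
  qed
  have "measure_isomorphism (lebesgue_on X) (lebesgue_on X) id"
    unfolding measure_isomorphism_def
  proof (intro conjI)
    have "the_inv_into X id y = y" if "y \<in> X" for y
      using the_inv_into_f_f[of id X y] that by simp
    then have "the_inv_into (space (lebesgue_on X)) id \<in> measurable (lebesgue_on X) (lebesgue_on X)
        \<longleftrightarrow> id \<in> measurable (lebesgue_on X) (lebesgue_on X)"
      by (intro measurable_cong) simp
    then show "the_inv_into (space (lebesgue_on X)) id \<in> measurable (lebesgue_on X) (lebesgue_on X)"
      by (simp add: id_def)
    show "distr (lebesgue_on X) (lebesgue_on X) id = lebesgue_on X" by (simp add: id_def)
  qed (auto simp: id_def bij_betw_def)
  then have "\<exists>f. measure_isomorphism (restrict_space M (space M - {}))
      (restrict_space (lebesgue_on {0..1::real}) (space (lebesgue_on {0..1::real}) - V)) f"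
    unfolding 1 2 by (rule exI[of _ id])
  then have "isomorphic_mod_null M (lebesgue_on {0..1::real})"
    unfolding isomorphic_mod_null_def using V null_sets.empty_sets[of M] by blast
  then show ?thesis by (simp add: lebesgue_prob_space_def prob_space_M)
qed

lemma flow_vimage:
  assumes "A \<subseteq> X"
  shows "flow t -` A \<inter> X = flow (- t) ` A"
  using assms flow_in_X by (force simp: image_iff flow_flow flow_0)

lemma flow_measurable: "flow t \<in> measurable M M"
proof (rule measurableI)
  fix A assume A: "A \<in> sets M"
  then have "A \<subseteq> X" by (simp add: sets_M)
  then show "flow t -` A \<inter> space M \<in> sets M"
    unfolding space_M flow_vimage using flow_M(1)[OF A] flow_vimage by simp
qed (simp add: space_M flow_in_X)

lemma flow_invertible_measure_preserving: "invertible_measure_preserving M (flow t)"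
  unfolding invertible_measure_preserving_def measure_isomorphism_def
proof (intro conjI)
  show "bij_betw (flow t) (space M) (space M)" unfolding space_M by (rule flow_bij)
  show "flow t \<in> measurable M M" by (rule flow_measurable)
  have "the_inv_into X (flow t) y = flow (- t) y" if "y \<in> X" for y
    using that flow_in_X by (intro the_inv_into_f_eq[OF flow_inj]) (auto simp: flow_flow flow_0)
  then have "the_inv_into (space M) (flow t) \<in> measurable M M \<longleftrightarrow> flow (- t) \<in> measurable M M"
    unfolding space_M by (intro measurable_cong) (simp add: space_M)
  then show "the_inv_into (space M) (flow t) \<in> measurable M M" using flow_measurable by simp
  show "distr M M (flow t) = M"
  proof (rule measure_eqI)
    fix A assume A: "A \<in> sets (distr M M (flow t))"
    then have AM: "A \<in> sets M" and AX: "A \<subseteq> X" by (auto simp: sets_M)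
    have "emeasure (distr M M (flow t)) A = emeasure M (flow t -` A \<inter> space M)"
      by (rule emeasure_distr[OF flow_measurable AM])
    also have "\<dots> = emeasure M A" unfolding space_M flow_vimage[OF AX] by (rule flow_M(3)[OF AM])
    finally show "emeasure (distr M M (flow t)) A = emeasure M A" .
  qed simp
qed

lemma flow_strong_mixing: "strong_mixing M (flow 1)"
  unfolding strong_mixing_def
proof (intro ballI)
  fix A B assume A: "A \<in> sets M" and B: "B \<in> sets M"
  then have "A \<subseteq> X" by (simp add: sets_M)
  then show "(\<lambda>n. measure M ((flow 1 ^^ n) ` A \<inter> B)) \<longlonglongrightarrow> measure M A * measure M B"
    by (simp only: flow_funpow_image flow_mixing[OF A B])
qed

end

theorem theorem4p1:
  "\<exists>(M :: real measure) (T :: real \<Rightarrow> real).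
     lebesgue_prob_space M \<and>
     invertible_measure_preserving M T \<and>
     strong_mixing M T \<and>
     (\<forall>A\<in>sets M. 0 < measure M A \<and> measure M A < 1 \<longrightarrow>
        infinite {n::nat. 1 \<le> n \<and> measure M ((T ^^ n) ` A \<inter> A) - (measure M A)\<^sup>2 > 0})"
proof -
  obtain e h K x where "block_structure e h K x" "\<And>n. 4 ^ n \<le> e n"
    using exists_block_structure by blast
  then obtain W where "cut_and_stack e h K x W"
    using block_structure.exists_widths by blast
  then interpret cut_and_stack e h K x W .
  have "infinite {n::nat. 1 \<le> n \<and> measure M ((flow 1 ^^ n) ` A \<inter> A) - (measure M A)\<^sup>2 > 0}"
    if A: "A \<in> sets M" "0 < measure M A" "measure M A < 1" for A
    unfolding infinite_nat_iff_unbounded_le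
  proof
    fix N
    have "A \<subseteq> X" using A(1) by (simp add: sets_M)
    with over_independence[OF A, of N]
    show "\<exists>n\<ge>N. n \<in> {n::nat. 1 \<le> n \<and> measure M ((flow 1 ^^ n) ` A \<inter> A) - (measure M A)\<^sup>2 > 0}"
      by (auto simp: flow_funpow_image)
  qed
  then show ?thesis
    using M_lebesgue_prob_space flow_invertible_measure_preserving flow_strong_mixing by blast
qed

end
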